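(* Let $r\geq 1$ and $q\ge1$ be integers, and let $X$ be a finite $r$-dimensional simplicial complex such that one of the following holds: (1) $X$ is a $q$-thick spherical building admitting a strongly transitive action; (2) the universal covering of $X$ is a $q$-thick affine building of dimension $\geq2$ admitting a strongly transitive action, and the labeling of its vertices (by the vertices of its Coxeter diagram) descends to $X$. Let $w$ denote the canonical weight function of $X$, let $T$ denote the Coxeter diagram of the building mentioned in (1) or (2), put $m=m(T)$, and assume $q\geq r^2(m-2)$. Then for every nontrivial abelian group $R$, $(X,w,R_X)$ is a $\left(1-\frac{\sqrt{m-2}}{\sqrt q-(r-1)\sqrt{m-2}}\right)$-coboundary expander in dimension $0$, i.e. $$\mathrm{cbe}_0(X,w,R_X)\geq 1-\frac{\sqrt{m-2}}{\sqrt q-(r-1)\sqrt{m-2}}.$$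
   Context: Buildings (as in Abramenko--Brown, "Buildings"): a building is a (possibly infinite) simplicial complex $X$ that is the union of a collection $\mathcal{E}$ of subcomplexes, called apartments, each a Coxeter complex, such that any two faces lie in a common apartment and any two apartments containing given faces $x,y$ are isomorphic via an isomorphism fixing $x$ and $y$ pointwise. All apartments are isomorphic to one Coxeter complex, encoded by a Coxeter diagram $T=T(X)$, a finite graph whose edges are labelled by elements of $\{3,4,5,\dots\}\cup\{\infty\}$ (unlabelled edges have label $3$). The vertices of $X$ are labelled by the vertices of $T$, making $X$ a pure $(r+1)$-partite complex with $r=\dim X=|V(T)|-1$. Let $B$ be the real $V(T)\times V(T)$ matrix with $B_{u,u}=1$, $B_{u,v}=-\cos(\pi/k)$ if $\{u,v\}$ is an edge of $T$ labelled $k$, and $B_{u,v}=0$ otherwise. $X$ is spherical if $B$ is positive definite (equivalently, apartments are finite), and affine if $B$ is positive semidefinite of rank $|V(T)|-1$. A building of dimension $r$ is $q$-thick if every $(r-1)$-face is contained in at least $q$ $r$-faces. $X$ admits a strongly transitive action if there is a group $G$ acting on $X$ by type-preserving (label-preserving) simplicial automorphisms that takes apartments to apartments and acts transitively on the pairs $(A,x)$ with $A\in\mathcal{E}$ and $x$ an $r$-face of $A$. Put $m(T)=\max(\{2\}\cup\{n: T\text{ has an edge labelled }n\})$. Simplicial complexes contain the empty face; $X(i)$ is the set of faces of dimension $i$ (cardinality $i+1$). The canonical weight function of a pure $r$-dimensional finite complex $X$ is $w(x)=\binom{r+1}{\dim x+1}^{-1}\frac{|\{y\in X(r):y\supseteq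 x\}|}{|X(r)|}$ for $x\in X$; for $A\subseteq X$, $w(A)=\sum_{a\in A}w(a)$. Coboundary expansion in dimension $0$ with constant coefficients $R$ ($R_X$ is the constant sheaf): fix a linear order on the vertices and, for an edge $e$, let $e^+,e^-$ be its larger and smaller vertex. Let $C^0=R^{X(0)}$, $C^1=R^{X(1)}$, $(d_0f)(e)=f(e^+)-f(e^-)$, and $B^0\subseteq C^0$ the set of constant functions. For $f\in C^i$ put $\|f\|_w=w(\{x\in X(i): f(x)\neq 0\})$ and $\mathrm{dist}_w(f,B^0)=\min_{g\in B^0}\|f-g\|_w$. $\mathrm{cbe}_0(X,w,R_X)$ is the supremum of all $\varepsilon\in[0,\infty)$ with $\|d_0f\|_w\ge\varepsilon\,\mathrm{dist}_w(f,B^0)$ for all $f\in C^0$; $(X,w,R_X)$ is an $\varepsilon$-coboundary expander in dimension $0$ if $\mathrm{cbe}_0(X,w,R_X)\ge\varepsilon$. *)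

theory Defs
  imports "HOL-Analysis.Analysis" "HOL-Algebra.Generated_Groups" "HOL-Algebra.Group_Action"
begin

section \<open>Simplicial complexes\<close>

definition abstract_simplicial_complex :: "'v set set \<Rightarrow> bool" where
  "abstract_simplicial_complex X \<longleftrightarrow> {} \<in> X \<and> (\<forall>x\<in>X. finite x \<and> (\<forall>y. y \<subseteq> x \<longrightarrow> y \<in> X))"

abbreviation vertices :: "'v set set \<Rightarrow> 'v set" where
  "vertices X \<equiv> \<Union> X"

definition faces :: "'v set set \<Rightarrow> nat \<Rightarrow> 'v set set" where
  "faces X i = {x \<in> X. card x = i + 1}"

definition has_dimension :: "'v set set \<Rightarrow> nat \<Rightarrow> bool" where
  "has_dimension X d \<longleftrightarrow> faces X d \<noteq> {} \<and> (\<forall>x\<in>X. card x \<le> d + 1)"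

definition simplicial_iso :: "('v \<Rightarrow> 'w) \<Rightarrow> 'v set set \<Rightarrow> 'w set set \<Rightarrow> bool" where
  "simplicial_iso f X Y \<longleftrightarrow> bij_betw f (vertices X) (vertices Y) \<and> (`) f ` X = Y"


section \<open>Coxeter diagrams and Coxeter groups\<close>

text \<open>
  A diagram with vertex set the finite type \<open>'t\<close>: \<open>T u v = Some k\<close> means that
  \<open>{u, v}\<close> is an edge labelled \<open>k\<close>, and \<open>T u v = None\<close> that it is not an edge.
\<close>
type_synonym 't coxeter_diagram = "'t \<Rightarrow> 't \<Rightarrow> enat option"

definition is_coxeter_diagram :: "'t::finite coxeter_diagram \<Rightarrow> bool" where
  "is_coxeter_diagram T \<longleftrightarrow>
     (\<forall>u. T u u = None) \<and> (\<forall>u v. T u v = T v u) \<and> (\<forall>u v k. T u v = Some k \<longrightarrow> 3 \<le> k)"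

definition max_label :: "'t::finite coxeter_diagram \<Rightarrow> enat" where
  "max_label T = Max ({2} \<union> {k. \<exists>u v. T u v = Some k})"

definition gram_entry :: "enat \<Rightarrow> real" where
  "gram_entry k = (case k of enat n \<Rightarrow> - cos (pi / real n) | \<infinity> \<Rightarrow> - 1)"

definition gram_matrix :: "'t::finite coxeter_diagram \<Rightarrow> real^'t^'t" where
  "gram_matrix T =
     (\<chi> u v. if u = v then 1 else case T u v of None \<Rightarrow> 0 | Some k \<Rightarrow> gram_entry k)"

definition spherical_diagram :: "'t::finite coxeter_diagram \<Rightarrow> bool" where
  "spherical_diagram T \<longleftrightarrow> (\<forall>x. x \<noteq> 0 \<longrightarrow> x \<bullet> (gram_matrix T *v x) > 0)"

definition affine_diagram :: "'t::finite coxeter_diagram \<Rightarrow> bool" where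
  "affine_diagram T \<longleftrightarrow>
     (\<forall>x. x \<bullet> (gram_matrix T *v x) \<ge> 0) \<and> rank (gram_matrix T) = CARD('t) - 1"

definition coxeter_matrix :: "'t::finite coxeter_diagram \<Rightarrow> 't \<Rightarrow> 't \<Rightarrow> enat" where
  "coxeter_matrix T s t = (if s = t then 1 else case T s t of None \<Rightarrow> 2 | Some k \<Rightarrow> k)"

text \<open>
  The Coxeter group is presented by the generators \<open>'t\<close> with the relations
  \<open>(s t)\<^sup>m = 1\<close> for \<open>m = coxeter_matrix T s t\<close> finite.  As the case \<open>s = t\<close> makes every
  generator an involution, words without inverses suffice.
\<close>
inductive coxeter_step :: "'t::finite coxeter_diagram \<Rightarrow> 't list \<Rightarrow> 't list \<Rightarrow> bool"
  for T where
  "coxeter_matrix T s t = enat n \<Longrightarrow> coxeter_step T (a @ concat (replicate n [s, t]) @ b) (a @ b)"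

definition coxeter_rel :: "'t::finite coxeter_diagram \<Rightarrow> 't list rel" where
  "coxeter_rel T = {(a, b). equivclp (coxeter_step T) a b}"

definition coxeter_group :: "'t::finite coxeter_diagram \<Rightarrow> 't list set monoid" where
  "coxeter_group T =
     \<lparr>carrier = UNIV // coxeter_rel T,
      mult = (\<lambda>A B. \<Union>a\<in>A. \<Union>b\<in>B. coxeter_rel T `` {a @ b}),
      one = coxeter_rel T `` {[]}\<rparr>"

definition coxeter_generator :: "'t::finite coxeter_diagram \<Rightarrow> 't \<Rightarrow> 't list set" where
  "coxeter_generator T s = coxeter_rel T `` {[s]}"

lemma equiv_coxeter_rel: "equiv UNIV (coxeter_rel T)"
  unfolding coxeter_rel_def
  by (auto intro!: equivI refl_onI symI transI intro: equivclp_sym equivclp_trans simp: equivclp_refl)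

lemma coxeter_step_context: "coxeter_step T x y \<Longrightarrow> coxeter_step T (c @ x @ d) (c @ y @ d)"
proof (induction rule: coxeter_step.induct)
  case (1 s t n a b)
  then show ?case using coxeter_step.intros[of T s t n "c @ a" "b @ d"] by simp
qed

lemma coxeter_rel_context:
  assumes "(x, y) \<in> coxeter_rel T"
  shows "(c @ x @ d, c @ y @ d) \<in> coxeter_rel T"
proof -
  have "equivclp (coxeter_step T) x y" using assms by (simp add: coxeter_rel_def)
  then have "equivclp (coxeter_step T) (c @ x @ d) (c @ y @ d)"
  proof (induction rule: equivclp_induct)
    case base
    then show ?case by (simp add: equivclp_refl)
  next
    case (step y z)
    then show ?case
      by (meson coxeter_step_context equivclp_into_equivclp)
  qed
  then show ?thesis by (simp add: coxeter_rel_def)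
qed

lemma coxeter_rel_append:
  assumes "(x, y) \<in> coxeter_rel T" and "(x', y') \<in> coxeter_rel T"
  shows "(x @ x', y @ y') \<in> coxeter_rel T"
  using coxeter_rel_context[OF assms(1), of "[]" x'] coxeter_rel_context[OF assms(2), of y "[]"]
    equivE[OF equiv_coxeter_rel] by (metis append.left_neutral append_Nil2 transD)

lemma coxeter_group_mult:
  "coxeter_rel T `` {a} \<otimes>\<^bsub>coxeter_group T\<^esub> coxeter_rel T `` {b} = coxeter_rel T `` {a @ b}"
proof -
  have "congruent2 (coxeter_rel T) (coxeter_rel T) (\<lambda>a b. coxeter_rel T `` {a @ b})"
    by (auto intro!: congruent2I' equiv_class_eq[OF equiv_coxeter_rel] coxeter_rel_append)
  from UN_equiv_class2[OF equiv_coxeter_rel equiv_coxeter_rel this, of a b]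
  show ?thesis by (simp add: coxeter_group_def)
qed

lemma coxeter_rel_rev: "(rev a @ a, []) \<in> coxeter_rel T"
proof (induction a)
  case Nil
  then show ?case using equivE[OF equiv_coxeter_rel] by (metis UNIV_I append.left_neutral refl_onD rev.simps(1))
next
  case (Cons s a)
  have "coxeter_step T (rev a @ concat (replicate 1 [s, s]) @ a) (rev a @ a)"
    by (rule coxeter_step.intros) (simp add: coxeter_matrix_def one_enat_def)
  then have "(rev (s # a) @ s # a, rev a @ a) \<in> coxeter_rel T"
    by (auto simp: coxeter_rel_def intro: r_into_equivclp)
  then show ?case using Cons equivE[OF equiv_coxeter_rel] by (metis transD)
qed

lemma group_coxeter_group: "group (coxeter_group T)"
proof (rule groupI)
  have car: "x \<in> carrier (coxeter_group T) \<longleftrightarrow> (\<exists>a. x = coxeter_rel T `` {a})" for x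
    by (auto simp: coxeter_group_def quotient_def)
  have one: "\<one>\<^bsub>coxeter_group T\<^esub> = coxeter_rel T `` {[]}"
    by (simp add: coxeter_group_def)
  show "\<one>\<^bsub>coxeter_group T\<^esub> \<in> carrier (coxeter_group T)"
    using car one by blast
  fix x assume "x \<in> carrier (coxeter_group T)"
  then obtain a where a: "x = coxeter_rel T `` {a}" using car by blast
  show "\<one>\<^bsub>coxeter_group T\<^esub> \<otimes>\<^bsub>coxeter_group T\<^esub> x = x"
    by (simp add: one a coxeter_group_mult)
  show "\<exists>y\<in>carrier (coxeter_group T). y \<otimes>\<^bsub>coxeter_group T\<^esub> x = \<one>\<^bsub>coxeter_group T\<^esub>"
  proof (rule bexI)
    show "coxeter_rel T `` {rev a} \<otimes>\<^bsub>coxeter_group T\<^esub> x = \<one>\<^bsub>coxeter_group T\<^esub>"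
      using equiv_class_eq[OF equiv_coxeter_rel coxeter_rel_rev]
      by (simp add: one a coxeter_group_mult)
    show "coxeter_rel T `` {rev a} \<in> carrier (coxeter_group T)" using car by blast
  qed
  fix y assume "y \<in> carrier (coxeter_group T)"
  then obtain b where b: "y = coxeter_rel T `` {b}" using car by blast
  show "x \<otimes>\<^bsub>coxeter_group T\<^esub> y \<in> carrier (coxeter_group T)"
    using car by (auto simp: a b coxeter_group_mult)
  fix z assume "z \<in> carrier (coxeter_group T)"
  then obtain c where c: "z = coxeter_rel T `` {c}" using car by blast
  show "x \<otimes>\<^bsub>coxeter_group T\<^esub> y \<otimes>\<^bsub>coxeter_group T\<^esub> z =
        x \<otimes>\<^bsub>coxeter_group T\<^esub> (y \<otimes>\<^bsub>coxeter_group T\<^esub> z)"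
    by (simp add: a b c coxeter_group_mult)
qed


section \<open>Coxeter complexes and buildings\<close>

text \<open>
  The simplex belonging to a standard coset \<open>w W\<^sub>J\<close> is represented by its set of vertices,
  the cosets \<open>w W\<^bsub>S - {s}\<^esub>\<close> with \<open>s \<notin> J\<close>; so the faces are the subsets of the chambers,
  and reverse inclusion of cosets becomes inclusion of faces.
\<close>
definition coxeter_vertex :: "'t::finite coxeter_diagram \<Rightarrow> 't \<Rightarrow> 't list set \<Rightarrow> 't list set set" where
  "coxeter_vertex T s w =
     w <#\<^bsub>coxeter_group T\<^esub> generate (coxeter_group T) (coxeter_generator T ` (UNIV - {s}))"

definition coxeter_complex :: "'t::finite coxeter_diagram \<Rightarrow> 't list set set set set" where
  "coxeter_complex T =
     {x. \<exists>w \<in> carrier (coxeter_group T). x \<subseteq> {coxeter_vertex T s w | s. s \<in> UNIV}}"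

text \<open>\<open>E\<close> is the collection of apartments.\<close>
definition building :: "'t::finite coxeter_diagram \<Rightarrow> 'v set set \<Rightarrow> 'v set set set \<Rightarrow> bool" where
  "building T X E \<longleftrightarrow>
     is_coxeter_diagram T \<and> abstract_simplicial_complex X \<and> X = \<Union> E \<and>
     (\<forall>A\<in>E. abstract_simplicial_complex A \<and> (\<exists>f. simplicial_iso f A (coxeter_complex T))) \<and>
     (\<forall>x\<in>X. \<forall>y\<in>X. \<exists>A\<in>E. x \<in> A \<and> y \<in> A) \<and>
     (\<forall>A\<in>E. \<forall>A'\<in>E. \<forall>x\<in>A \<inter> A'. \<forall>y\<in>A \<inter> A'.
        \<exists>f. simplicial_iso f A A' \<and> (\<forall>v\<in>x \<union> y. f v = v))"

text \<open>
  \<open>\<tau>\<close> labels the vertices of a building by the vertices of \<open>T\<close>: every apartment can be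
  identified with the Coxeter complex in such a way that the vertices labelled \<open>s\<close> are the
  cosets of \<open>W\<^bsub>S - {s}\<^esub>\<close>.
\<close>
definition building_labelling ::
    "'t::finite coxeter_diagram \<Rightarrow> 'v set set set \<Rightarrow> ('v \<Rightarrow> 't) \<Rightarrow> bool" where
  "building_labelling T E \<tau> \<longleftrightarrow>
     (\<forall>A\<in>E. \<exists>f. simplicial_iso f A (coxeter_complex T) \<and>
        (\<forall>v\<in>vertices A. \<exists>w\<in>carrier (coxeter_group T). f v = coxeter_vertex T (\<tau> v) w))"

text \<open>
  Faces of dimension \<open>d - 1\<close> have cardinality \<open>d\<close>.  Buildings may be infinite, where
  \<open>card\<close> is \<open>0\<close>; so an infinite set of chambers is admitted separately.
\<close>
definition thick :: "nat \<Rightarrow> nat \<Rightarrow> 'v set set \<Rightarrow> bool" where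
  "thick q d X \<longleftrightarrow>
     (\<forall>x\<in>X. card x = d \<longrightarrow>
        infinite {y \<in> faces X d. x \<subseteq> y} \<or> q \<le> card {y \<in> faces X d. x \<subseteq> y})"

definition strongly_transitive_action ::
    "nat \<Rightarrow> 'v set set \<Rightarrow> 'v set set set \<Rightarrow> ('v \<Rightarrow> 't) \<Rightarrow> 'g monoid \<Rightarrow> ('g \<Rightarrow> 'v \<Rightarrow> 'v) \<Rightarrow> bool" where
  "strongly_transitive_action d X E \<tau> G \<phi> \<longleftrightarrow>
     group_action G (vertices X) \<phi> \<and>
     (\<forall>g\<in>carrier G. simplicial_iso (\<phi> g) X X \<and> (\<forall>v\<in>vertices X. \<tau> (\<phi> g v) = \<tau> v) \<and>
        (\<forall>A\<in>E. (`) (\<phi> g) ` A \<in> E)) \<and>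
     (\<forall>A\<in>E. \<forall>A'\<in>E. \<forall>x\<in>faces A d. \<forall>x'\<in>faces A' d.
        \<exists>g\<in>carrier G. (`) (\<phi> g) ` A = A' \<and> \<phi> g ` x = x')"

text \<open>
  Restricting the type of the group loses nothing, because an acting group can be
  replaced by its image in the group of bijections of the vertex set.
\<close>
definition admits_strongly_transitive_action ::
    "nat \<Rightarrow> 'v set set \<Rightarrow> 'v set set set \<Rightarrow> ('v \<Rightarrow> 't) \<Rightarrow> bool" where
  "admits_strongly_transitive_action d X E \<tau> \<longleftrightarrow>
     (\<exists>(G :: ('v \<Rightarrow> 'v) monoid) \<phi>. strongly_transitive_action d X E \<tau> G \<phi>)"


section \<open>Universal coverings\<close>

definition edge_path :: "'v set set \<Rightarrow> 'v list \<Rightarrow> bool" where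
  "edge_path Y p \<longleftrightarrow> p \<noteq> [] \<and> set p \<subseteq> vertices Y \<and> successively (\<lambda>u v. {u, v} \<in> Y) p"

text \<open>Edge paths may repeat vertices: \<open>{u, v, w}\<close> need not have three elements below.\<close>
inductive elementary_homotopy :: "'v set set \<Rightarrow> 'v list \<Rightarrow> 'v list \<Rightarrow> bool" for Y where
  triangle: "{u, v, w} \<in> Y \<Longrightarrow> elementary_homotopy Y (a @ [u, v, w] @ b) (a @ [u, w] @ b)"
| repetition: "{u} \<in> Y \<Longrightarrow> elementary_homotopy Y (a @ [u, u] @ b) (a @ [u] @ b)"

definition connected_complex :: "'v set set \<Rightarrow> bool" where
  "connected_complex Y \<longleftrightarrow> vertices Y \<noteq> {} \<and>
     (\<forall>u\<in>vertices Y. \<forall>v\<in>vertices Y. \<exists>p. edge_path Y p \<and> hd p = u \<and> last p = v)"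

text \<open>The edge-path group is trivial.\<close>
definition simply_connected_complex :: "'v set set \<Rightarrow> bool" where
  "simply_connected_complex Y \<longleftrightarrow> connected_complex Y \<and>
     (\<forall>p. edge_path Y p \<and> hd p = last p \<longrightarrow> equivclp (elementary_homotopy Y) p [hd p])"

text \<open>
  The star condition forces \<open>\<pi>\<close> to be injective on every face: an edge \<open>{v, u}\<close> with
  \<open>\<pi> v = \<pi> u\<close> would have the same image as \<open>{v}\<close>.
\<close>
definition simplicial_covering :: "('u \<Rightarrow> 'v) \<Rightarrow> 'u set set \<Rightarrow> 'v set set \<Rightarrow> bool" where
  "simplicial_covering \<pi> Y X \<longleftrightarrow>
     abstract_simplicial_complex Y \<and> abstract_simplicial_complex X \<and> \<pi> ` vertices Y = vertices X \<and>
     (\<forall>y\<in>Y. \<pi> ` y \<in> X) \<and>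
     (\<forall>v\<in>vertices Y. bij_betw ((`) \<pi>) {y \<in> Y. v \<in> y} {x \<in> X. \<pi> v \<in> x})"

definition universal_covering :: "('u \<Rightarrow> 'v) \<Rightarrow> 'u set set \<Rightarrow> 'v set set \<Rightarrow> bool" where
  "universal_covering \<pi> Y X \<longleftrightarrow> simplicial_covering \<pi> Y X \<and> simply_connected_complex Y"


section \<open>Coboundary expansion in dimension 0\<close>

definition canonical_weight :: "nat \<Rightarrow> 'v set set \<Rightarrow> 'v set \<Rightarrow> real" where
  "canonical_weight r X x =
     inverse (real ((r + 1) choose card x)) *
     (real (card {y \<in> faces X r. x \<subseteq> y}) / real (card (faces X r)))"

text \<open>
  Cochains are functions on \<open>faces X i\<close>, extended by \<open>0\<close>; a vertex \<open>v\<close> is identified with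
  the face \<open>{v}\<close>.
\<close>
definition cochains :: "'v set set \<Rightarrow> nat \<Rightarrow> ('v set \<Rightarrow> 'a::ab_group_add) set" where
  "cochains X i = {f. \<forall>x. x \<notin> faces X i \<longrightarrow> f x = 0}"

definition constant_cochains :: "'v set set \<Rightarrow> ('v set \<Rightarrow> 'a::ab_group_add) set" where
  "constant_cochains X = {f \<in> cochains X 0. \<exists>c. \<forall>x\<in>faces X 0. f x = c}"

text \<open>\<open>L\<close> is a linear order on the vertices.\<close>
definition larger_vertex :: "'v rel \<Rightarrow> 'v set \<Rightarrow> 'v" where
  "larger_vertex L e = (THE v. v \<in> e \<and> (\<forall>u\<in>e. (u, v) \<in> L))"

definition smaller_vertex :: "'v rel \<Rightarrow> 'v set \<Rightarrow> 'v" where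
  "smaller_vertex L e = (THE v. v \<in> e \<and> (\<forall>u\<in>e. (v, u) \<in> L))"

definition coboundary0 ::
    "'v rel \<Rightarrow> 'v set set \<Rightarrow> ('v set \<Rightarrow> 'a::ab_group_add) \<Rightarrow> 'v set \<Rightarrow> 'a" where
  "coboundary0 L X f e =
     (if e \<in> faces X 1 then f {larger_vertex L e} - f {smaller_vertex L e} else 0)"

definition cochain_norm ::
    "'v set set \<Rightarrow> ('v set \<Rightarrow> real) \<Rightarrow> nat \<Rightarrow> ('v set \<Rightarrow> 'a::ab_group_add) \<Rightarrow> real" where
  "cochain_norm X w i f = (\<Sum>x\<in>{x \<in> faces X i. f x \<noteq> 0}. w x)"

definition dist_constant ::
    "'v set set \<Rightarrow> ('v set \<Rightarrow> real) \<Rightarrow> ('v set \<Rightarrow> 'a::ab_group_add) \<Rightarrow> real" where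
  "dist_constant X w f =
     Min {cochain_norm X w 0 (\<lambda>x. f x - g x) | g. g \<in> constant_cochains X}"

definition cbe0 ::
    "'a::ab_group_add itself \<Rightarrow> 'v rel \<Rightarrow> 'v set set \<Rightarrow> ('v set \<Rightarrow> real) \<Rightarrow> ereal" where
  "cbe0 R L X w =
     Sup {ereal \<epsilon> | \<epsilon>. 0 \<le> \<epsilon> \<and>
       (\<forall>f :: 'v set \<Rightarrow> 'a. f \<in> cochains X 0 \<longrightarrow>
          cochain_norm X w 1 (coboundary0 L X f) \<ge> \<epsilon> * dist_constant X w f)}"

definition coboundary_expander0 ::
    "real \<Rightarrow> 'a::ab_group_add itself \<Rightarrow> 'v rel \<Rightarrow> 'v set set \<Rightarrow> ('v set \<Rightarrow> real) \<Rightarrow> bool" where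
  "coboundary_expander0 \<epsilon> R L X w \<longleftrightarrow> ereal \<epsilon> \<le> cbe0 R L X w"

end

theory Submission
  imports Defs
begin

text \<open>
  Let \<open>C\<close> be the set of chambers of \<open>X\<close>, labelled by the types in \<open>T\<close>.  For each type \<open>s\<close>, summing
  over the chambers that are \<open>s\<close>-adjacent to a given one is an operator on real functions on \<open>C\<close>.
  In the building, the Weyl distance shows that these operators satisfy the braid relations, and
  strong transitivity makes the number of \<open>s\<close>-adjacent chambers constant; both properties are
  local, so they descend along the covering.  The braid relation of \<open>s\<close> and \<open>t\<close>, restricted to the
  plane spanned by a maximising pair of vectors, bounds the cosine of the angle between the
  \<open>s\<close>-invariant and the \<open>t\<close>-invariant functions by \<open>sqrt ((m - 2) / q)\<close>, without the theorem of Feit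
  and Higman.  These bounds trickle down to the functions of the vertices of \<open>X\<close>, which are the
  functions invariant under all types but one, and the resulting spectral gap is applied to the
  indicator functions of the values of a cochain.
\<close>

section \<open>Words in the Coxeter generators\<close>

text \<open>The constant comes from a recursion. For two types the cosine is at most
  \<open>\<mu> = sqrt ((m - 2) / q)\<close>; each further type turns a bound \<open>l\<close> into
  \<open>l / (1 - l)\<close>, which lowers its reciprocal by one. From 2 to \<open>r + 1\<close>
  types there are \<open>r - 1\<close> such steps, so the end value is
  \<open>\<mu> / (1 - (r - 1) * \<mu>)\<close>, the fraction in the theorem. The hypothesis on
  \<open>q\<close> says \<open>r * \<mu> \<le> 1\<close>; at equality the claimed expansion is 0 and
  holds trivially. Two obstacles shape the proof. The inequality behind the recursion also admits
  \<open>L = 1\<close>, so a strict bound must be known beforehand: a maximum is attained by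
  compactness, and 1 is impossible because a function invariant under two complementary sets of
  types is orthogonal to itself. And the braid relation needs that alternating galleries up to the
  order of \<open>s t\<close> never reach a chamber twice; this is a statement on reduced words, for
  which the exchange condition and the reflection representation are developed first. In the plane
  of a maximising pair, the product of the two operators is a 2 by 2 matrix whose determinant is
  known and whose trace encodes the cosine; the braid relation becomes an equation for the
  trace.\<close>

fun alt :: "nat \<Rightarrow> 'a \<Rightarrow> 'a \<Rightarrow> 'a list" where
  "alt 0 s t = []"
| "alt (Suc n) s t = s # alt n t s"

lemma length_alt [simp]: "length (alt n s t) = n"
  by (induction n s t rule: alt.induct) auto

lemma set_alt: "set (alt n s t) \<subseteq> {s, t}"
  by (induction n s t rule: alt.induct) auto

lemma alt_add: "alt (m + n) s t = alt m s t @ (if even m then alt n s t else alt n t s)"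
  by (induction m s t rule: alt.induct) auto

lemma alt_snoc: "alt (Suc n) s t = alt n s t @ [if even n then s else t]"
  using alt_add[of n 1 s t] by simp

lemma rev_alt: "rev (alt n s t) = (if even n then alt n t s else alt n s t)"
proof (induction n s t rule: alt.induct)
  case (2 n s t)
  have "rev (alt (Suc n) s t) = rev (alt n t s) @ [s]" by simp
  also have "\<dots> = (if even n then alt n s t else alt n t s) @ [s]" using 2 by simp
  finally show ?case using alt_snoc[of n s t] alt_snoc[of n t s]
    by (cases "even n") (simp_all del: alt.simps)
qed simp

lemma concat_replicate_alt: "concat (replicate n [s, t]) = alt (2 * n) s t"
  by (induction n) auto

text \<open>The shift by \<open>n\<close> pairs each index of the first half with one of the second
  half. It will apply to the reflections crossed by a relator of length \<open>2 * n\<close>, which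
  repeat with period \<open>n\<close>.\<close>

lemma card_shift_even:
  fixes n :: nat
  assumes "\<And>i. P (i + n) \<longleftrightarrow> P i"
  shows "even (card {i. i < 2 * n \<and> P i})"
proof -
  have "{i. i < 2 * n \<and> P i} = {i. i < n \<and> P i} \<union> (\<lambda>i. i + n) ` {i. i < n \<and> P i}" (is "_ = ?A \<union> ?B")
  proof (intro Set.set_eqI iffI)
    fix i assume "i \<in> {i. i < 2 * n \<and> P i}"
    then show "i \<in> ?A \<union> ?B"
      using assms[of "i - n"] by (cases "i < n") (auto intro!: image_eqI[of _ _ "i - n"])
  qed (use assms in auto)
  moreover have "card (?A \<union> ?B) = card ?A + card ?B"
    by (intro card_Un_disjoint) auto
  moreover have "card ?B = card ?A" by (intro card_image) (auto simp: inj_on_def)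
  ultimately show ?thesis by simp
qed

section \<open>Words up to equality in the Coxeter group\<close>

locale coxeter_words =
  fixes T :: "'t::finite coxeter_diagram"
  assumes coxeter_diagram: "is_coxeter_diagram T"
begin

text \<open>Group elements are handled as words modulo this congruence, so that letters, lengths and
  list inductions stay available; \<open>rev\<close> plays the inverse because generators are
  involutions.\<close>

definition weq :: "'t list \<Rightarrow> 't list \<Rightarrow> bool" (infix "\<doteq>" 50) where
  "a \<doteq> b \<longleftrightarrow> (a, b) \<in> coxeter_rel T"

lemma weq_refl [simp]: "a \<doteq> a"
  unfolding weq_def using equivE[OF equiv_coxeter_rel[of T]] by (metis UNIV_I refl_onD)

lemma weq_sym: "a \<doteq> b \<Longrightarrow> b \<doteq> a"
  unfolding weq_def using equivE[OF equiv_coxeter_rel[of T]] by (metis symD)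

lemma weq_trans [trans]: "a \<doteq> b \<Longrightarrow> b \<doteq> c \<Longrightarrow> a \<doteq> c"
  unfolding weq_def using equivE[OF equiv_coxeter_rel[of T]] by (metis transD)

lemma weq_append: "a \<doteq> b \<Longrightarrow> a' \<doteq> b' \<Longrightarrow> a @ a' \<doteq> b @ b'"
  unfolding weq_def by (rule coxeter_rel_append)

lemma weq_Cons: "a \<doteq> b \<Longrightarrow> s # a \<doteq> s # b"
  using weq_append[of "[s]" "[s]" a b] by simp

lemma rev_append_weq: "rev a @ a \<doteq> []" unfolding weq_def by (rule coxeter_rel_rev)

lemma append_rev_weq: "a @ rev a \<doteq> []" using rev_append_weq[of "rev a"] by simp

lemma weq_cancel_left: "a @ b \<doteq> a @ c \<longleftrightarrow> b \<doteq> c"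
proof
  assume "a @ b \<doteq> a @ c"
  then have 1: "rev a @ a @ b \<doteq> rev a @ a @ c" by (simp add: weq_append)
  have "rev a @ a @ x \<doteq> x" for x
    using weq_append[OF rev_append_weq weq_refl, of a x] by simp
  then show "b \<doteq> c" by (meson 1 weq_sym weq_trans)
qed (simp add: weq_append)

lemma weq_rev_left: "rev a @ b \<doteq> c \<longleftrightarrow> b \<doteq> a @ c"
proof -
  have "rev a @ b \<doteq> c \<longleftrightarrow> a @ (rev a @ b) \<doteq> a @ c" by (simp add: weq_cancel_left)
  also have "\<dots> \<longleftrightarrow> b \<doteq> a @ c"
    using weq_append[OF append_rev_weq weq_refl, of a b] by (simp) (meson weq_sym weq_trans)
  finally show ?thesis .
qed

lemma weq_rev: "a \<doteq> b \<Longrightarrow> rev a \<doteq> rev b"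
proof -
  assume "a \<doteq> b"
  then have "a @ rev b \<doteq> b @ rev b" by (simp add: weq_append)
  also have "\<dots> \<doteq> []" by (rule append_rev_weq)
  finally have "[] \<doteq> a @ rev b" by (rule weq_sym)
  then show ?thesis using weq_rev_left[of a "[]" "rev b"] by simp
qed

lemma weq_rev_iff: "rev a \<doteq> rev b \<longleftrightarrow> a \<doteq> b"
  using weq_rev[of a b] weq_rev[of "rev a" "rev b"] by auto

lemma weq_cancel_right: "b @ a \<doteq> c @ a \<longleftrightarrow> b \<doteq> c"
  using weq_rev_iff[of "b @ a" "c @ a"] weq_cancel_left[of "rev a" "rev b" "rev c"] weq_rev_iff[of b c]
  by simp

lemma weq_rev_right: "b @ rev a \<doteq> c \<longleftrightarrow> b \<doteq> c @ a"
proof -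
  have "b @ rev a \<doteq> c \<longleftrightarrow> rev (b @ rev a) \<doteq> rev c" by (simp only: weq_rev_iff)
  also have "\<dots> \<longleftrightarrow> a @ rev b \<doteq> rev c" by simp
  also have "\<dots> \<longleftrightarrow> rev b \<doteq> rev a @ rev c" using weq_rev_left[of "rev a" "rev b" "rev c"] by simp
  also have "\<dots> \<longleftrightarrow> b \<doteq> c @ a" using weq_rev_iff[of b "c @ a"] by simp
  finally show ?thesis .
qed

lemma Cons_weq_iff: "s # a \<doteq> b \<longleftrightarrow> a \<doteq> s # b"
  using weq_rev_left[of "[s]" a b] by simp

lemma snoc_weq_iff: "a @ [s] \<doteq> b \<longleftrightarrow> a \<doteq> b @ [s]"
  using weq_rev_right[of a "[s]" b] by simp

lemma Cons_Cons_weq: "s # s # a \<doteq> a"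
  using Cons_weq_iff[of s "s # a" a] by simp

lemma conj_weq_iff: "p @ a @ rev p \<doteq> b \<longleftrightarrow> a \<doteq> rev p @ b @ p"
  using weq_rev_right[of "p @ a" p b] weq_rev_left[of "rev p" a "b @ p"] by simp

text \<open>Every relator has even length, so the parity of the length is a character of the
  group.\<close>

lemma weq_even_length: "a \<doteq> b \<Longrightarrow> even (length a) \<longleftrightarrow> even (length b)"
proof -
  have step: "coxeter_step T x y \<Longrightarrow> even (length x) \<longleftrightarrow> even (length y)" for x y
    by (induction rule: coxeter_step.induct) (simp add: concat_replicate_alt)
  assume "a \<doteq> b"
  then have "equivclp (coxeter_step T) a b" by (simp add: weq_def coxeter_rel_def)
  then show ?thesis by (induction rule: equivclp_induct) (use step in blast)+
qed

subsection \<open>Reflections and the exchange condition\<close>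

text \<open>
  The word \<open>s\<^sub>1 \<dots> s\<^sub>n\<close> crosses the walls of the reflections \<open>s\<^sub>1 \<dots> s\<^sub>i \<dots> s\<^sub>1\<close>; \<open>crosses a r\<close>
  says that the reflection \<open>r\<close> occurs an odd number of times among these.
\<close>
fun crosses :: "'t list \<Rightarrow> 't list \<Rightarrow> bool" where
  "crosses [] r = False"
| "crosses (s # a) r = (([s] \<doteq> r) \<noteq> crosses a ([s] @ r @ [s]))"

lemma crosses_cong: "r \<doteq> r' \<Longrightarrow> crosses a r = crosses a r'"
proof (induction a arbitrary: r r')
  case (Cons s a)
  have "[s] @ r @ [s] \<doteq> [s] @ r' @ [s]" using Cons.prems by (intro weq_append weq_refl)
  moreover have "[s] \<doteq> r \<longleftrightarrow> [s] \<doteq> r'" using Cons.prems by (meson weq_sym weq_trans)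
  ultimately show ?case using Cons.IH by (simp del: append_Cons append_Nil)
qed simp

text \<open>The cocycle rule of inversion sets: after walking \<open>a\<close>, the walls met by
  \<open>b\<close> are the translates of those it meets from the base chamber, and two crossings of
  one wall cancel.\<close>

lemma crosses_append: "crosses (a @ b) r = (crosses a r \<noteq> crosses b (rev a @ r @ a))"
  by (induction a arbitrary: r) auto

text \<open>Counting from zero, the \<open>i\<close>-th wall crossed by an alternating word has the
  palindrome \<open>alt (2 * i + 1) s t\<close> as its reflection.\<close>

lemma crosses_alt: "crosses (alt n s t) r \<longleftrightarrow> odd (card {i. i < n \<and> alt (2 * i + 1) s t \<doteq> r})"
proof (induction n s t arbitrary: r rule: alt.induct)
  case (2 n s t)
  have eq: "alt (2 * Suc i + 1) s t \<doteq> r \<longleftrightarrow> alt (2 * i + 1) t s \<doteq> [s] @ r @ [s]" for i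
  proof -
    have "alt (2 * Suc i + 1) s t = [s] @ alt (2 * i + 1) t s @ rev [s]"
      using alt_snoc[of "2 * i + 1" t s] by simp
    then show ?thesis using conj_weq_iff[of "[s]" "alt (2 * i + 1) t s" r] by (simp del: alt.simps)
  qed
  have "{i. i < Suc n \<and> alt (2 * i + 1) s t \<doteq> r} =
        (if [s] \<doteq> r then {0} else {}) \<union> Suc ` {i. i < n \<and> alt (2 * i + 1) t s \<doteq> [s] @ r @ [s]}"
    (is "?L = ?A \<union> Suc ` ?B")
  proof (intro Set.set_eqI iffI)
    fix i assume "i \<in> ?L"
    then show "i \<in> ?A \<union> Suc ` ?B"
      using eq[of "i - 1"] by (cases i) (auto simp del: alt.simps(2) append_Cons append_Nil, auto)
  next
    fix i assume "i \<in> ?A \<union> Suc ` ?B"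
    then show "i \<in> ?L"
      using eq[of "i - 1"] by (cases i) (auto simp del: append_Cons append_Nil split: if_splits)
  qed
  moreover have "card (?A \<union> Suc ` ?B) = card ?A + card ?B"
    by (subst card_Un_disjoint) (auto simp: card_image)
  ultimately have "odd (card ?L) \<longleftrightarrow> ([s] \<doteq> r) \<noteq> odd (card ?B)" by simp
  then show ?case using "2.IH" by simp
qed simp

text \<open>Since the relator is trivial, the palindromes of its walls repeat with period
  \<open>n\<close>; in two periods each wall is crossed an even number of times.\<close>

lemma crosses_relator:
  assumes "alt (2 * n) s t \<doteq> []"
  shows "\<not> crosses (alt (2 * n) s t) r"
proof -
  have "alt (2 * (i + n) + 1) s t \<doteq> r \<longleftrightarrow> alt (2 * i + 1) s t \<doteq> r" for i
  proof -
    have "alt (2 * (i + n) + 1) s t = alt (2 * n) s t @ alt (2 * i + 1) s t"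
      using alt_add[of "2 * n" "2 * i + 1" s t] by (simp add: algebra_simps)
    moreover have "alt (2 * n) s t @ alt (2 * i + 1) s t \<doteq> [] @ alt (2 * i + 1) s t"
      using assms by (intro weq_append weq_refl)
    ultimately have "alt (2 * (i + n) + 1) s t \<doteq> alt (2 * i + 1) s t" by (simp only: append_Nil)
    then show ?thesis by (meson weq_sym weq_trans)
  qed
  then show ?thesis unfolding crosses_alt using card_shift_even[of "\<lambda>i. alt (2 * i + 1) s t \<doteq> r" n] by blast
qed

text \<open>Inserting a relator changes no parity and no later conjugation. So
  \<open>crosses\<close> is a function on the group although it is computed from a word, which is
  what makes the exchange argument possible.\<close>

lemma crosses_weq:
  assumes "a \<doteq> b"
  shows "crosses a r = crosses b r"
proof -
  have step: "coxeter_step T x y \<Longrightarrow> crosses x r = crosses y r" for x y r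
  proof (induction rule: coxeter_step.induct)
    case (1 s t n a b)
    let ?R = "alt (2 * n) s t"
    have R: "?R \<doteq> []"
      using coxeter_step.intros[OF 1, of "[]" "[]"]
      by (auto simp: weq_def coxeter_rel_def concat_replicate_alt intro: r_into_equivclp)
    let ?r = "rev a @ r @ a"
    have "rev ?R @ ?r @ ?R \<doteq> [] @ ?r @ []"
      using R weq_rev[OF R] by (intro weq_append) auto
    then have "crosses b (rev ?R @ ?r @ ?R) = crosses b ?r" using crosses_cong by simp
    then show ?case
      using crosses_relator[OF R] by (simp add: crosses_append concat_replicate_alt)
  qed
  have "equivclp (coxeter_step T) a b" using assms by (simp add: weq_def coxeter_rel_def)
  then show ?thesis by (induction rule: equivclp_induct) (use step in blast)+
qed

text \<open>Oddly many crossings mean at least one, and left multiplication by the reflection that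
  belongs to the letter \<open>u\<close> deletes precisely that letter.\<close>

lemma crosses_exchange:
  assumes "crosses a r"
  shows "\<exists>p u q. a = p @ u # q \<and> r \<doteq> p @ [u] @ rev p \<and> r @ a \<doteq> p @ q"
  using assms
proof (induction a arbitrary: r)
  case (Cons s a)
  show ?case
  proof (cases "[s] \<doteq> r")
    case True
    have "r @ s # a \<doteq> s # s # a"
      using weq_append[OF weq_sym[OF True] weq_refl, of "s # a"] by simp
    then have "r @ s # a \<doteq> a" using Cons_Cons_weq[of s a] by (simp add: weq_trans)
    then show ?thesis using weq_sym[OF True] by (intro exI[of _ "[]"]) auto
  next
    case False
    then obtain p u q where *: "a = p @ u # q" "[s] @ r @ [s] \<doteq> p @ [u] @ rev p"
        "([s] @ r @ [s]) @ a \<doteq> p @ q"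
      using Cons.IH[of "[s] @ r @ [s]"] Cons.prems by auto
    have "r \<doteq> (s # p) @ [u] @ rev (s # p)"
    proof -
      have "r @ [s] \<doteq> s # p @ [u] @ rev p" using *(2) by (simp add: Cons_weq_iff)
      then show ?thesis by (simp add: snoc_weq_iff)
    qed
    moreover have "r @ s # a \<doteq> (s # p) @ q" using *(3) by (simp add: Cons_weq_iff)
    ultimately show ?thesis using *(1) by (intro exI[of _ "s # p"] exI[of _ u] exI[of _ q]) simp
  qed
qed simp

section \<open>Reduced words\<close>

definition reduced :: "'t list \<Rightarrow> bool" where
  "reduced a \<longleftrightarrow> (\<forall>b. b \<doteq> a \<longrightarrow> length a \<le> length b)"

lemma ex_reduced: "\<exists>b. b \<doteq> a \<and> reduced b"
proof -
  obtain b where b: "b \<doteq> a" "\<And>c. c \<doteq> a \<Longrightarrow> length b \<le> length c"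
    using ex_has_least_nat[of "\<lambda>b. b \<doteq> a" a length] by auto
  then have "reduced b" unfolding reduced_def by (meson weq_trans)
  with b show ?thesis by blast
qed

lemma reduced_Cons: "reduced (s # a) \<Longrightarrow> reduced a"
  unfolding reduced_def using weq_Cons by fastforce

text \<open>If \<open>s # a\<close> crossed the wall of \<open>s\<close> evenly often,
  \<open>a\<close> would cross it oddly often, and exchange would give a word shorter by
  two.\<close>

lemma reduced_crosses:
  assumes "reduced (s # a)"
  shows "crosses (s # a) [s]"
proof (rule ccontr)
  assume "\<not> crosses (s # a) [s]"
  then have "crosses a [s]"
    using crosses_cong[OF Cons_Cons_weq[of s "[s]"], of a] by simp
  then obtain p u q where "a = p @ u # q" "[s] @ a \<doteq> p @ q" using crosses_exchange by blast
  then have "p @ q \<doteq> s # a" by (simp add: weq_sym)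
  then have "length (s # a) \<le> length (p @ q)" using assms unfolding reduced_def by blast
  then show False using \<open>a = p @ u # q\<close> by simp
qed

end

context coxeter_words
begin

subsection \<open>The reflection representation\<close>

text \<open>A vector is given by its coordinates over the simple roots, and \<open>pairing s\<close>
  is the bilinear form with the root of \<open>s\<close>. The representation is built to tell a
  generator from products of the others.\<close>

definition pairing :: "'t \<Rightarrow> ('t \<Rightarrow> real) \<Rightarrow> real" where
  "pairing s v = (\<Sum>u\<in>UNIV. gram_matrix T $ s $ u * v u)"

definition reflect :: "'t \<Rightarrow> ('t \<Rightarrow> real) \<Rightarrow> 't \<Rightarrow> real" where
  "reflect s v = (\<lambda>u. v u - (if u = s then 2 * pairing s v else 0))"

lemma gram_diag: "gram_matrix T $ u $ u = 1"
  by (simp add: gram_matrix_def)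

lemma gram_sym: "gram_matrix T $ u $ v = gram_matrix T $ v $ u"
  using coxeter_diagram by (auto simp: gram_matrix_def is_coxeter_diagram_def)

lemma gram_offdiag:
  assumes "s \<noteq> t" and "coxeter_matrix T s t = enat m"
  shows "gram_matrix T $ s $ t = - cos (pi / m)" and "m \<ge> 2"
proof -
  have "m \<ge> 2 \<and> gram_matrix T $ s $ t = - cos (pi / m)"
  proof (cases "T s t")
    case None
    then have "m = 2" using assms by (simp add: coxeter_matrix_def) (metis enat.inject numeral_eq_enat)
    with None show ?thesis using assms by (simp add: gram_matrix_def)
  next
    case (Some k)
    then have "k = enat m" using assms by (simp add: coxeter_matrix_def)
    moreover have "3 \<le> k" using coxeter_diagram Some by (auto simp: is_coxeter_diagram_def)
    ultimately have "m \<ge> 3" by (simp add: numeral_eq_enat)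
    then show ?thesis using Some assms \<open>k = enat m\<close> by (simp add: gram_matrix_def gram_entry_def)
  qed
  then show "gram_matrix T $ s $ t = - cos (pi / m)" and "m \<ge> 2" by auto
qed

lemma pairing_diff_unit:
  "pairing t (\<lambda>u. v u - (if u = s then c else 0)) = pairing t v - c * gram_matrix T $ t $ s"
proof -
  have "pairing t (\<lambda>u. v u - (if u = s then c else 0))
      = pairing t v - (\<Sum>u\<in>UNIV. gram_matrix T $ t $ u * (if u = s then c else 0))"
    by (simp add: pairing_def right_diff_distrib sum_subtractf)
  also have "(\<Sum>u\<in>UNIV. gram_matrix T $ t $ u * (if u = s then c else 0)) = c * gram_matrix T $ t $ s"
    by (simp add: if_distrib cong: if_cong)
  finally show ?thesis .
qed

lemma pairing_reflect: "pairing t (reflect s v) = pairing t v - 2 * pairing s v * gram_matrix T $ t $ s"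
  unfolding reflect_def by (rule pairing_diff_unit)

abbreviation act :: "'t list \<Rightarrow> ('t \<Rightarrow> real) \<Rightarrow> 't \<Rightarrow> real" where
  "act a \<equiv> foldr reflect a"

lemma reflect_reflect: "reflect s (reflect s v) = v"
proof
  fix u
  show "reflect s (reflect s v) u = v u"
    using pairing_reflect[of s s v] by (simp add: reflect_def[of s "reflect s v"] gram_diag) (simp add: reflect_def)
qed

text \<open>
  With \<open>\<phi> = \<pi> / m\<close>, the rotation through \<open>2\<phi>\<close> is followed explicitly; the pairings with the
  two roots along an orbit are values of one solution \<open>h\<close> of \<open>h (x + \<phi>) + h (x - \<phi>) = 2 cos \<phi> h x\<close>.
\<close>
lemma act_dihedral:
  assumes st: "s \<noteq> t" and m: "coxeter_matrix T s t = enat m"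
  shows "act (alt (2 * m) s t) v = v"
proof -
  define \<phi> where "\<phi> = pi / m"
  have m2: "m \<ge> 2" using gram_offdiag[OF assms] by simp
  then have "0 < \<phi>" "\<phi> < pi" by (auto simp: \<phi>_def field_simps)
  then have sin: "sin \<phi> \<noteq> 0" using sin_gt_zero by force
  have g: "gram_matrix T $ s $ t = - cos \<phi>" "gram_matrix T $ t $ s = - cos \<phi>"
    using gram_offdiag[OF assms] gram_sym \<phi>_def by auto
  define A where "A = pairing t v"
  \<comment> \<open>Chosen so that \<open>h (- \<phi>) = - pairing s v\<close>, the starting value
    of the orbit; here \<open>sin \<phi>\<close> must not vanish.\<close>
  define B where "B = (pairing s v + pairing t v * cos \<phi>) / sin \<phi>"
  define h where "h = (\<lambda>x. A * cos x + B * sin x)"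
  \<comment> \<open>An antiderivative of \<open>h\<close>: the amounts subtracted by successive
    reflections are multiples of values of \<open>h\<close> and telescope to differences of
    \<open>G\<close>.\<close>
  define G where "G = (\<lambda>x. A * sin x - B * cos x)"
  have hrec: "h (x + \<phi>) = 2 * cos \<phi> * h x - h (x - \<phi>)" for x
    unfolding h_def cos_add sin_add cos_diff sin_diff by (simp add: algebra_simps)
  have Grec: "G (x + \<phi>) = G (x - \<phi>) + 2 * sin \<phi> * h x" for x
    unfolding h_def G_def cos_add sin_add cos_diff sin_diff by (simp add: algebra_simps)
  define x where "x = (\<lambda>n. 2 * real n * \<phi>)"
  have x: "x (Suc n) - \<phi> = x n + \<phi>" "x (Suc n) = (x n + \<phi>) + \<phi>" for n by (auto simp: x_def algebra_simps)
  have "pairing t (act (alt (2 * n) s t) v) = h (x n) \<and> pairing s (act (alt (2 * n) s t) v) = - h (x n - \<phi>)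
     \<and> act (alt (2 * n) s t) v = (\<lambda>u. v u - (if u = t then (G (x n - \<phi>) - G (- \<phi>)) / sin \<phi> else 0)
        - (if u = s then (G (x n) - G 0) / sin \<phi> else 0))" for n
  proof (induction n)
    case 0
    have "h (- \<phi>) = - pairing s v" using sin by (simp add: h_def A_def B_def)
    then show ?case by (auto simp: x_def h_def A_def)
  next
    case (Suc n)
    let ?w = "act (alt (2 * n) s t) v"
    have step: "act (alt (2 * Suc n) s t) v = reflect s (reflect t ?w)" by simp
    have IH: "pairing t ?w = h (x n)" "pairing s ?w = - h (x n - \<phi>)" using Suc by auto
    have p1: "pairing s (reflect t ?w) = h (x n + \<phi>)"
      using hrec[of "x n"] by (simp add: pairing_reflect IH g)
    have p2: "pairing t (reflect t ?w) = - h (x n)" by (simp add: pairing_reflect IH gram_diag)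
    have p3: "pairing s (reflect s (reflect t ?w)) = - h (x n + \<phi>)"
      by (simp add: pairing_reflect[of s s] p1 gram_diag)
    have p4: "pairing t (reflect s (reflect t ?w)) = h (x n + \<phi> + \<phi>)"
      using hrec[of "x n + \<phi>"] by (simp add: pairing_reflect[of t s] p1 p2 g)
    have "reflect s (reflect t ?w) u = v u - (if u = t then (G (x (Suc n) - \<phi>) - G (- \<phi>)) / sin \<phi> else 0)
        - (if u = s then (G (x (Suc n)) - G 0) / sin \<phi> else 0)" for u
    proof -
      have w: "?w u = v u - (if u = t then (G (x n - \<phi>) - G (- \<phi>)) / sin \<phi> else 0)
        - (if u = s then (G (x n) - G 0) / sin \<phi> else 0)" using Suc by metis
      have "reflect s (reflect t ?w) u = ?w u - (if u = t then 2 * h (x n) else 0) - (if u = s then 2 * h (x n + \<phi>) else 0)"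
        unfolding reflect_def[of s "reflect t ?w"] p1 by (simp add: reflect_def[of t ?w] IH)
      moreover have "(G (x (Suc n) - \<phi>) - G (- \<phi>)) / sin \<phi> = (G (x n - \<phi>) - G (- \<phi>)) / sin \<phi> + 2 * h (x n)"
        using Grec[of "x n"] sin by (simp only: x(1)) (simp add: field_simps)
      moreover have "(G (x (Suc n)) - G 0) / sin \<phi> = (G (x n) - G 0) / sin \<phi> + 2 * h (x n + \<phi>)"
        using Grec[of "x n + \<phi>"] sin by (simp only: x(2)) (simp add: field_simps)
      ultimately show ?thesis using w st by simp
    qed
    then have eq: "act (alt (2 * Suc n) s t) v = (\<lambda>u. v u - (if u = t then (G (x (Suc n) - \<phi>) - G (- \<phi>)) / sin \<phi> else 0)
        - (if u = s then (G (x (Suc n)) - G 0) / sin \<phi> else 0))" unfolding step by (rule ext)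
    have "pairing t (act (alt (2 * Suc n) s t) v) = h (x (Suc n))" unfolding step p4 x(2) ..
    moreover have "pairing s (act (alt (2 * Suc n) s t) v) = - h (x (Suc n) - \<phi>)" unfolding step p3 x(1) ..
    ultimately show ?case using eq by blast
  qed
  note closed = this[of m, THEN conjunct2, THEN conjunct2]
  \<comment> \<open>After \<open>m\<close> rotations the angle is a full turn, so both differences
    of \<open>G\<close> vanish.\<close>
  have "x m = 2 * pi" using m2 by (simp add: x_def \<phi>_def)
  moreover have "G (2 * pi - \<phi>) = G (- \<phi>)" "G (2 * pi) = G 0"
    by (simp_all add: G_def sin_diff cos_diff)
  ultimately show ?thesis unfolding closed by (simp cong: if_cong)
qed

lemma act_weq:
  assumes "a \<doteq> b"
  shows "act a = act b"
proof -
  have step: "coxeter_step T x y \<Longrightarrow> act x = act y" for x y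
  proof (induction rule: coxeter_step.induct)
    case (1 s t n a b)
    have "act (alt (2 * n) s t) v = v" for v
    proof (cases "s = t")
      case True
      have "act (alt (2 * n) s s) v = v"
        by (induction n) (auto simp: reflect_reflect)
      with True show ?thesis by simp
    qed (use act_dihedral 1 in blast)
    then have "act (alt (2 * n) s t) = (\<lambda>v. v)" by (rule ext)
    then show ?case by (simp add: concat_replicate_alt comp_def)
  qed
  have "equivclp (coxeter_step T) a b" using assms by (simp add: weq_def coxeter_rel_def)
  then show ?thesis by (induction rule: equivclp_induct) (use step in metis)+
qed

lemma act_other: "s \<notin> set a \<Longrightarrow> act a v s = v s"
  by (induction a) (auto simp: reflect_def)

text \<open>\<open>reflect s\<close> turns the root of \<open>s\<close> into its negative, whereas a
  word without \<open>s\<close> cannot change the coordinate at \<open>s\<close>.\<close>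

lemma generator_weq_in_set:
  assumes "[s] \<doteq> a"
  shows "s \<in> set a"
proof (rule ccontr)
  assume "s \<notin> set a"
  let ?v = "\<lambda>u. if u = s then 1 else (0::real)"
  have "pairing s ?v = 1" by (simp add: pairing_def gram_diag if_distrib cong: if_cong)
  then have "act [s] ?v s = - 1" by (simp add: reflect_def)
  then show False using act_weq[OF assms] act_other[OF \<open>s \<notin> set a\<close>, of ?v] by simp
qed

lemma generator_not_weq: "\<not> [s] \<doteq> []" "s \<noteq> t \<Longrightarrow> \<not> [s] \<doteq> [t]"
  using generator_weq_in_set[of s "[]"] generator_weq_in_set[of s "[t]"] by auto

subsection \<open>Parabolic subgroups\<close>

text \<open>Exchange shows that the first letter of the reduced word occurs in \<open>b\<close>, and
  removing it costs \<open>b\<close> one letter, so induction applies. Hence the letters of a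
  reduced word depend on the element alone, and parabolic subgroups intersect as their sets of
  generators do.\<close>

lemma reduced_set_subset: "reduced a \<Longrightarrow> a \<doteq> b \<Longrightarrow> set a \<subseteq> set b"
proof (induction a arbitrary: b)
  case (Cons s a)
  have "crosses b [s]" using reduced_crosses[OF Cons.prems(1)] crosses_weq[OF Cons.prems(2)] by blast
  then obtain p u q where *: "b = p @ u # q" "[s] \<doteq> p @ [u] @ rev p" "[s] @ b \<doteq> p @ q"
    using crosses_exchange by blast
  have "s \<in> set b" using generator_weq_in_set[OF *(2)] *(1) by auto
  have "a \<doteq> s # b" using Cons.prems(2) by (simp add: Cons_weq_iff)
  also have "\<dots> \<doteq> p @ q" using *(3) by simp
  finally have "set a \<subseteq> set (p @ q)" using Cons reduced_Cons by blast
  then show ?case using \<open>s \<in> set b\<close> *(1) by auto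
qed simp

text \<open>Membership in the maximal parabolic subgroup generated by the types other than
  \<open>u\<close>, the stabiliser of a vertex of type \<open>u\<close>.\<close>

definition avoids :: "'t \<Rightarrow> 't list \<Rightarrow> bool" where
  "avoids u a \<longleftrightarrow> (\<exists>b. a \<doteq> b \<and> u \<notin> set b)"

lemma avoidsI: "u \<notin> set a \<Longrightarrow> avoids u a"
  unfolding avoids_def using weq_refl by blast

lemma avoids_weq: "a \<doteq> b \<Longrightarrow> avoids u a = avoids u b"
  unfolding avoids_def by (meson weq_sym weq_trans)

lemma not_avoids_generator: "\<not> avoids s [s]"
  unfolding avoids_def using generator_weq_in_set by blast

text \<open>A reduced word for \<open>a\<close> has its letters in each of the avoiding words, so
  only \<open>s\<close> can occur; a word with \<open>s\<close> twice would not be reduced.\<close>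

lemma avoids_all_but_one:
  assumes "\<And>u. u \<noteq> s \<Longrightarrow> avoids u a"
  shows "a \<doteq> [] \<or> a \<doteq> [s]"
proof -
  obtain b where b: "b \<doteq> a" "reduced b" using ex_reduced by blast
  have "set b \<subseteq> {s}"
  proof
    fix u assume "u \<in> set b"
    show "u \<in> {s}"
    proof (rule ccontr)
      assume "u \<notin> {s}"
      then obtain c where "a \<doteq> c" "u \<notin> set c" using assms[of u] unfolding avoids_def by auto
      then have "set b \<subseteq> set c" using b reduced_set_subset weq_trans by blast
      with \<open>u \<in> set b\<close> \<open>u \<notin> set c\<close> show False by blast
    qed
  qed
  then have rep: "replicate (length b) s = b" by (intro replicate_eqI[symmetric]) auto
  have "length b < 2"
  proof (rule ccontr)
    assume "\<not> length b < 2"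
    then obtain l where "length b = Suc (Suc l)" using le_Suc_ex[of 2 "length b"] by auto
    then obtain c where "b = s # s # c" using rep by (cases b; cases "tl b") auto
    then have "c \<doteq> b" using Cons_Cons_weq weq_sym by blast
    then show False using b(2) \<open>b = s # s # c\<close> by (auto simp: reduced_def)
  qed
  then have "length b = 0 \<or> length b = 1" by linarith
  then have "b = [] \<or> b = [s]"
  proof
    assume "length b = 1"
    then show ?thesis using rep by simp
  qed simp
  then show ?thesis using b weq_sym by blast
qed

lemma avoids_all:
  assumes "\<And>u. avoids u a"
  shows "a \<doteq> []"
proof -
  fix s
  have "\<not> a \<doteq> [s]" for s using assms[of s] avoids_weq not_avoids_generator by blast
  then show ?thesis using avoids_all_but_one[of undefined a] assms by blast
qed

subsection \<open>Dihedral subgroups\<close>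

lemma alt_weq_Nil_swap: "alt (2 * n) s t \<doteq> [] \<Longrightarrow> alt (2 * n) t s \<doteq> []"
  using weq_rev[of "alt (2 * n) s t" "[]"] by (simp add: rev_alt)

lemma word_weq_alt:
  assumes "set z \<subseteq> {s, t}"
  shows "\<exists>j\<le>length z. z \<doteq> alt j s t \<or> z \<doteq> alt j t s"
  using assms
proof (induction z)
  case (Cons u z)
  then obtain j where j: "j \<le> length z" "z \<doteq> alt j s t \<or> z \<doteq> alt j t s" by auto
  obtain x y where xy: "z \<doteq> alt j x y" "{x, y} = {s, t}" using j by blast
  have u: "u = x \<or> u = y" using Cons.prems xy by auto
  have uz: "u # z \<doteq> u # alt j x y" using xy(1) by (rule weq_Cons)
  show ?case
  proof (cases "u = y")
    case True
    then have "u # z \<doteq> alt (Suc j) y x" using uz by simp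
    moreover have "(y = s \<and> x = t) \<or> (y = t \<and> x = s)" using xy(2) by (auto simp: doubleton_eq_iff)
    ultimately show ?thesis using j(1) by (intro exI[of _ "Suc j"]) auto
  next
    case False
    then have "u = x" using u by blast
    show ?thesis
    proof (cases j)
      case 0
      then show ?thesis using uz \<open>u = x\<close> xy(2) by (intro exI[of _ 1]) (auto simp: doubleton_eq_iff)
    next
      case (Suc i)
      then have "u # z \<doteq> alt i y x"
        using uz \<open>u = x\<close> Cons_Cons_weq[of x "alt i y x"] weq_trans by simp
      then show ?thesis using j(1) Suc xy(2) by (intro exI[of _ i]) (auto simp: doubleton_eq_iff)
    qed
  qed
qed (auto intro: exI[of _ 0])

text \<open>The order of the product of \<open>s\<close> and \<open>t\<close> in the group itself
  rather than the label in \<open>T\<close>: minimality makes short alternating words distinct, and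
  the label bounds it from above.\<close>

definition dihedral_order :: "'t \<Rightarrow> 't \<Rightarrow> nat" where
  "dihedral_order s t = (LEAST n. n \<ge> 1 \<and> alt (2 * n) s t \<doteq> [])"

context
  fixes s t :: 't and m k :: nat
  assumes st: "s \<noteq> t" and m: "max_label T = enat m" and k: "k = dihedral_order s t"
begin

lemma coxeter_matrix_le: "\<exists>n\<le>m. n \<ge> 2 \<and> coxeter_matrix T s t = enat n"
proof -
  have fin: "finite ({2} \<union> {k. \<exists>u v. T u v = Some k})"
  proof -
    have "{k. \<exists>u v. T u v = Some k} \<subseteq> (\<lambda>p. the (T (fst p) (snd p))) ` UNIV"
    proof
      fix k assume "k \<in> {k. \<exists>u v. T u v = Some k}"
      then obtain u v where "T u v = Some k" by blast
      then show "k \<in> (\<lambda>p. the (T (fst p) (snd p))) ` UNIV" by (intro image_eqI[of _ _ "(u, v)"]) auto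
    qed
    then show ?thesis by (simp add: finite_subset[OF _ finite_imageI[OF finite]])
  qed
  have "coxeter_matrix T s t \<in> {2} \<union> {k. \<exists>u v. T u v = Some k}"
    using st by (auto simp: coxeter_matrix_def split: option.splits)
  then have "coxeter_matrix T s t \<le> enat m"
    using Max_ge[OF fin] m unfolding max_label_def by metis
  then obtain n where "coxeter_matrix T s t = enat n" "n \<le> m"
    by (cases "coxeter_matrix T s t") auto
  then show ?thesis using gram_offdiag(2)[OF st] by blast
qed

lemma dihedral_order_props: "k \<ge> 1" "alt (2 * k) s t \<doteq> []" "k \<le> m"
proof -
  obtain n where n: "n \<le> m" "n \<ge> 2" "coxeter_matrix T s t = enat n" using coxeter_matrix_le by blast
  then have "alt (2 * n) s t \<doteq> []"
    using coxeter_step.intros[OF n(3), of "[]" "[]"]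
    by (auto simp: weq_def coxeter_rel_def concat_replicate_alt intro: r_into_equivclp)
  then have P: "n \<ge> 1 \<and> alt (2 * n) s t \<doteq> []" using n by simp
  show "k \<ge> 1" "alt (2 * k) s t \<doteq> []"
    using LeastI[of "\<lambda>n. n \<ge> 1 \<and> alt (2 * n) s t \<doteq> []", OF P] by (auto simp: k dihedral_order_def)
  show "k \<le> m" using Least_le[of "\<lambda>n. n \<ge> 1 \<and> alt (2 * n) s t \<doteq> []", OF P] n
    by (simp add: k dihedral_order_def)
qed

lemma dihedral_order_ge_2: "k \<ge> 2"
proof (rule ccontr)
  assume "\<not> k \<ge> 2"
  then have "k = 1" using dihedral_order_props(1) by linarith
  then have "[s, t] \<doteq> []" using dihedral_order_props(2) by (simp add: numeral_2_eq_2)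
  then have "[s] \<doteq> [t]" using Cons_weq_iff[of s "[t]" "[]"] weq_sym by blast
  then show False using generator_not_weq st by blast
qed

text \<open>Odd lengths are excluded by parity, even lengths by the minimality of
  \<open>k\<close>.\<close>

lemma alt_not_weq_Nil:
  assumes "0 < l" "l < 2 * k" "{x, y} = {s, t}"
  shows "\<not> alt l x y \<doteq> []"
proof
  assume *: "alt l x y \<doteq> []"
  then have "even l" using weq_even_length[OF *] by simp
  then obtain i where i: "l = 2 * i" by blast
  have "alt l s t \<doteq> []" using * assms(3) alt_weq_Nil_swap i by (auto simp: doubleton_eq_iff)
  then have "k \<le> i" unfolding k dihedral_order_def using i assms(1) by (intro Least_le) auto
  then show False using i assms(2) by simp
qed

text \<open>Words in two letters reduce to alternating ones. Against one with the same first letter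
  a common prefix cancels; against the other kind the quotient is an alternating word of length
  \<open>j + n < 2 * k\<close>. In both cases \<open>alt_not_weq_Nil\<close> applies.\<close>

lemma alt_not_weq_shorter:
  assumes "n \<le> k" "set z \<subseteq> {s, t}" "length z < n" "{x, y} = {s, t}"
  shows "\<not> alt n x y \<doteq> z"
proof
  assume *: "alt n x y \<doteq> z"
  obtain j where j: "j \<le> length z" "z \<doteq> alt j x y \<or> z \<doteq> alt j y x"
    using word_weq_alt[of z x y] assms by auto
  from j(2) show False
  proof
    assume "z \<doteq> alt j x y"
    then have "alt n x y \<doteq> alt j x y" using * weq_trans by blast
    moreover obtain d where d: "n = j + d" using j assms by (metis le_iff_add less_imp_le order_trans)
    ultimately have "(if even j then alt d x y else alt d y x) \<doteq> []"
      using alt_add[of j d x y] weq_cancel_left[of "alt j x y" _ "[]"] by simp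
    then show False
      using alt_not_weq_Nil[of d x y] alt_not_weq_Nil[of d y x] assms j d
      by (auto simp: insert_commute split: if_splits)
  next
    assume "z \<doteq> alt j y x"
    then have "alt n x y \<doteq> alt j y x" using * weq_trans by blast
    then have "rev (alt j y x) @ alt n x y \<doteq> []" using weq_rev_left[of "alt j y x" _ "[]"] by simp
    moreover have "rev (alt j y x) @ alt n x y = (if even j then alt (j + n) x y else alt (j + n) y x)"
      using alt_add[of j n x y] alt_add[of j n y x] by (auto simp: rev_alt)
    ultimately show False
      using alt_not_weq_Nil[of "j + n" x y] alt_not_weq_Nil[of "j + n" y x] assms j
      by (auto simp: insert_commute split: if_splits)
  qed
qed

text \<open>This is the relator of length \<open>2 * k\<close> cut into two halves.\<close>

lemma alt_braid: "alt k s t \<doteq> alt k t s"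
proof -
  have "alt k s t @ rev (alt k t s) = alt (2 * k) s t"
    using alt_add[of k k s t] by (auto simp: rev_alt mult_2)
  then show ?thesis using dihedral_order_props(2) weq_rev_right[of "alt k s t" "alt k t s" "[]"] by simp
qed

end

end

section \<open>Labelled complexes and their chambers\<close>

definition chambers :: "('v \<Rightarrow> 't::finite) \<Rightarrow> 'v set set \<Rightarrow> 'v set set" where
  "chambers \<tau> X = {c \<in> X. bij_betw \<tau> c UNIV}"

definition panel :: "('v \<Rightarrow> 't) \<Rightarrow> 't \<Rightarrow> 'v set \<Rightarrow> 'v set" where
  "panel \<tau> u c = {v \<in> c. \<tau> v \<noteq> u}"

definition adj :: "('v \<Rightarrow> 't::finite) \<Rightarrow> 'v set set \<Rightarrow> 't \<Rightarrow> 'v set \<Rightarrow> 'v set set" where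
  "adj \<tau> X u c = {d \<in> chambers \<tau> X. d \<noteq> c \<and> panel \<tau> u d = panel \<tau> u c}"

definition adj_sum :: "('t \<Rightarrow> 'c \<Rightarrow> 'c set) \<Rightarrow> 't \<Rightarrow> ('c \<Rightarrow> real) \<Rightarrow> 'c \<Rightarrow> real" where
  "adj_sum N u f c = sum f (N u c)"

text \<open>At \<open>c\<close> this sums \<open>f\<close> over the last chambers of all galleries
  of type \<open>us\<close> from \<open>c\<close>, with multiplicity. The neighbours
  \<open>N\<close> are a parameter because such sums are compared on a building, on its quotient and
  on an abstract system.\<close>

abbreviation gallery_sum :: "('t \<Rightarrow> 'c \<Rightarrow> 'c set) \<Rightarrow> 't list \<Rightarrow> ('c \<Rightarrow> real) \<Rightarrow> 'c \<Rightarrow> real" where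
  "gallery_sum N us \<equiv> foldr (adj_sum N) us"

lemma chamber_vertex_eq:
  assumes "c \<in> chambers \<tau> X" "v \<in> c" "v' \<in> c" "\<tau> v = \<tau> v'"
  shows "v = v'"
  using assms unfolding chambers_def bij_betw_def inj_on_def by blast

lemma chamber_vertex_ex:
  assumes "c \<in> chambers \<tau> X"
  shows "\<exists>v\<in>c. \<tau> v = u"
proof -
  have "\<tau> ` c = UNIV" using assms unfolding chambers_def bij_betw_def by simp
  then have "u \<in> \<tau> ` c" by simp
  then show ?thesis by blast
qed

lemma card_chamber:
  fixes \<tau> :: "'v \<Rightarrow> 't::finite"
  shows "c \<in> chambers \<tau> X \<Longrightarrow> card c = CARD('t)"
  unfolding chambers_def using bij_betw_same_card by blast

lemma chamber_finite:
  fixes \<tau> :: "'v \<Rightarrow> 't::finite"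
  shows "c \<in> chambers \<tau> X \<Longrightarrow> finite c"
  using bij_betw_finite[of \<tau> c UNIV] by (simp add: chambers_def)

lemma card_labels_eq:
  fixes \<tau> :: "'v \<Rightarrow> 't::finite"
  assumes pure: "\<And>x. x \<in> X \<Longrightarrow> \<exists>c\<in>chambers \<tau> X. x \<subseteq> c" and dim: "has_dimension X d"
  shows "CARD('t) = d + 1"
proof -
  obtain x where x: "x \<in> X" "card x = d + 1" using dim unfolding has_dimension_def faces_def by blast
  obtain c where c: "c \<in> chambers \<tau> X" "x \<subseteq> c" using pure[OF x(1)] by blast
  have "card x \<le> card c" using c chamber_finite card_mono by blast
  moreover have "card c \<le> d + 1" using dim c unfolding has_dimension_def chambers_def by blast
  ultimately show ?thesis using x card_chamber[OF c(1)] by simp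
qed

lemma faces_eq_chambers:
  fixes \<tau> :: "'v \<Rightarrow> 't::finite"
  assumes pure: "\<And>x. x \<in> X \<Longrightarrow> \<exists>c\<in>chambers \<tau> X. x \<subseteq> c" and d: "CARD('t) = d + 1"
  shows "faces X d = chambers \<tau> X"
proof
  show "faces X d \<subseteq> chambers \<tau> X"
  proof
    fix x assume "x \<in> faces X d"
    then have x: "x \<in> X" "card x = CARD('t)" using d unfolding faces_def by auto
    obtain c where c: "c \<in> chambers \<tau> X" "x \<subseteq> c" using pure[OF x(1)] by blast
    then have "x = c" using x card_chamber[OF c(1)] card_subset_eq[OF chamber_finite[OF c(1)]] by simp
    then show "x \<in> chambers \<tau> X" using c by simp
  qed
  show "chambers \<tau> X \<subseteq> faces X d"
    using card_chamber[of _ \<tau> X] d by (fastforce simp: faces_def chambers_def)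
qed

section \<open>Apartments and the Weyl distance\<close>

context coxeter_words
begin

abbreviation cls :: "'t list \<Rightarrow> 't list set" where
  "cls a \<equiv> coxeter_rel T `` {a}"

lemma cls_eq_iff: "cls a = cls b \<longleftrightarrow> a \<doteq> b"
  unfolding weq_def using eq_equiv_class_iff[OF equiv_coxeter_rel[of T]] by blast

lemma carrier_cls: "carrier (coxeter_group T) = range cls"
  by (auto simp: coxeter_group_def quotient_def)

lemma generate_avoiding:
  "generate (coxeter_group T) (coxeter_generator T ` (UNIV - {s})) = {cls j | j. s \<notin> set j}"
    (is "generate ?G ?H = _")
proof
  interpret group ?G by (rule group_coxeter_group)
  have one: "\<one>\<^bsub>?G\<^esub> = cls []" by (simp add: coxeter_group_def)
  have mult: "cls a \<otimes>\<^bsub>?G\<^esub> cls b = cls (a @ b)" for a b by (rule coxeter_group_mult)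
  have inv: "inv\<^bsub>?G\<^esub> (cls [t]) = cls [t]" for t
  proof (rule inv_equality)
    have "[t, t] \<doteq> []" by (rule Cons_Cons_weq)
    then show "cls [t] \<otimes>\<^bsub>?G\<^esub> cls [t] = \<one>\<^bsub>?G\<^esub>" unfolding mult one cls_eq_iff by simp
  qed (auto simp: carrier_cls)
  show "generate ?G ?H \<subseteq> {cls j | j. s \<notin> set j}"
  proof
    fix x assume "x \<in> generate ?G ?H"
    then show "x \<in> {cls j | j. s \<notin> set j}"
    proof (induction rule: generate.induct)
      case one
      show ?case unfolding \<open>\<one>\<^bsub>?G\<^esub> = cls []\<close> by (auto intro!: exI[of _ "[]"])
    next
      case (incl h)
      then obtain t where "t \<noteq> s" "h = cls [t]" by (auto simp: coxeter_generator_def)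
      then show ?case by (auto intro!: exI[of _ "[t]"])
    next
      case (inv h)
      then obtain t where "t \<noteq> s" "h = cls [t]" by (auto simp: coxeter_generator_def)
      then show ?case unfolding \<open>h = cls [t]\<close> \<open>inv\<^bsub>?G\<^esub> (cls [t]) = cls [t]\<close> by (auto intro!: exI[of _ "[t]"])
    next
      case (eng h1 h2)
      then obtain a b where "h1 = cls a" "h2 = cls b" "s \<notin> set a" "s \<notin> set b" by blast
      then show ?case using mult by (auto intro!: exI[of _ "a @ b"])
    qed
  qed
  show "{cls j | j. s \<notin> set j} \<subseteq> generate ?G ?H"
  proof clarify
    fix j :: "'t list" assume "s \<notin> set j"
    then show "cls j \<in> generate ?G ?H"
    proof (induction j)
      case Nil
      then show ?case using generate.one[of ?G ?H] by (simp add: one)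
    next
      case (Cons t j)
      have "cls [t] \<in> ?H" using Cons.prems by (auto simp: coxeter_generator_def)
      then have "cls [t] \<otimes>\<^bsub>?G\<^esub> cls j \<in> generate ?G ?H"
        using Cons by (intro generate.eng) (auto intro: generate.incl)
      then show ?case by (simp add: mult)
    qed
  qed
qed

lemma coxeter_vertex_cls: "coxeter_vertex T s (cls w) = {cls (w @ j) | j. s \<notin> set j}"
proof -
  have "coxeter_vertex T s (cls w) = (\<lambda>h. cls w \<otimes>\<^bsub>coxeter_group T\<^esub> h) ` {cls j | j. s \<notin> set j}"
    unfolding coxeter_vertex_def generate_avoiding l_coset_def by blast
  also have "\<dots> = {cls w \<otimes>\<^bsub>coxeter_group T\<^esub> cls j | j. s \<notin> set j}" by blast
  finally show ?thesis by (simp only: coxeter_group_mult)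
qed

lemma coxeter_vertex_mem: "cls v \<in> coxeter_vertex T s (cls w) \<longleftrightarrow> avoids s (rev w @ v)"
  unfolding coxeter_vertex_cls avoids_def by (auto simp: cls_eq_iff weq_rev_left)

lemma avoids_append: "avoids u a \<Longrightarrow> avoids u b \<Longrightarrow> avoids u (a @ b)"
proof -
  assume "avoids u a" "avoids u b"
  then obtain a' b' where "a \<doteq> a'" "u \<notin> set a'" "b \<doteq> b'" "u \<notin> set b'" unfolding avoids_def by blast
  then show ?thesis unfolding avoids_def by (intro exI[of _ "a' @ b'"]) (auto intro: weq_append)
qed

lemma avoids_rev: "avoids u a \<Longrightarrow> avoids u (rev a)"
  unfolding avoids_def by (metis weq_rev set_rev)

lemma rev_append_cancel: "rev a @ b @ rev b @ c \<doteq> rev a @ c"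
  using weq_append[OF weq_refl weq_append[OF append_rev_weq weq_refl], of "rev a" b c] by simp

lemma coxeter_vertex_eq_iff:
  "coxeter_vertex T s (cls w) = coxeter_vertex T s (cls w') \<longleftrightarrow> avoids s (rev w @ w')"
proof
  assume "coxeter_vertex T s (cls w) = coxeter_vertex T s (cls w')"
  moreover have "cls w' \<in> coxeter_vertex T s (cls w')"
    unfolding coxeter_vertex_cls by (auto intro!: exI[of _ "[]"])
  ultimately have "cls w' \<in> coxeter_vertex T s (cls w)" by (simp only:)
  then show "avoids s (rev w @ w')" by (simp only: coxeter_vertex_mem)
next
  assume *: "avoids s (rev w @ w')"
  have "avoids s (rev w @ v) \<longleftrightarrow> avoids s (rev w' @ v)" for v
  proof -
    have "avoids s (rev w' @ w)" using avoids_rev[OF *] by simp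
    then show ?thesis
      using avoids_append[of s "rev w' @ w" "rev w @ v"] avoids_append[OF *, of "rev w' @ v"]
        avoids_weq[OF rev_append_cancel[of w w' v]] avoids_weq[OF rev_append_cancel[of w' w v]]
      by auto
  qed
  moreover have "\<exists>v. x = cls v" if "x \<in> coxeter_vertex T s (cls u)" for x u
    using that unfolding coxeter_vertex_cls by blast
  ultimately show "coxeter_vertex T s (cls w) = coxeter_vertex T s (cls w')"
    using coxeter_vertex_mem by (intro Set.set_eqI) metis
qed

text \<open>For \<open>s \<noteq> t\<close> the coset of type \<open>t\<close> is stable under right
  multiplication by \<open>s\<close>, while a coset of type \<open>s\<close> is not.\<close>

lemma coxeter_vertex_type:
  assumes "coxeter_vertex T s (cls w) = coxeter_vertex T t (cls w')"
  shows "s = t"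
proof (rule ccontr)
  assume "s \<noteq> t"
  have "avoids s (rev w @ v)" if "t \<notin> set j" "v = w' @ j" for v j
    using assms coxeter_vertex_mem[of v s w] that unfolding coxeter_vertex_cls by blast
  from this[of "[]"] this[of "[s]"] have "avoids s (rev w @ w')" "avoids s (rev w @ w' @ [s])"
    using \<open>s \<noteq> t\<close> by auto
  then have "avoids s (rev (rev w @ w') @ rev w @ w' @ [s])"
    by (rule avoids_append[OF avoids_rev])
  moreover have "rev (rev w @ w') @ rev w @ w' @ [s] \<doteq> [s]"
    using weq_append[OF rev_append_weq[of "rev w @ w'"] weq_refl[of "[s]"]] by simp
  ultimately show False using avoids_weq not_avoids_generator by blast
qed

end

text \<open>
  In a chart, \<open>V w u\<close> is the vertex of type \<open>u\<close> of the chamber that corresponds to the group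
  element of the word \<open>w\<close>.
\<close>
locale labelled_building = coxeter_words T for T :: "'t::finite coxeter_diagram" +
  fixes X :: "'v set set" and E and \<tau> :: "'v \<Rightarrow> 't"
  assumes building: "building T X E" and labelling: "building_labelling T E \<tau>"
begin

text \<open>These three facts replace the isomorphism with the Coxeter complex, so that cosets can
  be forgotten from here on.\<close>

definition chart :: "'v set set \<Rightarrow> ('t list \<Rightarrow> 't \<Rightarrow> 'v) \<Rightarrow> bool" where
  "chart A V \<longleftrightarrow> A = {x. \<exists>w. x \<subseteq> range (V w)} \<and> (\<forall>w u. \<tau> (V w u) = u) \<and>
     (\<forall>w w' u. V w u = V w' u \<longleftrightarrow> avoids u (rev w @ w'))"

lemma ex_chart:
  assumes "A \<in> E"
  shows "\<exists>V. chart A V"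
proof -
  obtain f where f: "simplicial_iso f A (coxeter_complex T)"
    and ty: "\<forall>v\<in>vertices A. \<exists>w\<in>carrier (coxeter_group T). f v = coxeter_vertex T (\<tau> v) w"
    using bspec[OF labelling[unfolded building_labelling_def] assms] by (elim exE conjE)
  have bij: "bij_betw f (vertices A) (vertices (coxeter_complex T))" and
    im: "(`) f ` A = coxeter_complex T" using f by (auto simp: simplicial_iso_def)
  define g where "g = inv_into (vertices A) f"
  define V where "V = (\<lambda>w u. g (coxeter_vertex T u (cls w)))"
  have inC: "x \<in> coxeter_complex T \<longleftrightarrow> (\<exists>w. x \<subseteq> range (\<lambda>u. coxeter_vertex T u (cls w)))" for x
  proof -
    have "{coxeter_vertex T s w | s. s \<in> UNIV} = range (\<lambda>s. coxeter_vertex T s w)" for w by blast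
    then show ?thesis unfolding coxeter_complex_def carrier_cls by auto
  qed
  have cv: "coxeter_vertex T u (cls w) \<in> vertices (coxeter_complex T)" for u w
    using inC[of "{coxeter_vertex T u (cls w)}"] by blast
  have fV: "f (V w u) = coxeter_vertex T u (cls w)" and VA: "V w u \<in> vertices A" for w u
    unfolding V_def g_def using cv bij bij_betw_inv_into_right[OF bij] bij_betw_imp_surj_on[OF bij] inv_into_into
    by (metis, metis)
  have gf: "g (f v) = v" if "v \<in> vertices A" for v
    unfolding g_def using bij_betw_inv_into_left[OF bij that] .
  have "A = {x. \<exists>w. x \<subseteq> range (V w)}"
  proof (intro Set.set_eqI iffI)
    fix x assume x: "x \<in> A"
    then have "f ` x \<in> coxeter_complex T" using im by blast
    then obtain w where "f ` x \<subseteq> range (\<lambda>u. coxeter_vertex T u (cls w))" unfolding inC by (elim exE)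
    then have "g ` f ` x \<subseteq> g ` range (\<lambda>u. coxeter_vertex T u (cls w))" by (rule image_mono)
    also have "\<dots> = range (V w)" unfolding V_def by (simp add: image_image)
    finally have "g ` f ` x \<subseteq> range (V w)" .
    moreover have "g ` f ` x = x" using gf x by (force simp: image_iff)
    ultimately show "x \<in> {x. \<exists>w. x \<subseteq> range (V w)}" by auto
  next
    fix x assume "x \<in> {x. \<exists>w. x \<subseteq> range (V w)}"
    then obtain w where w: "x \<subseteq> range (V w)" by blast
    then have "f ` x \<subseteq> f ` range (V w)" by (rule image_mono)
    also have "\<dots> = range (\<lambda>u. coxeter_vertex T u (cls w))" by (simp add: image_image fV)
    finally have "f ` x \<in> (`) f ` A" unfolding im inC by (rule exI)
    then obtain y where y: "y \<in> A" "f ` x = f ` y" by blast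
    have "x \<subseteq> vertices A"
    proof
      fix v assume "v \<in> x"
      then have "v \<in> range (V w)" using w by (rule subsetD[rotated])
      then show "v \<in> vertices A" by (rule rangeE) (simp only: VA)
    qed
    moreover have "y \<subseteq> vertices A" using y(1) by (rule Union_upper)
    ultimately have "x = y" using inj_on_image_eq_iff[OF bij_betw_imp_inj_on[OF bij]] y(2) by metis
    then show "x \<in> A" using y by simp
  qed
  moreover have "\<tau> (V w u) = u" for w u
  proof -
    obtain w' where "f (V w u) = coxeter_vertex T (\<tau> (V w u)) (cls w')"
      using bspec[OF ty VA] unfolding carrier_cls by blast
    then show ?thesis using coxeter_vertex_type unfolding fV by metis
  qed
  moreover have "V w u = V w' u \<longleftrightarrow> avoids u (rev w @ w')" for w w' u
  proof -
    have "V w u = V w' u \<longleftrightarrow> f (V w u) = f (V w' u)" using VA gf by metis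
    then show ?thesis unfolding fV coxeter_vertex_eq_iff .
  qed
  ultimately show ?thesis unfolding chart_def by blast
qed

lemma chart_type: "chart A V \<Longrightarrow> \<tau> (V w u) = u"
  unfolding chart_def by blast

lemma chart_eq_iff: "chart A V \<Longrightarrow> V w u = V w' u \<longleftrightarrow> avoids u (rev w @ w')"
  unfolding chart_def by blast

lemma chart_mem: "chart A V \<Longrightarrow> x \<in> A \<longleftrightarrow> (\<exists>w. x \<subseteq> range (V w))"
  unfolding chart_def by blast

lemma chart_cong: "chart A V \<Longrightarrow> w \<doteq> w' \<Longrightarrow> V w = V w'"
proof
  fix u assume V: "chart A V" and "w \<doteq> w'"
  then have "rev w @ w' \<doteq> []" using weq_rev_left[of w w' "[]"] weq_sym by simp
  then show "V w u = V w' u" using chart_eq_iff[OF V] avoids_weq avoidsI[of u "[]"] by simp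
qed

lemma chart_eq_panel:
  assumes V: "chart A V" and "\<And>u. u \<noteq> s \<Longrightarrow> V w u = V w' u"
  shows "w' \<doteq> w \<or> w' \<doteq> w @ [s]"
proof -
  have "rev w @ w' \<doteq> [] \<or> rev w @ w' \<doteq> [s]"
    using assms chart_eq_iff[OF V] by (intro avoids_all_but_one) blast
  then show ?thesis by (simp add: weq_rev_left)
qed

lemma chart_adjacent: "chart A V \<Longrightarrow> u \<noteq> s \<Longrightarrow> V (w @ [s]) u = V w u"
proof -
  assume V: "chart A V" and "u \<noteq> s"
  then have "avoids u (rev w @ w @ [s])"
    using avoids_weq[OF weq_append[OF rev_append_weq weq_refl], of u w "[s]"] avoidsI[of u "[s]"] by simp
  then show ?thesis using chart_eq_iff[OF V] by metis
qed

lemma chart_range_eq: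
  assumes V: "chart A V" and V': "chart A' V'" and eq: "range (V w) = range (V' w')"
  shows "V w = V' w'"
proof
  fix u
  have "V w u \<in> range (V' w')" using eq by blast
  then obtain u' where "V w u = V' w' u'" by blast
  then show "V w u = V' w' u" using chart_type[OF V] chart_type[OF V'] by metis
qed

lemma chart_range_eq_iff:
  assumes V: "chart A V"
  shows "range (V w) = range (V w') \<longleftrightarrow> w \<doteq> w'"
proof
  assume "range (V w) = range (V w')"
  then have "V w = V w'" by (rule chart_range_eq[OF V V])
  then have "rev w @ w' \<doteq> []" using chart_eq_iff[OF V] by (intro avoids_all) metis
  then show "w \<doteq> w'" by (simp add: weq_rev_left weq_sym)
qed (use chart_cong[OF V] in metis)

lemma chart_bij: "chart A V \<Longrightarrow> bij_betw \<tau> (range (V w)) UNIV"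
  unfolding bij_betw_def inj_on_def using chart_type by (force simp: image_iff)

text \<open>Left translation is a type-preserving automorphism of the Coxeter complex, so any
  chamber of an apartment can be made the base chamber.\<close>

lemma chart_shift:
  assumes V: "chart A V"
  shows "chart A (\<lambda>w. V (w0 @ w))"
  unfolding chart_def
proof (intro conjI allI)
  have "V (w0 @ rev w0 @ w) = V w" for w
    using weq_append[OF append_rev_weq weq_refl, of w0 w] by (intro chart_cong[OF V]) simp
  then have "(\<exists>w. x \<subseteq> range (V w)) \<longleftrightarrow> (\<exists>w. x \<subseteq> range (V (w0 @ w)))" for x by metis
  then show "A = {x. \<exists>w. x \<subseteq> range (V (w0 @ w))}"
    by (intro Set.set_eqI) (simp only: chart_mem[OF V] mem_Collect_eq)
  show "\<tau> (V (w0 @ w) u) = u" for w u by (rule chart_type[OF V])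
  show "V (w0 @ w) u = V (w0 @ w') u \<longleftrightarrow> avoids u (rev w @ w')" for w w' u
    unfolding chart_eq_iff[OF V] using avoids_weq[OF weq_append[OF weq_refl weq_append[OF rev_append_weq weq_refl], of "rev w" w0 w']]
    by simp
qed

lemmas building_props = building[unfolded building_def]

lemma apartment_subset: "A \<in> E \<Longrightarrow> A \<subseteq> X"
  using building_props[THEN conjunct2, THEN conjunct2, THEN conjunct1] by blast

lemmas common_apartment = building_props[THEN conjunct2, THEN conjunct2, THEN conjunct2, THEN conjunct2,
  THEN conjunct1, THEN bspec, THEN bspec]

lemmas apartments_iso = building_props[THEN conjunct2, THEN conjunct2, THEN conjunct2, THEN conjunct2,
  THEN conjunct2, THEN bspec, THEN bspec, THEN bspec, THEN bspec]

lemma chart_chamber: "A \<in> E \<Longrightarrow> chart A V \<Longrightarrow> range (V w) \<in> chambers \<tau> X"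
  unfolding chambers_def using chart_bij chart_mem[of A V "range (V w)"] apartment_subset by blast

lemma bij_subset_eq: "bij_betw f x UNIV \<Longrightarrow> bij_betw f y UNIV \<Longrightarrow> x \<subseteq> y \<Longrightarrow> x = y"
  unfolding bij_betw_def inj_on_def by (metis UNIV_I imageE subsetD subsetI subset_antisym)

lemma chamber_in_chart:
  assumes "A \<in> E" "chart A V" "c \<in> chambers \<tau> X" "c \<in> A"
  shows "\<exists>w. c = range (V w)"
proof -
  obtain w where "c \<subseteq> range (V w)" using assms chart_mem by blast
  then show ?thesis using bij_subset_eq[of \<tau> c "range (V w)"] chart_bij assms unfolding chambers_def by blast
qed

lemma chambers_pure: "x \<in> X \<Longrightarrow> \<exists>c\<in>chambers \<tau> X. x \<subseteq> c"
  using common_apartment[of x x] ex_chart chart_mem chart_chamber by metis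

text \<open>Rigidity along galleries. Within an apartment a panel lies in only two chambers; the
  image of the next chamber contains the known panel and, by injectivity of \<open>\<phi>\<close>,
  is not the image of the old chamber.\<close>

lemma apartment_iso_chart:
  assumes V: "chart A V" and V': "chart A' V'" and \<phi>: "simplicial_iso \<phi> A A'"
    and base: "\<And>u. \<phi> (V [] u) = V' [] u"
  shows "\<phi> (V w u) = V' w u"
proof -
  have inj: "inj_on \<phi> (vertices A)" and im: "(`) \<phi> ` A = A'"
    using \<phi> by (auto simp: simplicial_iso_def bij_betw_def)
  have VA: "V w u \<in> vertices A" for w u using chart_mem[OF V, of "range (V w)"] by blast
  show ?thesis
  proof (induction w arbitrary: u rule: rev_induct)
    case (snoc s w)
    have "\<phi> ` range (V (w @ [s])) \<in> A'" using im chart_mem[OF V, of "range (V (w @ [s]))"] by blast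
    then obtain w' where sub: "\<phi> ` range (V (w @ [s])) \<subseteq> range (V' w')" using chart_mem[OF V'] by blast
    have eq: "\<phi> (V (w @ [s]) u) = V' w u" if "u \<noteq> s" for u
      using snoc chart_adjacent[OF V that] by simp
    have w': "V' w' u = V' w u" if "u \<noteq> s" for u
    proof -
      have "V' w u \<in> range (V' w')" using eq[OF that] sub by (metis imageI rangeI subsetD)
      then show ?thesis using chart_type[OF V'] by (metis imageE)
    qed
    obtain x where x: "\<phi> (V (w @ [s]) s) = V' w' x" using sub by blast
    \<comment> \<open>An isomorphism of apartments comes without information on types, so the type
      of the new vertex is forced by injectivity.\<close>
    have "x = s"
    proof (rule ccontr)
      assume "x \<noteq> s"
      then have "\<phi> (V (w @ [s]) s) = \<phi> (V w x)" by (simp only: x w'[OF \<open>x \<noteq> s\<close>] snoc)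
      then have "V (w @ [s]) s = V w x" by (rule inj_onD[OF inj _ VA VA])
      then show False using chart_type[OF V] \<open>x \<noteq> s\<close> by metis
    qed
    have "w \<doteq> w' \<or> w \<doteq> w' @ [s]" using chart_eq_panel[OF V' w'] by blast
    then have "w' \<doteq> w @ [s]"
    proof
      assume "w \<doteq> w'"
      then have "V' w' = V' w" using chart_cong[OF V'] by metis
      then have "\<phi> (V (w @ [s]) s) = \<phi> (V w s)" using x \<open>x = s\<close> snoc by simp
      then have "V (w @ [s]) s = V w s" by (rule inj_onD[OF inj _ VA VA])
      then have "avoids s (rev w @ w @ [s])" using chart_eq_iff[OF V] by metis
      then show ?thesis
        using avoids_weq[OF weq_append[OF rev_append_weq weq_refl], of s w "[s]"] not_avoids_generator by simp
    qed (use snoc_weq_iff weq_sym in blast)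
    then have "V' w' = V' (w @ [s])" by (rule chart_cong[OF V'])
    then show ?case using eq w' x \<open>x = s\<close> by metis
  qed (rule base)
qed

text \<open>A relation and not a function: words are determined only up to \<open>\<doteq>\<close>,
  and independence of the apartment is proved later, in \<open>weyl_dist_unique\<close>.\<close>

definition weyl_dist :: "'v set \<Rightarrow> 'v set \<Rightarrow> 't list \<Rightarrow> bool" where
  "weyl_dist c d w \<longleftrightarrow> (\<exists>A\<in>E. \<exists>V. chart A V \<and> c = range (V []) \<and> d = range (V w))"

lemma weyl_dist_chambers:
  "weyl_dist c d w \<Longrightarrow> c \<in> chambers \<tau> X" "weyl_dist c d w \<Longrightarrow> d \<in> chambers \<tau> X"
  unfolding weyl_dist_def using chart_chamber by metis+

lemma weyl_dist_ex:
  assumes "c \<in> chambers \<tau> X" "d \<in> chambers \<tau> X"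
  shows "\<exists>w. weyl_dist c d w"
proof -
  obtain A where A: "A \<in> E" "c \<in> A" "d \<in> A" using common_apartment assms unfolding chambers_def by blast
  obtain V where V: "chart A V" using ex_chart A by blast
  obtain w w' where w: "c = range (V w)" "d = range (V w')" using chamber_in_chart A V assms by metis
  have "V (w @ rev w @ w') = V w'"
    using weq_append[OF append_rev_weq weq_refl, of w w'] by (intro chart_cong[OF V]) simp
  then have "weyl_dist c d (rev w @ w')"
    unfolding weyl_dist_def using A(1) chart_shift[OF V, of w] w
    by (intro bexI[of _ A] exI[of _ "\<lambda>x. V (w @ x)"]) auto
  then show ?thesis by blast
qed

lemma weyl_dist_weq: "weyl_dist c d w \<Longrightarrow> w \<doteq> w' \<Longrightarrow> weyl_dist c d w'"
  unfolding weyl_dist_def using chart_cong by metis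

text \<open>The isomorphism of apartments that fixes \<open>c\<close> and the common part of
  \<open>d\<close> and \<open>d'\<close> matches the two charts, by rigidity. A general set
  \<open>J\<close> of types serves both for a common chamber (all types) and for a common panel (all
  but one).\<close>

lemma weyl_dist_compare:
  assumes "weyl_dist c d w" "weyl_dist c d' w'" and J: "{v \<in> d. \<tau> v \<in> J} = {v \<in> d'. \<tau> v \<in> J}" and "u \<in> J"
  shows "avoids u (rev w @ w')"
proof -
  obtain A V where V: "A \<in> E" "chart A V" "c = range (V [])" "d = range (V w)"
    using assms(1) unfolding weyl_dist_def by blast
  obtain A' V' where V': "A' \<in> E" "chart A' V'" "c = range (V' [])" "d' = range (V' w')"
    using assms(2) unfolding weyl_dist_def by blast
  define p where "p = {v \<in> d. \<tau> v \<in> J}"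
  have "c \<in> A \<inter> A'" using V V' chart_mem[OF V(2), of c] chart_mem[OF V'(2), of c] by blast
  moreover have "p \<subseteq> range (V w)" "p \<subseteq> range (V' w')" using V(4) V'(4) J unfolding p_def by auto
  then have "p \<in> A \<inter> A'" using chart_mem[OF V(2), of p] chart_mem[OF V'(2), of p] by blast
  ultimately obtain \<phi> where \<phi>: "simplicial_iso \<phi> A A'" "\<And>v. v \<in> c \<union> p \<Longrightarrow> \<phi> v = v"
    using apartments_iso[OF V(1) V'(1)] by blast
  have "\<phi> (V [] u) = V' [] u" for u
  proof -
    have "V [] = V' []" using chart_range_eq V V' by metis
    moreover have "V [] u \<in> c" using V by blast
    ultimately show ?thesis using \<phi>(2) by simp
  qed
  then have "\<phi> (V w u) = V' w u" by (rule apartment_iso_chart[OF V(2) V'(2) \<phi>(1)])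
  moreover have up: "V w u \<in> p" using V(4) \<open>u \<in> J\<close> chart_type[OF V(2)] unfolding p_def by auto
  ultimately have "V w u = V' w u" using \<phi>(2) by simp
  moreover have "V w u = V' w' u"
  proof -
    have "V w u \<in> d'" using up J unfolding p_def by blast
    then obtain x where "V w u = V' w' x" using V'(4) by blast
    then show ?thesis using chart_type[OF V(2)] chart_type[OF V'(2)] by metis
  qed
  ultimately show ?thesis using chart_eq_iff[OF V'(2)] by metis
qed

lemma weyl_dist_unique:
  assumes "weyl_dist c d w" "weyl_dist c d w'"
  shows "w \<doteq> w'"
proof -
  have "rev w @ w' \<doteq> []"
    using weyl_dist_compare[OF assms, of UNIV] by (intro avoids_all) simp
  then show ?thesis by (simp add: weq_rev_left weq_sym)
qed

lemma weyl_dist_panel: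
  assumes "weyl_dist c d w" "weyl_dist c d' w'" "panel \<tau> s d = panel \<tau> s d'"
  shows "w' \<doteq> w \<or> w' \<doteq> w @ [s]"
proof -
  have "rev w @ w' \<doteq> [] \<or> rev w @ w' \<doteq> [s]"
    using weyl_dist_compare[OF assms(1,2), of "- {s}"] assms(3)
    by (intro avoids_all_but_one) (simp add: panel_def)
  then show ?thesis by (simp add: weq_rev_left)
qed

lemma weyl_dist_sym: "weyl_dist c d w \<Longrightarrow> weyl_dist d c (rev w)"
proof -
  assume "weyl_dist c d w"
  then obtain A V where V: "A \<in> E" "chart A V" "c = range (V [])" "d = range (V w)"
    unfolding weyl_dist_def by blast
  have "V (w @ rev w) = V []" by (intro chart_cong[OF V(2)] append_rev_weq)
  then show ?thesis
    unfolding weyl_dist_def using V chart_shift[OF V(2), of w]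
    by (intro bexI[of _ A] exI[of _ "\<lambda>x. V (w @ x)"]) auto
qed

lemma weyl_dist_Nil: "c \<in> chambers \<tau> X \<Longrightarrow> weyl_dist c d [] \<longleftrightarrow> c = d"
proof
  assume "c \<in> chambers \<tau> X"
  then obtain w where w: "weyl_dist c c w" using weyl_dist_ex by blast
  then obtain A V where V: "A \<in> E" "chart A V" "c = range (V [])"
    unfolding weyl_dist_def by blast
  then show "c = d \<Longrightarrow> weyl_dist c d []" unfolding weyl_dist_def by blast
qed (auto simp: weyl_dist_def)

lemma weyl_dist_Cons:
  assumes "weyl_dist c d (s # w)"
  shows "\<exists>e\<in>adj \<tau> X s c. weyl_dist e d w"
proof -
  obtain A V where V: "A \<in> E" "chart A V" "c = range (V [])" "d = range (V (s # w))"
    using assms unfolding weyl_dist_def by blast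
  define e where "e = range (V [s])"
  have "e \<noteq> c" unfolding e_def V(3) chart_range_eq_iff[OF V(2)] using generator_not_weq by blast
  moreover have "panel \<tau> s (range (V x)) = V x ` (- {s})" for x
    unfolding panel_def using chart_type[OF V(2)] by auto
  then have "panel \<tau> s e = panel \<tau> s c"
    unfolding e_def V(3) using chart_adjacent[OF V(2), of _ s "[]"] by (auto intro!: image_cong)
  ultimately have "e \<in> adj \<tau> X s c" unfolding adj_def e_def using chart_chamber V by blast
  moreover have "weyl_dist e d w"
    unfolding weyl_dist_def using V chart_shift[OF V(2), of "[s]"]
    by (intro bexI[of _ A] exI[of _ "\<lambda>x. V ([s] @ x)"]) (auto simp: e_def)
  ultimately show ?thesis by blast
qed

lemma weyl_dist_adj:
  assumes "c \<in> chambers \<tau> X" "d \<in> adj \<tau> X s c"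
  shows "weyl_dist c d [s]"
proof -
  obtain w where w: "weyl_dist c d w" using assms weyl_dist_ex unfolding adj_def by blast
  have "weyl_dist c c []" using assms(1) by (simp add: weyl_dist_Nil)
  moreover have "panel \<tau> s c = panel \<tau> s d" using assms(2) by (simp add: adj_def)
  ultimately have "w \<doteq> [] \<or> w \<doteq> [] @ [s]" using weyl_dist_panel[OF _ w] by blast
  then show ?thesis
    using assms w weyl_dist_weq weyl_dist_Nil unfolding adj_def by (metis (mono_tags, lifting) append_Nil mem_Collect_eq)
qed

lemma weyl_dist_step_right:
  assumes "weyl_dist e c z" "c' \<in> adj \<tau> X s c"
  shows "weyl_dist e c' z \<or> weyl_dist e c' (z @ [s])"
proof -
  obtain w where w: "weyl_dist e c' w"
    using assms weyl_dist_ex weyl_dist_chambers unfolding adj_def by blast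
  have "w \<doteq> z \<or> w \<doteq> z @ [s]"
    using assms weyl_dist_panel[OF assms(1) w] unfolding adj_def by simp
  then show ?thesis using w weyl_dist_weq by blast
qed

lemma adj_sym: "c \<in> chambers \<tau> X \<Longrightarrow> d \<in> adj \<tau> X s c \<Longrightarrow> c \<in> adj \<tau> X s d"
  unfolding adj_def by auto

lemma weyl_dist_step_left:
  assumes "c \<in> chambers \<tau> X" "e \<in> adj \<tau> X u c" "weyl_dist e d w"
  shows "weyl_dist c d w \<or> weyl_dist c d (u # w)"
  using weyl_dist_step_right[OF weyl_dist_sym[OF assms(3)] adj_sym[OF assms(1,2)]]
    weyl_dist_sym[of d c "rev w"] weyl_dist_sym[of d c "rev w @ [u]"] by auto

text \<open>Each step of the gallery of type \<open>a\<close> either appends its letter to the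
  distance from \<open>e\<close> or leaves that distance unchanged.\<close>

lemma weyl_dist_subword:
  assumes "weyl_dist e c z" "weyl_dist c d a"
  shows "\<exists>y. weyl_dist e d (z @ y) \<and> length y \<le> length a \<and> set y \<subseteq> set a"
  using assms
proof (induction a arbitrary: c z)
  case Nil
  then have "c = d" using weyl_dist_chambers weyl_dist_Nil by blast
  then show ?case using Nil by (intro exI[of _ "[]"]) auto
next
  case (Cons s a)
  obtain c' where c': "c' \<in> adj \<tau> X s c" "weyl_dist c' d a" using weyl_dist_Cons Cons.prems by blast
  consider "weyl_dist e c' z" | "weyl_dist e c' (z @ [s])" using weyl_dist_step_right Cons.prems c' by blast
  then show ?case
  proof cases
    case 1
    then show ?thesis using Cons.IH[OF 1 c'(2)] by force
  next
    case 2
    then obtain y where "weyl_dist e d ((z @ [s]) @ y)" "length y \<le> length a" "set y \<subseteq> set a"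
      using Cons.IH[OF 2 c'(2)] by blast
    then show ?thesis by (intro exI[of _ "s # y"]) auto
  qed
qed

text \<open>The letters of a Weyl distance name a gallery from \<open>c\<close> to
  \<open>d\<close>.\<close>

lemma adj_invariant_constant:
  assumes "\<And>c d u. c \<in> chambers \<tau> X \<Longrightarrow> d \<in> adj \<tau> X u c \<Longrightarrow> f d = f c"
    and "c \<in> chambers \<tau> X" "d \<in> chambers \<tau> X"
  shows "f c = f d"
proof -
  obtain w where "weyl_dist c d w" using weyl_dist_ex assms by blast
  then show ?thesis using assms(2)
  proof (induction w arbitrary: c)
    case Nil
    then show ?case using weyl_dist_Nil[of c d] by simp
  next
    case (Cons s w)
    then obtain e where e: "e \<in> adj \<tau> X s c" "weyl_dist e d w" using weyl_dist_Cons by blast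
    then have "f e = f d" using Cons.IH weyl_dist_chambers by blast
    then show ?case using assms(1)[OF Cons.prems(2) e(1)] by simp
  qed
qed

subsection \<open>The braid relations\<close>

context
  fixes s t :: 't and m k :: nat
  assumes st: "s \<noteq> t" and m: "max_label T = enat m" and k: "k = dihedral_order s t"
begin

text \<open>Otherwise the distance from \<open>c\<close> to \<open>d\<close> would already be
  \<open>alt n y x\<close>; starting from \<open>e\<close> through \<open>c\<close> would give
  \<open>alt n y x \<doteq> x # z\<close> with \<open>z\<close> of length at most \<open>n\<close>,
  and the alternating word of length \<open>n + 1 \<le> k\<close> would equal a shorter one.\<close>

lemma weyl_dist_alt_step:
  assumes n: "Suc n \<le> k" and xy: "{x, y} = {s, t}"
    and "c \<in> chambers \<tau> X" "e \<in> adj \<tau> X x c" "weyl_dist e d (alt n y x)"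
  shows "weyl_dist c d (alt (Suc n) x y)"
proof (rule ccontr)
  assume "\<not> weyl_dist c d (alt (Suc n) x y)"
  then have cd: "weyl_dist c d (alt n y x)" using weyl_dist_step_left[OF assms(3-5)] by simp
  have "weyl_dist e c [x]"
    using weyl_dist_sym[OF weyl_dist_adj[OF assms(3,4)]] by simp
  then obtain z where z: "weyl_dist e d ([x] @ z)" "length z \<le> n" "set z \<subseteq> set (alt n y x)"
    using weyl_dist_subword[OF _ cd] by force
  have "alt n y x \<doteq> x # z" using weyl_dist_unique[OF assms(5) z(1)] by simp
  then have "alt (Suc n) x y \<doteq> z" by (simp add: Cons_weq_iff)
  moreover have "set z \<subseteq> {s, t}" using z(3) set_alt[of n y x] xy by blast
  ultimately show False using alt_not_weq_shorter[OF st m k n _ _ xy] z(2) by simp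
qed

text \<open>Up to length \<open>k\<close> an alternating gallery is minimal and determined by its
  ends, so each chamber at that distance is counted exactly once.\<close>

lemma gallery_sum_alt:
  assumes fin: "\<And>c u. c \<in> chambers \<tau> X \<Longrightarrow> finite (adj \<tau> X u c)"
    and "n \<le> k" "{x, y} = {s, t}" "c \<in> chambers \<tau> X"
  shows "finite {d. weyl_dist c d (alt n x y)} \<and>
    gallery_sum (adj \<tau> X) (alt n x y) f c = sum f {d. weyl_dist c d (alt n x y)}"
  using assms(2-4)
proof (induction n x y arbitrary: c rule: alt.induct)
  case (1 x y)
  then have "{d. weyl_dist c d (alt 0 x y)} = {c}" using weyl_dist_Nil by auto
  then show ?case by simp
next
  case (2 n x y)
  let ?D = "\<lambda>e. {d. weyl_dist e d (alt n y x)}"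
  have ch: "e \<in> chambers \<tau> X" if "e \<in> adj \<tau> X x c" for e using that unfolding adj_def by blast
  have IH: "finite (?D e)" "gallery_sum (adj \<tau> X) (alt n y x) f e = sum f (?D e)" if "e \<in> adj \<tau> X x c" for e
    using "2.IH"[OF _ _ ch[OF that]] "2.prems" by (auto simp: insert_commute)
  have D: "{d. weyl_dist c d (alt (Suc n) x y)} = (\<Union>e\<in>adj \<tau> X x c. ?D e)"
    using weyl_dist_Cons weyl_dist_alt_step[OF "2.prems"(1,2,3)] by fastforce
  \<comment> \<open>Two first steps \<open>e\<close> and \<open>e'\<close> leading to the same
    \<open>d\<close> would be \<open>x\<close>-adjacent, which gives \<open>e\<close> two distances
    to \<open>d\<close> that differ by the letter \<open>x\<close>.\<close>
  have disj: "?D e \<inter> ?D e' = {}" if "e \<in> adj \<tau> X x c" "e' \<in> adj \<tau> X x c" "e \<noteq> e'" for e e'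
  proof (rule ccontr)
    assume "?D e \<inter> ?D e' \<noteq> {}"
    then obtain d where d: "weyl_dist e d (alt n y x)" "weyl_dist e' d (alt n y x)" by blast
    have "e' \<in> adj \<tau> X x e" using that unfolding adj_def by auto
    then have "weyl_dist e d (alt (Suc n) x y)"
      using weyl_dist_alt_step[OF "2.prems"(1,2) ch[OF that(1)] _ d(2)] by blast
    then have "[x] @ alt n y x \<doteq> [] @ alt n y x" using weyl_dist_unique d(1) by fastforce
    then show False unfolding weq_cancel_right using generator_not_weq by blast
  qed
  have "gallery_sum (adj \<tau> X) (alt (Suc n) x y) f c = (\<Sum>e\<in>adj \<tau> X x c. sum f (?D e))"
    using IH by (simp add: adj_sum_def)
  also have "\<dots> = sum f (\<Union>e\<in>adj \<tau> X x c. ?D e)"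
    using IH disj fin "2.prems" by (intro sum.UNION_disjoint[symmetric]) auto
  finally show ?case unfolding D using IH fin "2.prems" by auto
qed

text \<open>Both alternating words are the same group element, so both sums run over the same
  chambers.\<close>

lemma gallery_sum_braid:
  assumes fin: "\<And>c u. c \<in> chambers \<tau> X \<Longrightarrow> finite (adj \<tau> X u c)" and c: "c \<in> chambers \<tau> X"
  shows "gallery_sum (adj \<tau> X) (alt k s t) f c = gallery_sum (adj \<tau> X) (alt k t s) f c"
proof -
  have "{d. weyl_dist c d (alt k s t)} = {d. weyl_dist c d (alt k t s)}"
    using weyl_dist_weq[OF _ alt_braid[OF st m k]] weyl_dist_weq[OF _ weq_sym[OF alt_braid[OF st m k]]] by blast
  then show ?thesis
    using gallery_sum_alt[OF fin _ _ c, of k s t f] gallery_sum_alt[OF fin _ _ c, of k t s f]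
    by (simp add: insert_commute)
qed

end

end

section \<open>Transfer along coverings\<close>

text \<open>This is what is kept of \<open>X\<close>; apartments no longer occur.
  \<open>N u c\<close> leaves out \<open>c\<close>, so a panel of cotype \<open>u\<close> lies in
  \<open>a u + 1\<close> chambers, hence the shift in the comparison with \<open>q\<close>.\<close>

locale chamber_system =
  fixes C :: "'c set" and N :: "'t::finite \<Rightarrow> 'c \<Rightarrow> 'c set" and a :: "'t \<Rightarrow> nat" and q m :: nat
  assumes finite_C: "finite C" and C_nonempty: "C \<noteq> {}"
    and N_subset: "\<And>c u. c \<in> C \<Longrightarrow> N u c \<subseteq> C - {c}"
    and N_sym: "\<And>c d u. c \<in> C \<Longrightarrow> d \<in> N u c \<Longrightarrow> c \<in> N u d"
    and N_trans: "\<And>c d e u. c \<in> C \<Longrightarrow> d \<in> N u c \<Longrightarrow> e \<in> N u d \<Longrightarrow> e \<noteq> c \<Longrightarrow> e \<in> N u c"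
    and card_N: "\<And>c u. c \<in> C \<Longrightarrow> card (N u c) = a u"
    and q_le: "\<And>u. q \<le> a u + 1" and q_ge_1: "1 \<le> q"
    and braid: "\<And>s t. s \<noteq> t \<Longrightarrow> \<exists>k. 2 \<le> k \<and> k \<le> m \<and>
       (\<forall>f. \<forall>c\<in>C. gallery_sum N (alt k s t) f c = gallery_sum N (alt k t s) f c)"
    and connected: "\<And>f c d. (\<And>c d u. c \<in> C \<Longrightarrow> d \<in> N u c \<Longrightarrow> f d = f c) \<Longrightarrow>
       c \<in> C \<Longrightarrow> d \<in> C \<Longrightarrow> f c = (f d :: real)"

lemma panel_image:
  assumes "\<And>v. v \<in> c \<Longrightarrow> \<tau> v = \<tau>' (\<pi> v)"
  shows "panel \<tau>' u (\<pi> ` c) = \<pi> ` panel \<tau> u c"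
  using assms by (auto simp: panel_def)

lemma bij_betw_image_label:
  assumes "\<And>v. v \<in> c \<Longrightarrow> \<tau> v = \<tau>' (\<pi> v)" and "inj_on \<pi> c"
  shows "bij_betw \<tau> c UNIV \<longleftrightarrow> bij_betw \<tau>' (\<pi> ` c) UNIV"
proof -
  have "bij_betw \<tau> c UNIV \<longleftrightarrow> bij_betw (\<tau>' \<circ> \<pi>) c UNIV"
    using assms(1) by (intro bij_betw_cong) simp
  also have "\<dots> \<longleftrightarrow> bij_betw \<tau>' (\<pi> ` c) UNIV"
    using assms(2) by (intro bij_betw_comp_iff[symmetric]) (simp add: bij_betw_def)
  finally show ?thesis .
qed

text \<open>A covering is given as a bijection on stars of vertices, so a panel must have a vertex
  to be lifted; with a single label it would be empty.\<close>

lemma panel_nonempty: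
  fixes \<tau> :: "'v \<Rightarrow> 't::finite"
  assumes "CARD('t) \<ge> 2" "c \<in> chambers \<tau> X"
  shows "\<exists>v. v \<in> panel \<tau> u c"
proof -
  have "UNIV \<noteq> {u}" using assms(1) by (metis card_1_singleton_iff not_numeral_le_zero numeral_One numeral_le_iff semiring_norm(69) is_singleton_def is_singleton_altdef)
  then obtain w where "w \<noteq> u" by blast
  then show ?thesis using chamber_vertex_ex[OF assms(2), of w] unfolding panel_def by blast
qed

context labelled_building
begin

lemma simplicial: "abstract_simplicial_complex X"
  using building_props by blast

lemma subset_closed: "x \<in> X \<Longrightarrow> y \<subseteq> x \<Longrightarrow> y \<in> X"
  using simplicial unfolding abstract_simplicial_complex_def by blast

lemma chambers_nonempty: "chambers \<tau> X \<noteq> {}"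
  using chambers_pure[of "{}"] simplicial unfolding abstract_simplicial_complex_def by blast

lemma top_faces: "CARD('t) = d + 1 \<Longrightarrow> faces X d = chambers \<tau> X"
  by (rule faces_eq_chambers[OF chambers_pure])

lemma thick_adj:
  assumes "CARD('t) = d + 1" "thick q d X" "c \<in> chambers \<tau> X" "finite (adj \<tau> X u c)"
  shows "q \<le> card (adj \<tau> X u c) + 1"
proof -
  let ?p = "panel \<tau> u c"
  have p: "?p \<in> X" using subset_closed[of c ?p] assms(3) by (auto simp: panel_def chambers_def)
  obtain v where v: "v \<in> c" "\<tau> v = u" using chamber_vertex_ex[OF assms(3)] by blast
  have "?p = c - {v}" using v chamber_vertex_eq[OF assms(3)] by (auto simp: panel_def)
  then have "card ?p = d" using card_chamber[OF assms(3)] assms(1) v chamber_finite[OF assms(3)] by simp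
  have "{y \<in> faces X d. ?p \<subseteq> y} = insert c (adj \<tau> X u c)"
  proof -
    have 1: "panel \<tau> u y = ?p" if "y \<in> chambers \<tau> X" "?p \<subseteq> y" for y
    proof
      show "?p \<subseteq> panel \<tau> u y" using that by (auto simp: panel_def)
      show "panel \<tau> u y \<subseteq> ?p"
      proof
        fix w assume w: "w \<in> panel \<tau> u y"
        obtain w' where w': "w' \<in> c" "\<tau> w' = \<tau> w" using chamber_vertex_ex[OF assms(3)] by metis
        then have "w' \<in> ?p" using w by (auto simp: panel_def)
        then have "w' = w" using chamber_vertex_eq[OF that(1)] that(2) w w' by (auto simp: panel_def)
        then show "w \<in> ?p" using \<open>w' \<in> ?p\<close> by simp
      qed
    qed
    have 2: "?p \<subseteq> y" if "panel \<tau> u y = ?p" for y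
      unfolding that[symmetric] by (auto simp: panel_def)
    show ?thesis unfolding top_faces[OF assms(1)] adj_def using assms(3) 1 2 by blast
  qed
  then have "q \<le> card (insert c (adj \<tau> X u c))"
    using assms(2,4) p \<open>card ?p = d\<close> unfolding thick_def by fastforce
  also have "\<dots> = card (adj \<tau> X u c) + 1" using assms(4) by (simp add: adj_def)
  finally show ?thesis .
qed

lemma automorphism_adj:
  assumes g: "simplicial_iso g X X" "\<And>v. v \<in> vertices X \<Longrightarrow> \<tau> (g v) = \<tau> v"
    and c: "c \<in> chambers \<tau> X"
  shows "bij_betw ((`) g) (adj \<tau> X u c) (adj \<tau> X u (g ` c))"
proof -
  have inj: "inj_on g (vertices X)" and im: "(`) g ` X = X"
    using g by (auto simp: simplicial_iso_def bij_betw_def)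
  have ch: "g ` d \<in> chambers \<tau> X \<longleftrightarrow> d \<in> chambers \<tau> X" if "d \<in> X" for d
  proof -
    have "inj_on g d" using inj_on_subset[OF inj, of d] that by blast
    moreover have "\<tau> v = \<tau> (g v)" if "v \<in> d" for v using g(2)[of v] that \<open>d \<in> X\<close> by (metis UnionI)
    ultimately have "bij_betw \<tau> d UNIV \<longleftrightarrow> bij_betw \<tau> (g ` d) UNIV" by (intro bij_betw_image_label)
    moreover have "g ` d \<in> X" using im that by blast
    ultimately show ?thesis using that unfolding chambers_def by simp
  qed
  have pan: "panel \<tau> u (g ` d) = g ` panel \<tau> u d" if "d \<in> X" for d
    using that by (intro panel_image) (metis g(2) UnionI)
  have eq: "g ` x = g ` y \<longleftrightarrow> x = y" if "x \<subseteq> vertices X" "y \<subseteq> vertices X" for x y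
    using inj_on_image_eq_iff[OF inj that] .
  have cX: "c \<in> X" using c by (simp add: chambers_def)
  have key: "g ` d \<in> adj \<tau> X u (g ` c) \<longleftrightarrow> d \<in> adj \<tau> X u c" if "d \<in> X" for d
  proof -
    have "panel \<tau> u d \<subseteq> vertices X" "panel \<tau> u c \<subseteq> vertices X" "d \<subseteq> vertices X" "c \<subseteq> vertices X"
      using that cX by (auto simp: panel_def)
    then show ?thesis unfolding adj_def using ch[OF that] pan[OF that] pan[OF cX] eq by simp
  qed
  show ?thesis
  proof (intro bij_betw_imageI)
    show "inj_on ((`) g) (adj \<tau> X u c)"
      using eq by (intro inj_onI) (auto simp: adj_def chambers_def)
    show "(`) g ` adj \<tau> X u c = adj \<tau> X u (g ` c)"
    proof
      show "(`) g ` adj \<tau> X u c \<subseteq> adj \<tau> X u (g ` c)"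
        using key by (auto simp: adj_def chambers_def)
      show "adj \<tau> X u (g ` c) \<subseteq> (`) g ` adj \<tau> X u c"
      proof
        fix e assume e: "e \<in> adj \<tau> X u (g ` c)"
        then have "e \<in> X" by (simp add: adj_def chambers_def)
        then obtain d where "d \<in> X" "e = g ` d" using im by blast
        then show "e \<in> (`) g ` adj \<tau> X u c" using key e by blast
      qed
    qed
  qed
qed

text \<open>Strong transitivity includes transitivity on chambers, and type-preserving automorphisms
  carry panels to panels of the same cotype.\<close>

lemma card_adj_constant:
  assumes d: "CARD('t) = d + 1" and act: "admits_strongly_transitive_action d X E \<tau>"
    and "c \<in> chambers \<tau> X" "c' \<in> chambers \<tau> X"
  shows "card (adj \<tau> X u c) = card (adj \<tau> X u c')"
proof -
  obtain G :: "('v \<Rightarrow> 'v) monoid" and \<phi> where sta: "strongly_transitive_action d X E \<tau> G \<phi>"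
    using act unfolding admits_strongly_transitive_action_def by blast
  have ex: "\<exists>A\<in>E. x \<in> faces A d" if "x \<in> chambers \<tau> X" for x
    using common_apartment[of x x] that top_faces[OF d] unfolding faces_def by blast
  obtain A A' where A: "A \<in> E" "c \<in> faces A d" "A' \<in> E" "c' \<in> faces A' d"
    using ex[OF assms(3)] ex[OF assms(4)] by blast
  have "\<forall>A\<in>E. \<forall>A'\<in>E. \<forall>x\<in>faces A d. \<forall>x'\<in>faces A' d.
        \<exists>g\<in>carrier G. (`) (\<phi> g) ` A = A' \<and> \<phi> g ` x = x'"
    using sta unfolding strongly_transitive_action_def by (elim conjE)
  then obtain g where g: "g \<in> carrier G" "\<phi> g ` c = c'" using A by meson
  have "simplicial_iso (\<phi> g) X X" "\<forall>v\<in>vertices X. \<tau> (\<phi> g v) = \<tau> v"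
    using sta g(1) unfolding strongly_transitive_action_def by auto
  then have "bij_betw ((`) (\<phi> g)) (adj \<tau> X u c) (adj \<tau> X u (\<phi> g ` c))"
    using assms(3) by (intro automorphism_adj) auto
  then show ?thesis using g(2) bij_betw_same_card by blast
qed

end

text \<open>A spherical building enters as its own covering by the identity map, so both cases of
  the theorem share all that follows.\<close>

locale labelled_covering = labelled_building T Y E \<tau>
  for T :: "'t::finite coxeter_diagram" and Y :: "'u set set" and E and \<tau> +
  fixes \<pi> :: "'u \<Rightarrow> 'v" and X :: "'v set set" and \<tau>' :: "'v \<Rightarrow> 't"
  assumes covering: "simplicial_covering \<pi> Y X"
    and label: "\<And>v. v \<in> vertices Y \<Longrightarrow> \<tau> v = \<tau>' (\<pi> v)"
    and two_labels: "CARD('t) \<ge> 2"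
begin

lemma face_label: "y \<in> Y \<Longrightarrow> v \<in> y \<Longrightarrow> \<tau> v = \<tau>' (\<pi> v)"
  using label by blast

lemma face_image: "y \<in> Y \<Longrightarrow> \<pi> ` y \<in> X"
  using covering unfolding simplicial_covering_def by blast

text \<open>Labels factor through \<open>\<pi>\<close>, and a chamber has only one vertex of each
  label.\<close>

lemma face_inj: "y \<in> Y \<Longrightarrow> inj_on \<pi> y"
proof (rule inj_onI)
  fix v w assume *: "y \<in> Y" "v \<in> y" "w \<in> y" "\<pi> v = \<pi> w"
  then obtain c where c: "c \<in> chambers \<tau> Y" "y \<subseteq> c" using chambers_pure by blast
  have "\<tau> v = \<tau> w" using * face_label by metis
  then show "v = w" using chamber_vertex_eq[OF c(1)] c(2) * by blast
qed

lemma star_inj: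
  assumes "y \<in> Y" "z \<in> Y" "v \<in> y" "v \<in> z" "\<pi> ` y = \<pi> ` z"
  shows "y = z"
proof -
  have "bij_betw ((`) \<pi>) {y \<in> Y. v \<in> y} {x \<in> X. \<pi> v \<in> x}"
    using covering assms unfolding simplicial_covering_def by blast
  then show ?thesis using assms by (auto simp: bij_betw_def dest: inj_onD)
qed

lemma star_surj:
  assumes "v \<in> vertices Y" "x \<in> X" "\<pi> v \<in> x"
  shows "\<exists>y\<in>Y. v \<in> y \<and> \<pi> ` y = x"
proof -
  have "bij_betw ((`) \<pi>) {y \<in> Y. v \<in> y} {x \<in> X. \<pi> v \<in> x}"
    using covering assms(1) unfolding simplicial_covering_def by blast
  then have "x \<in> (`) \<pi> ` {y \<in> Y. v \<in> y}" using assms by (simp add: bij_betw_def)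
  then show ?thesis by blast
qed

lemma chamber_image_iff: "y \<in> Y \<Longrightarrow> \<pi> ` y \<in> chambers \<tau>' X \<longleftrightarrow> y \<in> chambers \<tau> Y"
  using bij_betw_image_label[of y \<tau> \<tau>' \<pi>] face_label face_inj face_image unfolding chambers_def by auto

lemma face_lift:
  assumes "x \<in> X" "x \<noteq> {}"
  shows "\<exists>y\<in>Y. \<pi> ` y = x"
proof -
  obtain v' where v': "v' \<in> x" using assms by blast
  have "\<pi> ` vertices Y = vertices X" using covering unfolding simplicial_covering_def by (elim conjE)
  moreover have "v' \<in> vertices X" using assms(1) v' by (rule UnionI)
  ultimately have "v' \<in> \<pi> ` vertices Y" by (simp only:)
  then obtain v where v: "v \<in> vertices Y" "\<pi> v = v'" by (elim imageE) simp
  have "\<exists>y\<in>Y. v \<in> y \<and> \<pi> ` y = x" using v v' by (intro star_surj assms(1)) simp_all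
  then show ?thesis by blast
qed

lemma covered_pure:
  assumes "x \<in> X"
  shows "\<exists>c\<in>chambers \<tau>' X. x \<subseteq> c"
proof -
  have "\<exists>y\<in>Y. x \<subseteq> \<pi> ` y"
  proof (cases "x = {}")
    case True
    then show ?thesis using chambers_nonempty by (auto simp: chambers_def)
  qed (use face_lift assms in blast)
  then obtain y where y: "y \<in> Y" "x \<subseteq> \<pi> ` y" by blast
  then obtain c where c: "c \<in> chambers \<tau> Y" "y \<subseteq> c" using chambers_pure by blast
  then have "\<pi> ` c \<in> chambers \<tau>' X" using chamber_image_iff by (auto simp: chambers_def)
  then show ?thesis using y c by blast
qed

lemma chamber_lift:
  assumes "c \<in> chambers \<tau>' X"
  shows "\<exists>d\<in>chambers \<tau> Y. \<pi> ` d = c"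
proof -
  have "c \<noteq> {}" "c \<in> X" using chamber_vertex_ex[OF assms] assms by (auto simp: chambers_def)
  then obtain y where "y \<in> Y" "\<pi> ` y = c" using face_lift by blast
  then show ?thesis using chamber_image_iff assms by blast
qed

text \<open>All chambers on the panel of \<open>c\<close> contain a fixed vertex \<open>v\<close> of
  that panel, and the covering is a bijection on the star of \<open>v\<close>.\<close>

lemma adj_image:
  assumes c: "c \<in> chambers \<tau> Y"
  shows "bij_betw ((`) \<pi>) (adj \<tau> Y u c) (adj \<tau>' X u (\<pi> ` c))"
proof -
  obtain v where v: "v \<in> panel \<tau> u c" using panel_nonempty[OF two_labels c] by blast
  have cY: "c \<in> Y" using c by (simp add: chambers_def)
  have pan: "panel \<tau>' u (\<pi> ` d) = \<pi> ` panel \<tau> u d" if "d \<in> Y" for d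
    using face_label that by (intro panel_image) auto
  have pY: "panel \<tau> u d \<in> Y" if "d \<in> Y" for d
    using subset_closed[OF that, of "panel \<tau> u d"] by (auto simp: panel_def)
  have vc: "v \<in> c" using v by (simp add: panel_def)
  have adjY: "d \<in> Y" "v \<in> d" "d \<in> chambers \<tau> Y" "d \<noteq> c" "panel \<tau> u d = panel \<tau> u c" if "d \<in> adj \<tau> Y u c" for d
    using that v by (auto simp: adj_def chambers_def panel_def)
  show ?thesis
  proof (intro bij_betw_imageI)
    show "inj_on ((`) \<pi>) (adj \<tau> Y u c)" using star_inj adjY by (intro inj_onI) blast
    show "(`) \<pi> ` adj \<tau> Y u c = adj \<tau>' X u (\<pi> ` c)"
    proof
      show "(`) \<pi> ` adj \<tau> Y u c \<subseteq> adj \<tau>' X u (\<pi> ` c)"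
      proof clarify
        fix d assume d: "d \<in> adj \<tau> Y u c"
        have "\<pi> ` d \<noteq> \<pi> ` c" using star_inj[OF adjY(1)[OF d] cY adjY(2)[OF d] vc] adjY(4)[OF d] by blast
        moreover have "\<pi> ` d \<in> chambers \<tau>' X" using chamber_image_iff[OF adjY(1)[OF d]] adjY(3)[OF d] by blast
        moreover have "panel \<tau>' u (\<pi> ` d) = panel \<tau>' u (\<pi> ` c)"
          using pan[OF adjY(1)[OF d]] pan[OF cY] adjY(5)[OF d] by simp
        ultimately show "\<pi> ` d \<in> adj \<tau>' X u (\<pi> ` c)" unfolding adj_def by blast
      qed
      show "adj \<tau>' X u (\<pi> ` c) \<subseteq> (`) \<pi> ` adj \<tau> Y u c"
      proof
        fix x assume x: "x \<in> adj \<tau>' X u (\<pi> ` c)"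
        then have xX: "x \<in> X" "x \<in> chambers \<tau>' X" "x \<noteq> \<pi> ` c" "panel \<tau>' u x = \<pi> ` panel \<tau> u c"
          using pan[OF cY] by (auto simp: adj_def chambers_def)
        then have "\<pi> v \<in> panel \<tau>' u x" using v by simp
        then have vx: "\<pi> v \<in> x" "\<tau>' (\<pi> v) \<noteq> u" by (auto simp: panel_def)
        obtain y where y: "y \<in> Y" "v \<in> y" "\<pi> ` y = x" using star_surj[OF _ xX(1) vx(1)] cY vc by blast
        have "v \<in> panel \<tau> u y" using vx(2) y face_label by (auto simp: panel_def)
        moreover have "\<pi> ` panel \<tau> u y = \<pi> ` panel \<tau> u c" using pan[OF y(1)] y(3) xX(4) by simp
        ultimately have "panel \<tau> u y = panel \<tau> u c" using star_inj[OF pY[OF y(1)] pY[OF cY]] v by blast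
        moreover have "y \<in> chambers \<tau> Y" using chamber_image_iff[OF y(1)] y(3) xX(2) by blast
        ultimately have "y \<in> adj \<tau> Y u c" using xX(3) y(3) by (auto simp: adj_def)
        then show "x \<in> (`) \<pi> ` adj \<tau> Y u c" using y(3) by blast
      qed
    qed
  qed
qed

text \<open>Galleries lift uniquely, one adjacency at a time.\<close>

lemma gallery_sum_image:
  assumes "c \<in> chambers \<tau> Y"
  shows "gallery_sum (adj \<tau>' X) us f (\<pi> ` c) = gallery_sum (adj \<tau> Y) us (\<lambda>d. f (\<pi> ` d)) c"
  using assms
proof (induction us arbitrary: c)
  case (Cons u us)
  have "gallery_sum (adj \<tau>' X) (u # us) f (\<pi> ` c) = (\<Sum>d\<in>adj \<tau> Y u c. gallery_sum (adj \<tau>' X) us f (\<pi> ` d))"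
    using sum.reindex_bij_betw[OF adj_image[OF Cons.prems], of "gallery_sum (adj \<tau>' X) us f"]
    by (simp add: adj_sum_def)
  also have "\<dots> = (\<Sum>d\<in>adj \<tau> Y u c. gallery_sum (adj \<tau> Y) us (\<lambda>d. f (\<pi> ` d)) d)"
    by (intro sum.cong refl Cons.IH) (simp add: adj_def)
  also have "\<dots> = gallery_sum (adj \<tau> Y) (u # us) (\<lambda>d. f (\<pi> ` d)) c" by (simp add: adj_sum_def)
  finally show ?case .
qed simp

lemma covered_chamber_system:
  assumes finX: "finite X" and m: "max_label T = enat m" and q: "1 \<le> q"
    and d: "CARD('t) = d + 1" and th: "thick q d Y"
    and act: "admits_strongly_transitive_action d Y E \<tau>"
  shows "\<exists>a. chamber_system (chambers \<tau>' X) (adj \<tau>' X) a q m"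
proof -
  have fin: "finite (chambers \<tau>' X)" using finX by (simp add: chambers_def)
  \<comment> \<open>\<open>Y\<close> may be infinite, but its panels inherit finiteness from
    \<open>X\<close>.\<close>
  have finadj: "finite (adj \<tau> Y u c)" if "c \<in> chambers \<tau> Y" for u c
    using bij_betw_finite[OF adj_image[OF that]] fin by (simp add: adj_def)
  obtain c0 where c0: "c0 \<in> chambers \<tau> Y" using chambers_nonempty by blast
  define a where "a = (\<lambda>u. card (adj \<tau> Y u c0))"
  have "chamber_system (chambers \<tau>' X) (adj \<tau>' X) a q m"
  proof
    show "chambers \<tau>' X \<noteq> {}" using c0 chamber_image_iff by (auto simp: chambers_def)
    show "card (adj \<tau>' X u c) = a u" if c: "c \<in> chambers \<tau>' X" for c u
    proof -
      obtain d where "d \<in> chambers \<tau> Y" "\<pi> ` d = c" using chamber_lift[OF c] by blast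
      then show ?thesis
        using bij_betw_same_card[OF adj_image] card_adj_constant[OF d act _ c0] unfolding a_def by metis
    qed
    show "q \<le> a u + 1" for u unfolding a_def using thick_adj[OF d th c0 finadj[OF c0]] .
    show "\<exists>k. 2 \<le> k \<and> k \<le> m \<and> (\<forall>f. \<forall>c\<in>chambers \<tau>' X.
        gallery_sum (adj \<tau>' X) (alt k s t) f c = gallery_sum (adj \<tau>' X) (alt k t s) f c)"
      if "s \<noteq> t" for s t
    proof (intro exI conjI allI ballI)
      show "2 \<le> dihedral_order s t" using dihedral_order_ge_2[OF that m refl] .
      show "dihedral_order s t \<le> m" using dihedral_order_props(3)[OF that m refl] .
      fix f c assume c: "c \<in> chambers \<tau>' X"
      then obtain d where d: "d \<in> chambers \<tau> Y" "\<pi> ` d = c" using chamber_lift[OF c] by blast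
      show "gallery_sum (adj \<tau>' X) (alt (dihedral_order s t) s t) f c =
          gallery_sum (adj \<tau>' X) (alt (dihedral_order s t) t s) f c"
        using gallery_sum_image[OF d(1)] gallery_sum_braid[OF that m refl finadj d(1)] d(2) by metis
    qed
    show "f c = (f d :: real)"
      if *: "\<And>c d u. c \<in> chambers \<tau>' X \<Longrightarrow> d \<in> adj \<tau>' X u c \<Longrightarrow> f d = f c"
        and cd: "c \<in> chambers \<tau>' X" "d \<in> chambers \<tau>' X" for f c d
    proof -
      \<comment> \<open>Connectedness is inherited through lifts: the pullback of \<open>f\<close>
        is constant along adjacencies upstairs.\<close>
      obtain c' d' where cd': "c' \<in> chambers \<tau> Y" "\<pi> ` c' = c" "d' \<in> chambers \<tau> Y" "\<pi> ` d' = d"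
        using chamber_lift[OF cd(1)] chamber_lift[OF cd(2)] by blast
      have inv: "f (\<pi> ` e') = f (\<pi> ` e)" if "e \<in> chambers \<tau> Y" "e' \<in> adj \<tau> Y u e" for e e' u
      proof (rule *)
        show "\<pi> ` e \<in> chambers \<tau>' X" using that(1) chamber_image_iff[of e] by (simp add: chambers_def)
        show "\<pi> ` e' \<in> adj \<tau>' X u (\<pi> ` e)" using bij_betwE[OF adj_image[OF that(1)]] that(2) by simp
      qed
      have "f (\<pi> ` c') = f (\<pi> ` d')"
        by (rule adj_invariant_constant[of "\<lambda>e. f (\<pi> ` e)", OF inv cd'(1,3)])
      then show ?thesis using cd' by simp
    qed
  qed (use fin q in \<open>auto simp: adj_def\<close>)
  then show ?thesis by blast
qed

end

lemma simplicial_covering_id: "abstract_simplicial_complex X \<Longrightarrow> simplicial_covering (\<lambda>v. v) X X"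
  unfolding simplicial_covering_def by (auto simp: bij_betw_def inj_on_def)

lemma building_quotient_chamber_system:
  fixes T :: "'t::finite coxeter_diagram" and X :: "'v set set"
  assumes "r \<ge> 1" "q \<ge> 1" "abstract_simplicial_complex X" "finite X" "has_dimension X r"
    and cases: "(\<exists>E \<tau>. building T X E \<and> building_labelling T E \<tau> \<and> spherical_diagram T \<and>
              thick q r X \<and> admits_strongly_transitive_action r X E \<tau>)
       \<or> (\<exists>(Y :: 'u set set) \<pi> d E \<tau>.
              universal_covering \<pi> Y X \<and>
              building T Y E \<and> building_labelling T E \<tau> \<and> affine_diagram T \<and>
              has_dimension Y d \<and> d \<ge> 2 \<and> thick q d Y \<and>
              admits_strongly_transitive_action d Y E \<tau> \<and>
              (\<exists>\<tau>'. \<forall>v\<in>vertices Y. \<tau> v = \<tau>' (\<pi> v)))"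
    and m: "max_label T = enat m"
  shows "\<exists>(\<tau> :: 'v \<Rightarrow> 't) a. CARD('t) = r + 1 \<and> (\<forall>x\<in>X. \<exists>c\<in>chambers \<tau> X. x \<subseteq> c) \<and>
     chamber_system (chambers \<tau> X) (adj \<tau> X) a q m"
  using cases
proof
  assume "\<exists>E \<tau>. building T X E \<and> building_labelling T E \<tau> \<and> spherical_diagram T \<and>
              thick q r X \<and> admits_strongly_transitive_action r X E \<tau>"
  then obtain E and \<tau> :: "'v \<Rightarrow> 't" where *: "building T X E" "building_labelling T E \<tau>" "thick q r X"
      "admits_strongly_transitive_action r X E \<tau>" by blast
  interpret labelled_building T X E \<tau>
    using * by unfold_locales (auto simp: building_def)
  have r: "CARD('t) = r + 1" using card_labels_eq[OF chambers_pure assms(5)] .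
  interpret labelled_covering T X E \<tau> "\<lambda>v. v" X \<tau>
    using r assms(1) simplicial_covering_id[OF assms(3)] by unfold_locales auto
  show ?thesis using covered_chamber_system[OF assms(4) m assms(2) r *(3,4)] covered_pure r by blast
next
  assume "\<exists>(Y :: 'u set set) \<pi> d E \<tau>.
              universal_covering \<pi> Y X \<and>
              building T Y E \<and> building_labelling T E \<tau> \<and> affine_diagram T \<and>
              has_dimension Y d \<and> d \<ge> 2 \<and> thick q d Y \<and>
              admits_strongly_transitive_action d Y E \<tau> \<and>
              (\<exists>\<tau>'. \<forall>v\<in>vertices Y. \<tau> v = \<tau>' (\<pi> v))"
  then obtain Y :: "'u set set" and \<pi> d E and \<tau> :: "'u \<Rightarrow> 't" and \<tau>' :: "'v \<Rightarrow> 't"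
    where *: "universal_covering \<pi> Y X" "building T Y E" "building_labelling T E \<tau>"
      "has_dimension Y d" "d \<ge> 2" "thick q d Y" "admits_strongly_transitive_action d Y E \<tau>"
      "\<forall>v\<in>vertices Y. \<tau> v = \<tau>' (\<pi> v)" by blast
  interpret labelled_building T Y E \<tau>
    using * by unfold_locales (auto simp: building_def)
  have d: "CARD('t) = d + 1" using card_labels_eq[OF chambers_pure *(4)] .
  interpret labelled_covering T Y E \<tau> \<pi> X \<tau>'
    using * d by unfold_locales (auto simp: universal_covering_def)
  \<comment> \<open>Both dimensions are one less than the number of labels.\<close>
  have "r = d" using card_labels_eq[OF covered_pure assms(5)] d by simp
  then show ?thesis using covered_chamber_system[OF assms(4) m assms(2) d *(6,7)] covered_pure d by blast
qed

section \<open>The spectral gap of a dihedral pair\<close>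

text \<open>
  In the plane spanned by two unit vectors \<open>x\<close>, \<open>y\<close> with \<open>\<langle>x, y\<rangle> = \<theta>\<close>, the adjacency operators of two
  types act in coordinates by \<open>plane_s\<close> and \<open>plane_t\<close>.
\<close>
context
  fixes a b \<theta> :: real
begin

definition plane_s :: "real \<times> real \<Rightarrow> real \<times> real" where
  "plane_s p = (a * fst p + (a + 1) * \<theta> * snd p, - snd p)"

definition plane_t :: "real \<times> real \<Rightarrow> real \<times> real" where
  "plane_t p = (- fst p, (b + 1) * \<theta> * fst p + b * snd p)"

text \<open>The trace of \<open>plane_s\<close> after \<open>plane_t\<close> as a 2 by 2 matrix; its
  determinant is \<open>a * b\<close>.\<close>

definition plane_trace :: real where
  "plane_trace = (a + 1) * (b + 1) * \<theta>\<^sup>2 - a - b"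

text \<open>Rescaled Chebyshev polynomials of the second kind. By Cayley-Hamilton they are the
  coefficients that express powers of a 2 by 2 matrix with this trace and determinant
  \<open>a * b\<close> by the matrix and the identity.\<close>

fun plane_cheb :: "nat \<Rightarrow> real" where
  "plane_cheb 0 = 0"
| "plane_cheb (Suc 0) = 1"
| "plane_cheb (Suc (Suc n)) = plane_trace * plane_cheb (Suc n) - a * b * plane_cheb n"

lemma st_square: "plane_s (plane_t (plane_s (plane_t p))) = (plane_trace * fst (plane_s (plane_t p)) - a * b * fst p, plane_trace * snd (plane_s (plane_t p)) - a * b * snd p)"
  by (cases p) (simp add: plane_s_def plane_t_def plane_trace_def algebra_simps power2_eq_square)

lemma ts_square: "plane_t (plane_s (plane_t (plane_s p))) = (plane_trace * fst (plane_t (plane_s p)) - a * b * fst p, plane_trace * snd (plane_t (plane_s p)) - a * b * snd p)"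
  by (cases p) (simp add: plane_s_def plane_t_def plane_trace_def algebra_simps power2_eq_square)

abbreviation plane_gen :: "bool \<Rightarrow> real \<times> real \<Rightarrow> real \<times> real" where
  "plane_gen c \<equiv> (if c then plane_s else plane_t)"

lemma st_power: "foldr plane_gen (alt (2 * Suc n) True False) p =
    (plane_cheb (Suc n) * fst (plane_s (plane_t p)) - a * b * plane_cheb n * fst p, plane_cheb (Suc n) * snd (plane_s (plane_t p)) - a * b * plane_cheb n * snd p)"
proof (induction n)
  case (Suc n)
  have lin: "plane_s (plane_t (r * fst u - s * fst v, r * snd u - s * snd v)) =
      (r * fst (plane_s (plane_t u)) - s * fst (plane_s (plane_t v)), r * snd (plane_s (plane_t u)) - s * snd (plane_s (plane_t v)))" for r s u v
    by (simp add: plane_s_def plane_t_def algebra_simps)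
  have "foldr plane_gen (alt (2 * Suc (Suc n)) True False) p = plane_s (plane_t (foldr plane_gen (alt (2 * Suc n) True False) p))"
    by simp
  then show ?case unfolding Suc lin st_square by (simp add: algebra_simps)
qed (simp add: numeral_2_eq_2)

lemma ts_power: "foldr plane_gen (alt (2 * Suc n) False True) p =
    (plane_cheb (Suc n) * fst (plane_t (plane_s p)) - a * b * plane_cheb n * fst p, plane_cheb (Suc n) * snd (plane_t (plane_s p)) - a * b * plane_cheb n * snd p)"
proof (induction n)
  case (Suc n)
  have lin: "plane_t (plane_s (r * fst u - s * fst v, r * snd u - s * snd v)) =
      (r * fst (plane_t (plane_s u)) - s * fst (plane_t (plane_s v)), r * snd (plane_t (plane_s u)) - s * snd (plane_t (plane_s v)))" for r s u v
    by (simp add: plane_s_def plane_t_def algebra_simps)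
  have "foldr plane_gen (alt (2 * Suc (Suc n)) False True) p = plane_t (plane_s (foldr plane_gen (alt (2 * Suc n) False True) p))"
    by simp
  then show ?case unfolding Suc lin ts_square by (simp add: algebra_simps)
qed (simp add: numeral_2_eq_2)

context
  fixes q :: real
  assumes ab: "a \<ge> 0" "b \<ge> 0" and qa: "q \<le> a + 1" and qb: "q \<le> b + 1" and q1: "q \<ge> 1" and \<theta>: "\<theta> > 0"
begin

text \<open>Both products of the two maps have the same trace and determinant, so the multiples of
  the identity in \<open>st_power\<close> and \<open>ts_power\<close> agree. The products differ at
  \<open>(0, 1)\<close>, so their common coefficient must vanish.\<close>

lemma braid_even:
  assumes "\<And>p. foldr plane_gen (alt (2 * Suc n) True False) p = foldr plane_gen (alt (2 * Suc n) False True) p"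
  shows "plane_cheb (Suc n) = 0"
proof -
  have "plane_cheb (Suc n) * fst (plane_s (plane_t (0, 1))) = plane_cheb (Suc n) * fst (plane_t (plane_s (0, 1)))"
    using assms[of "(0, 1)"] unfolding st_power ts_power by simp
  then have "plane_cheb (Suc n) * ((a + 1) * (b + 1) * \<theta>) = 0"
    by (simp add: plane_s_def plane_t_def algebra_simps)
  then show ?thesis using ab \<theta> by simp
qed

text \<open>Splitting off the first letter leaves a power of the opposite product; the relation is
  the first coordinate at \<open>(0, 1)\<close>, divided by
  \<open>(a + 1) * \<theta>\<close>.\<close>

lemma braid_odd:
  assumes "\<And>p. foldr plane_gen (alt (Suc (2 * Suc n)) True False) p = foldr plane_gen (alt (Suc (2 * Suc n)) False True) p"
  shows "plane_cheb (Suc n) * (plane_trace + b) = a * b * plane_cheb n"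
proof -
  have "foldr plane_gen (alt (Suc (2 * Suc n)) True False) p = plane_s (foldr plane_gen (alt (2 * Suc n) False True) p)"
    "foldr plane_gen (alt (Suc (2 * Suc n)) False True) p = plane_t (foldr plane_gen (alt (2 * Suc n) True False) p)" for p
    by (subst alt.simps, simp del: alt.simps)+
  then have "fst (plane_s (foldr plane_gen (alt (2 * Suc n) False True) (0, 1))) = fst (plane_t (foldr plane_gen (alt (2 * Suc n) True False) (0, 1)))"
    using assms[of "(0, 1)"] by (simp del: alt.simps)
  then have "(a + 1) * \<theta> * (plane_cheb (Suc n) * (plane_trace + b) - a * b * plane_cheb n) = 0"
    unfolding st_power ts_power by (simp add: plane_s_def plane_t_def plane_trace_def algebra_simps power2_eq_square)
  then show ?thesis using ab \<theta> by simp
qed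

text \<open>Since \<open>a * b\<close> is at most the square of \<open>(a + b) / 2\<close>, a trace
  above \<open>a + b\<close> keeps the ratio of successive values at least
  \<open>(a + b) / 2\<close>; no value after the zeroth can vanish.\<close>

lemma plane_cheb_growth:
  assumes "plane_trace > a + b"
  shows "plane_cheb n \<ge> 0 \<and> plane_cheb (Suc n) \<ge> (a + b) / 2 * plane_cheb n \<and> plane_cheb (Suc n) > 0"
proof (induction n)
  case (Suc n)
  let ?h = "(a + b) / 2"
  have "0 \<le> (a - b)\<^sup>2" by simp
  then have h: "?h \<ge> 0" "a * b \<le> ?h * ?h"
    using ab by (simp_all add: power2_eq_square field_simps)
  have "a * b * plane_cheb n \<le> ?h * ?h * plane_cheb n" using h Suc by (intro mult_right_mono) auto
  also have "\<dots> = ?h * (?h * plane_cheb n)" by simp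
  also have "\<dots> \<le> ?h * plane_cheb (Suc n)" using h Suc by (intro mult_left_mono) auto
  finally have step: "plane_cheb (Suc (Suc n)) \<ge> (plane_trace - ?h) * plane_cheb (Suc n)" by (simp add: algebra_simps)
  have "plane_trace - ?h > ?h" using assms by (simp add: field_simps)
  then have step': "(plane_trace - ?h) * plane_cheb (Suc n) > ?h * plane_cheb (Suc n)"
    using Suc by (intro mult_strict_right_mono) auto
  have "?h * plane_cheb (Suc n) \<ge> 0" using h(1) Suc by (intro mult_nonneg_nonneg) auto
  then have "plane_cheb (Suc (Suc n)) > 0" "plane_cheb (Suc (Suc n)) \<ge> ?h * plane_cheb (Suc n)" using step step' by linarith+
  then show ?case using Suc by simp
qed simp

text \<open>The reason is \<open>q * (a + b) \<le> 2 * ((a + 1) * (b + 1))\<close>, where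
  \<open>q\<close> is estimated by \<open>b + 1\<close> in front of \<open>a\<close> and by
  \<open>a + 1\<close> in front of \<open>b\<close>.\<close>

lemma theta_bound:
  assumes "(a + 1) * (b + 1) * \<theta>\<^sup>2 \<le> l / 2 * (a + b)" "l \<ge> 0"
  shows "\<theta>\<^sup>2 \<le> l / q"
proof -
  have "q * (a + b) \<le> 2 * ((a + 1) * (b + 1))"
  proof -
    have "q * a \<le> (b + 1) * a" "q * b \<le> (a + 1) * b" using ab qa qb by (auto intro: mult_right_mono)
    then show ?thesis using ab by (simp add: algebra_simps)
  qed
  then have "l / 2 * (q * (a + b)) \<le> l / 2 * (2 * ((a + 1) * (b + 1)))" using assms(2) by (intro mult_left_mono) auto
  moreover have "q * ((a + 1) * (b + 1) * \<theta>\<^sup>2) \<le> q * (l / 2 * (a + b))"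
    using assms(1) q1 by (intro mult_left_mono) auto
  ultimately have "(a + 1) * (b + 1) * (q * \<theta>\<^sup>2) \<le> (a + 1) * (b + 1) * l" by (simp add: algebra_simps)
  moreover have "(a + 1) * (b + 1) > 0" using ab by simp
  ultimately have "q * \<theta>\<^sup>2 \<le> l" using mult_le_cancel_left_pos by blast
  then show ?thesis using q1 by (simp add: field_simps)
qed

text \<open>By definition of the trace, \<open>(a + 1) * (b + 1) * \<theta>\<^sup>2\<close> is the
  trace plus \<open>a + b\<close>. The relation makes the trace at most 0,
  \<open>(a + b) / 2\<close> or \<open>a + b\<close> for \<open>k = 4\<close>, \<open>k = 5\<close>
  or \<open>k \<ge> 6\<close>, and \<open>theta_bound\<close> gives 2, 3 or 4 over \<open>q\<close>.
  So \<open>k - 2\<close> fits the small cases and is at least 4 from 6 on.\<close>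

lemma dihedral_angle_bound:
  assumes k: "k \<ge> 2" and braid: "\<And>p. foldr plane_gen (alt k True False) p = foldr plane_gen (alt k False True) p"
  shows "\<theta>\<^sup>2 \<le> (real k - 2) / q"
proof -
  have plane_trace: "(a + 1) * (b + 1) * \<theta>\<^sup>2 = plane_trace + a + b" by (simp add: plane_trace_def)
  obtain n where n: "k = 2 * Suc n \<or> k = Suc (2 * Suc n)"
  proof (cases "even k")
    case True
    then obtain j where "k = 2 * j" by blast
    then show ?thesis using k that[of "j - 1"] by (cases j) auto
  next
    case False
    then obtain j where "k = Suc (2 * j)" by (auto elim: oddE)
    then show ?thesis using k that[of "j - 1"] by (cases j) auto
  qed
  have rel: "plane_cheb (Suc n) = 0 \<and> k = 2 * Suc n \<or> plane_cheb (Suc n) * (plane_trace + b) = a * b * plane_cheb n \<and> k = Suc (2 * Suc n)"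
    using n braid braid_even[of n] braid_odd[of n] by metis
  consider "k = 2" | "k = 3" | "k = 4" | "k = 5" | "k \<ge> 6" using k by linarith
  then show ?thesis
  proof cases
    case 1
    \<comment> \<open>\<open>plane_cheb 1 = 1\<close> contradicts the relation: commuting operators
      admit no positive \<open>\<theta>\<close>.\<close>
    then show ?thesis using rel by auto
  next
    case 2
    then have "n = 0" using n by auto
    then have "plane_trace + b = 0" using rel 2 by auto
    \<comment> \<open>Here \<open>theta_bound\<close> would ask for \<open>a \<le> b\<close>, so the
      estimate is made directly from \<open>q \<le> b + 1\<close>.\<close>
    then have "(a + 1) * (b + 1) * \<theta>\<^sup>2 = a" using plane_trace by simp
    moreover have "q * a \<le> (b + 1) * a" using ab qb by (intro mult_right_mono) auto
    moreover have "(b + 1) * (q * ((a + 1) * \<theta>\<^sup>2)) = q * ((a + 1) * (b + 1) * \<theta>\<^sup>2)"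
      by (simp only: mult_ac)
    ultimately have "(b + 1) * (q * ((a + 1) * \<theta>\<^sup>2)) \<le> (b + 1) * a" by (simp only:)
    then have "q * ((a + 1) * \<theta>\<^sup>2) \<le> a" using ab by (subst (asm) mult_le_cancel_left_pos) auto
    then have "(a + 1) * (q * \<theta>\<^sup>2) \<le> (a + 1) * 1" by (simp add: algebra_simps)
    then have "q * \<theta>\<^sup>2 \<le> 1" using ab by (subst (asm) mult_le_cancel_left_pos) auto
    then show ?thesis using 2 q1 by (simp add: field_simps)
  next
    case 3
    then have "n = 1" using n by auto
    then have "plane_trace = 0" using rel 3 by (auto simp: numeral_eq_Suc)
    then have "\<theta>\<^sup>2 \<le> 2 / q" using plane_trace by (intro theta_bound) auto
    then show ?thesis using 3 by simp
  next
    case 4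
    then have "n = 1" using n by auto
    then have t: "plane_trace * (plane_trace + b) = a * b" using rel 4 by (auto simp: numeral_eq_Suc)
    have "plane_trace \<le> (a + b) / 2"
    proof (rule ccontr)
      assume "\<not> ?thesis"
      then have gt: "plane_trace > (a + b) / 2" by simp
      then have "plane_trace * plane_trace > (a + b) / 2 * ((a + b) / 2)" using ab by (intro mult_strict_mono) auto
      moreover have "plane_trace * b \<ge> 0" using gt ab by auto
      moreover have "0 \<le> (a - b)\<^sup>2" by simp
      then have "a * b \<le> (a + b) / 2 * ((a + b) / 2)" by (simp add: power2_eq_square field_simps)
      ultimately show False using t by (simp add: algebra_simps)
    qed
    then have "\<theta>\<^sup>2 \<le> 3 / q" using plane_trace by (intro theta_bound) auto
    then show ?thesis using 4 by simp
  next
    case 5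
    have "plane_trace \<le> a + b"
    proof (rule ccontr)
      assume "\<not> ?thesis"
      then have gt: "plane_trace > a + b" by simp
      \<comment> \<open>Growth makes \<open>plane_cheb (Suc n)\<close> positive, which excludes the
        even relation; in the odd one it makes the left side too large.\<close>
      note g = plane_cheb_growth[OF gt, of n]
      have "a * b * plane_cheb n \<le> (a + b) * plane_cheb (Suc n)"
      proof -
        have "0 \<le> (a - b)\<^sup>2" by simp
        then have "a * b \<le> (a + b) / 2 * ((a + b) / 2)" by (simp add: power2_eq_square field_simps)
        then have "a * b * plane_cheb n \<le> (a + b) / 2 * ((a + b) / 2) * plane_cheb n" using g by (intro mult_right_mono) auto
        also have "\<dots> = (a + b) / 2 * ((a + b) / 2 * plane_cheb n)" by simp
        also have "\<dots> \<le> (a + b) / 2 * plane_cheb (Suc n)" using g ab by (intro mult_left_mono) auto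
        also have "\<dots> \<le> (a + b) * plane_cheb (Suc n)" using g ab by (intro mult_right_mono) auto
        finally show ?thesis .
      qed
      also have "\<dots> < plane_cheb (Suc n) * plane_trace" using g gt by simp
      also have "\<dots> \<le> plane_cheb (Suc n) * (plane_trace + b)" using g ab by simp
      finally show False using rel g by auto
    qed
    then have "\<theta>\<^sup>2 \<le> 4 / q" using plane_trace by (intro theta_bound) auto
    also have "\<dots> \<le> (real k - 2) / q" using 5 q1 by (intro divide_right_mono) auto
    finally show ?thesis .
  qed
qed

end

end

section \<open>Maximising the inner product of two subspaces\<close>

definition inner_on :: "'c set \<Rightarrow> ('c \<Rightarrow> real) \<Rightarrow> ('c \<Rightarrow> real) \<Rightarrow> real" where
  "inner_on C f g = (\<Sum>c\<in>C. f c * g c)"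

lemma continuous_on_inner_on:
  "continuous_on UNIV (\<lambda>p. inner_on C (fst p) (snd p))"
proof -
  have "continuous_on UNIV (\<lambda>p::('c \<Rightarrow> real) \<times> ('c \<Rightarrow> real). fst p c)" for c
    using continuous_on_compose2[OF continuous_on_product_coordinates[of c] continuous_on_fst[OF continuous_on_id]] by simp
  moreover have "continuous_on UNIV (\<lambda>p::('c \<Rightarrow> real) \<times> ('c \<Rightarrow> real). snd p c)" for c
    using continuous_on_compose2[OF continuous_on_product_coordinates[of c] continuous_on_snd[OF continuous_on_id]] by simp
  ultimately show ?thesis unfolding inner_on_def by (intro continuous_intros)
qed

text \<open>Functions on \<open>C\<close> are total functions on the type; forcing 0 outside
  \<open>C\<close> places the sphere in a product of compact intervals, so Tychonoff's theorem
  applies.\<close>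

lemma compact_unit_sphere_on:
  fixes C :: "'c set"
  assumes C: "finite C" and U: "closed U"
  shows "compact {f \<in> U. (\<forall>c. c \<notin> C \<longrightarrow> f c = 0) \<and> inner_on C f f = 1}"
proof -
  define B where "B = (\<lambda>c. if c \<in> C then {-1..1} else {0::real})"
  have "compactin (product_topology (\<lambda>c. euclidean) UNIV) (PiE UNIV B)"
    unfolding compactin_PiE B_def by auto
  then have "compact (PiE UNIV B)" by (simp add: euclidean_product_topology)
  moreover have "closed {f. inner_on C f f = 1}"
    unfolding inner_on_def by (intro closed_Collect_eq continuous_intros continuous_on_product_coordinates)
  then have "closed (U \<inter> {f. inner_on C f f = 1})" using U by (rule closed_Int[rotated])
  ultimately have "compact (PiE UNIV B \<inter> (U \<inter> {f. inner_on C f f = 1}))" by (rule compact_Int_closed)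
  moreover have "\<bar>f c\<bar> \<le> 1" if "inner_on C f f = 1" "c \<in> C" for f c
  proof -
    have "f c * f c \<le> 1" using member_le_sum[of c C "\<lambda>c. f c * f c"] that C by (simp add: inner_on_def)
    then have "(f c)\<^sup>2 \<le> 1" by (simp add: power2_eq_square)
    then show ?thesis by (simp add: abs_square_le_1)
  qed
  then have "{f \<in> U. (\<forall>c. c \<notin> C \<longrightarrow> f c = 0) \<and> inner_on C f f = 1} = PiE UNIV B \<inter> (U \<inter> {f. inner_on C f f = 1})"
    unfolding B_def by (auto simp: PiE_def Pi_def abs_le_iff split: if_splits)
  ultimately show ?thesis by simp
qed

lemma ex_max_inner_on:
  fixes C :: "'c set"
  assumes C: "finite C" and U: "closed U" and V: "closed V"
    and res: "\<And>f. f \<in> U \<Longrightarrow> (\<lambda>c. if c \<in> C then f c else 0) \<in> U" "\<And>f. f \<in> V \<Longrightarrow> (\<lambda>c. if c \<in> C then f c else 0) \<in> V"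
    and ne: "x0 \<in> U" "inner_on C x0 x0 = 1" "y0 \<in> V" "inner_on C y0 y0 = 1"
  shows "\<exists>x\<in>U. \<exists>y\<in>V. inner_on C x x = 1 \<and> inner_on C y y = 1 \<and>
    (\<forall>x'\<in>U. \<forall>y'\<in>V. inner_on C x' x' = 1 \<longrightarrow> inner_on C y' y' = 1 \<longrightarrow> inner_on C x' y' \<le> inner_on C x y)"
proof -
  define R where "R = (\<lambda>(f :: 'c \<Rightarrow> real) c. if c \<in> C then f c else 0)"
  define K where "K = (\<lambda>U. {f \<in> U. (\<forall>c. c \<notin> C \<longrightarrow> f c = 0) \<and> inner_on C f f = 1})"
  have inR: "inner_on C (R f) (R g) = inner_on C f g" for f g
    unfolding inner_on_def R_def by (intro sum.cong) auto
  have RU: "R f \<in> K U" if "f \<in> U" "inner_on C f f = 1" for f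
    using res(1)[OF that(1)] inR[of f f] that(2) unfolding K_def R_def by simp
  have RV: "R f \<in> K V" if "f \<in> V" "inner_on C f f = 1" for f
    using res(2)[OF that(1)] inR[of f f] that(2) unfolding K_def R_def by simp
  have "compact (K U \<times> K V)" unfolding K_def using C U V by (intro compact_Times compact_unit_sphere_on)
  moreover have "K U \<times> K V \<noteq> {}" using RU RV ne by blast
  ultimately obtain p where p: "p \<in> K U \<times> K V"
    "\<And>p'. p' \<in> K U \<times> K V \<Longrightarrow> inner_on C (fst p') (snd p') \<le> inner_on C (fst p) (snd p)"
    using continuous_attains_sup[of "K U \<times> K V" "\<lambda>p. inner_on C (fst p) (snd p)"]
      continuous_on_subset[OF continuous_on_inner_on] by (metis subset_UNIV)
  show ?thesis
  proof (rule bexI[of _ "fst p"], rule bexI[of _ "snd p"], intro conjI ballI impI)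
    fix x' y' assume "x' \<in> U" "y' \<in> V" "inner_on C x' x' = 1" "inner_on C y' y' = 1"
    then have "(R x', R y') \<in> K U \<times> K V" using RU RV by blast
    then show "inner_on C x' y' \<le> inner_on C (fst p) (snd p)" using p(2)[of "(R x', R y')"] inR by simp
  qed (use p(1) in \<open>auto simp: K_def\<close>)
qed

section \<open>Inner products and bounds on the cosine of an angle\<close>

lemma inner_on_commute: "inner_on C f g = inner_on C g f"
  unfolding inner_on_def by (simp add: mult.commute)

lemma inner_on_add_left: "inner_on C (\<lambda>c. f c + g c) h = inner_on C f h + inner_on C g h"
  unfolding inner_on_def by (simp add: sum.distrib algebra_simps)

lemma inner_on_diff_left: "inner_on C (\<lambda>c. f c - g c) h = inner_on C f h - inner_on C g h"
  unfolding inner_on_def by (simp add: sum_subtractf algebra_simps)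

lemma inner_on_diff_right: "inner_on C h (\<lambda>c. f c - g c) = inner_on C h f - inner_on C h g"
  unfolding inner_on_def by (simp add: sum_subtractf algebra_simps)

lemma inner_on_scale_left: "inner_on C (\<lambda>c. r * f c) h = r * inner_on C f h"
  unfolding inner_on_def by (simp add: sum_distrib_left algebra_simps)

lemma inner_on_scale_right: "inner_on C h (\<lambda>c. r * f c) = r * inner_on C h f"
  unfolding inner_on_def by (simp add: sum_distrib_left algebra_simps)

lemma inner_on_cong: "(\<And>c. c \<in> C \<Longrightarrow> f c = f' c) \<Longrightarrow> (\<And>c. c \<in> C \<Longrightarrow> g c = g' c) \<Longrightarrow> inner_on C f g = inner_on C f' g'"
  unfolding inner_on_def by (intro sum.cong) auto

lemma inner_on_nonneg: "inner_on C f f \<ge> 0"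
  unfolding inner_on_def by (intro sum_nonneg) simp

lemma inner_on_eq_0:
  assumes "finite C" "inner_on C f f \<le> 0" "c \<in> C"
  shows "f c = 0"
proof -
  have "(\<Sum>c\<in>C. f c * f c) = 0" using assms(2) inner_on_nonneg[of C f] unfolding inner_on_def by simp
  then have "f c * f c = 0" using assms sum_nonneg_eq_0_iff[of C "\<lambda>c. f c * f c"] by simp
  then show ?thesis by simp
qed

definition norm_on :: "'c set \<Rightarrow> ('c \<Rightarrow> real) \<Rightarrow> real" where
  "norm_on C f = sqrt (inner_on C f f)"

lemma norm_on_nonneg: "norm_on C f \<ge> 0"
  unfolding norm_on_def using inner_on_nonneg by simp

lemma norm_on_square: "(norm_on C f)\<^sup>2 = inner_on C f f"
  unfolding norm_on_def using inner_on_nonneg by simp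

definition closed_cone_on :: "'c set \<Rightarrow> ('c \<Rightarrow> real) set \<Rightarrow> bool" where
  "closed_cone_on C U \<longleftrightarrow> closed U \<and> (\<forall>f\<in>U. (\<lambda>c. if c \<in> C then f c else 0) \<in> U) \<and> (\<forall>f\<in>U. \<forall>r. (\<lambda>c. r * f c) \<in> U)"

text \<open>The product form also makes sense for zero vectors. No absolute value appears, since the
  spaces to which it is applied are closed under negation.\<close>

definition cos_bound :: "'c set \<Rightarrow> ('c \<Rightarrow> real) set \<Rightarrow> ('c \<Rightarrow> real) set \<Rightarrow> real \<Rightarrow> bool" where
  "cos_bound C U V l \<longleftrightarrow> (\<forall>f\<in>U. \<forall>g\<in>V. inner_on C f g \<le> l * (norm_on C f * norm_on C g))"

lemma cos_bound_mono: "cos_bound C U V l \<Longrightarrow> l \<le> l' \<Longrightarrow> cos_bound C U V l'"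
  unfolding cos_bound_def by (meson mult_nonneg_nonneg mult_right_mono norm_on_nonneg order_trans)

lemma cos_bound_commute: "cos_bound C U V l \<Longrightarrow> cos_bound C V U l"
  unfolding cos_bound_def by (metis inner_on_commute mult.commute)

lemma cos_boundI:
  assumes C: "finite C" and U: "closed_cone_on C U" and V: "closed_cone_on C V"
    and unit: "\<And>x y. x \<in> U \<Longrightarrow> y \<in> V \<Longrightarrow> inner_on C x x = 1 \<Longrightarrow> inner_on C y y = 1 \<Longrightarrow> inner_on C x y \<le> l"
  shows "cos_bound C U V l"
  unfolding cos_bound_def
proof (intro ballI)
  fix f g assume fg: "f \<in> U" "g \<in> V"
  show "inner_on C f g \<le> l * (norm_on C f * norm_on C g)"
  proof (cases "inner_on C f f = 0 \<or> inner_on C g g = 0")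
    case True
    have "inner_on C f g = 0"
    proof (cases "inner_on C f f = 0")
      case True
      then have "inner_on C f g = inner_on C (\<lambda>_. 0) g"
        using inner_on_eq_0[OF C, of f] by (intro inner_on_cong) auto
      then show ?thesis by (simp add: inner_on_def)
    next
      case False
      then have "inner_on C f g = inner_on C f (\<lambda>_. 0)"
        using True inner_on_eq_0[OF C, of g] by (intro inner_on_cong) auto
      then show ?thesis by (simp add: inner_on_def)
    qed
    then show ?thesis using True by (auto simp: norm_on_def)
  next
    case False
    define F where "F = norm_on C f"
    define G where "G = norm_on C g"
    have pos: "F > 0" "G > 0"
      using False inner_on_nonneg[of C f] inner_on_nonneg[of C g] by (auto simp: F_def G_def norm_on_def)
    have sq: "inner_on C f f = F * F" "inner_on C g g = G * G"
      using norm_on_square[of C f] norm_on_square[of C g] by (simp_all add: F_def G_def power2_eq_square)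
    let ?x = "\<lambda>c. inverse F * f c" and ?y = "\<lambda>c. inverse G * g c"
    have "inner_on C ?x ?y \<le> l"
    proof (rule unit)
      show "?x \<in> U" "?y \<in> V" using U V fg unfolding closed_cone_on_def by blast+
      show "inner_on C ?x ?x = 1" "inner_on C ?y ?y = 1"
        using pos by (simp_all only: inner_on_scale_left inner_on_scale_right sq) (simp_all add: field_simps)
    qed
    then have "inverse F * (inverse G * inner_on C f g) \<le> l" by (simp add: inner_on_scale_left inner_on_scale_right)
    then show ?thesis using pos by (simp add: F_def[symmetric] G_def[symmetric] field_simps)
  qed
qed

text \<open>The bound 0 covers spaces without a pair of positive inner product, for instance a zero
  space; otherwise compactness gives a maximising pair.\<close>

lemma cos_bound_attained:
  assumes C: "finite C" and U: "closed_cone_on C U" and V: "closed_cone_on C V"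
  shows "cos_bound C U V 0 \<or> (\<exists>x\<in>U. \<exists>y\<in>V. inner_on C x x = 1 \<and> inner_on C y y = 1 \<and>
    inner_on C x y > 0 \<and> cos_bound C U V (inner_on C x y))"
proof (cases "\<exists>x\<in>U. \<exists>y\<in>V. inner_on C x x = 1 \<and> inner_on C y y = 1 \<and> inner_on C x y > 0")
  case True
  then obtain x0 y0 where 0: "x0 \<in> U" "y0 \<in> V" "inner_on C x0 x0 = 1" "inner_on C y0 y0 = 1" "inner_on C x0 y0 > 0"
    by blast
  obtain x y where xy: "x \<in> U" "y \<in> V" "inner_on C x x = 1" "inner_on C y y = 1"
    "\<And>x' y'. x' \<in> U \<Longrightarrow> y' \<in> V \<Longrightarrow> inner_on C x' x' = 1 \<Longrightarrow> inner_on C y' y' = 1 \<Longrightarrow> inner_on C x' y' \<le> inner_on C x y"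
    using ex_max_inner_on[OF C, of U V x0 y0] U V 0 unfolding closed_cone_on_def by blast
  have "inner_on C x y > 0" using xy(5)[OF 0(1-4)] 0(5) by linarith
  moreover have "cos_bound C U V (inner_on C x y)" using C U V xy(5) by (rule cos_boundI)
  ultimately show ?thesis using xy(1-4) by blast
next
  case False
  then have "cos_bound C U V 0" by (intro cos_boundI C U V) (meson not_le)
  then show ?thesis by blast
qed

section \<open>Angles between spaces of invariant functions\<close>

lemma map_alt: "map f (alt n x y) = alt n (f x) (f y)"
  by (induction n x y rule: alt.induct) auto

context chamber_system
begin

definition invariant :: "'t set \<Rightarrow> ('c \<Rightarrow> real) set" where
  "invariant J = {f. \<forall>u\<in>J. \<forall>c\<in>C. \<forall>d\<in>N u c. f d = f c}"

definition perp :: "'t set \<Rightarrow> ('c \<Rightarrow> real) set" where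
  "perp J = {f. \<forall>g\<in>invariant J. inner_on C f g = 0}"

lemma N_in_C: "c \<in> C \<Longrightarrow> d \<in> N u c \<Longrightarrow> d \<in> C" using N_subset by blast

lemma finite_N: "c \<in> C \<Longrightarrow> finite (N u c)" using N_subset finite_C finite_subset by (metis finite_Diff)

lemma invariantD: "f \<in> invariant J \<Longrightarrow> u \<in> J \<Longrightarrow> c \<in> C \<Longrightarrow> d \<in> N u c \<Longrightarrow> f d = f c"
  unfolding invariant_def by blast

lemma invariant_mono: "J \<subseteq> J' \<Longrightarrow> invariant J' \<subseteq> invariant J"
  unfolding invariant_def by blast

lemma invariant_diff: "f \<in> invariant J \<Longrightarrow> g \<in> invariant J \<Longrightarrow> (\<lambda>c. f c - g c) \<in> invariant J"
  unfolding invariant_def by auto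

lemma perpD: "f \<in> perp J \<Longrightarrow> g \<in> invariant J \<Longrightarrow> inner_on C f g = 0"
  unfolding perp_def by blast

lemma closed_cone_invariant_perp: "closed_cone_on C (invariant J \<inter> perp J')"
  unfolding closed_cone_on_def
proof (intro conjI ballI allI)
  have "closed (invariant J)"
  proof -
    have eq: "invariant J = (\<Inter>u\<in>J. \<Inter>c\<in>C. \<Inter>d\<in>N u c. {f. f d = f c})" unfolding invariant_def by blast
    show ?thesis unfolding eq
      by (intro closed_INT ballI closed_Collect_eq continuous_on_product_coordinates)
  qed
  moreover have "closed (perp J')"
  proof -
    have eq: "perp J' = (\<Inter>g\<in>invariant J'. {f. inner_on C f g = 0})" unfolding perp_def by blast
    show ?thesis unfolding eq inner_on_def
      by (intro closed_INT ballI closed_Collect_eq continuous_intros continuous_on_product_coordinates)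
  qed
  ultimately show "closed (invariant J \<inter> perp J')" by (rule closed_Int)
  fix f assume f: "f \<in> invariant J \<inter> perp J'"
  have "(\<lambda>c. if c \<in> C then f c else 0) \<in> invariant J"
    using f N_in_C unfolding invariant_def by auto
  moreover have "inner_on C (\<lambda>c. if c \<in> C then f c else 0) g = inner_on C f g" for g by (rule inner_on_cong) auto
  then have "(\<lambda>c. if c \<in> C then f c else 0) \<in> perp J'" using f unfolding perp_def by simp
  ultimately show "(\<lambda>c. if c \<in> C then f c else 0) \<in> invariant J \<inter> perp J'" by blast
  fix r
  have "(\<lambda>c. r * f c) \<in> invariant J" using f unfolding invariant_def by simp
  moreover have "(\<lambda>c. r * f c) \<in> perp J'" using f unfolding perp_def by (simp add: inner_on_scale_left)
  ultimately show "(\<lambda>c. r * f c) \<in> invariant J \<inter> perp J'" by blast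
qed

text \<open>Inner product 1 of unit vectors forces \<open>x = y\<close> on \<open>C\<close>, a
  function invariant under \<open>J - {s}\<close> and \<open>J - {t}\<close>, hence under
  \<open>J\<close>, and so orthogonal to itself.\<close>

lemma unit_inner_less_1:
  assumes "s \<in> J" "t \<in> J" "s \<noteq> t"
    and x: "x \<in> invariant (J - {s}) \<inter> perp J" "inner_on C x x = 1"
    and y: "y \<in> invariant (J - {t}) \<inter> perp J" "inner_on C y y = 1"
  shows "inner_on C x y < 1"
proof (rule ccontr)
  assume "\<not> inner_on C x y < 1"
  then have "inner_on C (\<lambda>c. x c - y c) (\<lambda>c. x c - y c) \<le> 0"
    using x(2) y(2) by (simp add: inner_on_diff_left inner_on_diff_right inner_on_commute[of C y x])
  then have eq: "x c = y c" if "c \<in> C" for c using inner_on_eq_0[OF finite_C _ that] by fastforce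
  have "x \<in> invariant J"
    unfolding invariant_def
  proof (intro CollectI ballI)
    fix u c d assume u: "u \<in> J" "c \<in> C" "d \<in> N u c"
    show "x d = x c"
    proof (cases "u = s")
      case True
      then have "y d = y c" using u assms(3) y(1) by (intro invariantD[of y "J - {t}" u]) auto
      then show ?thesis using eq u N_in_C by simp
    next
      case False
      then show ?thesis using u x(1) by (intro invariantD[of x "J - {s}" u]) auto
    qed
  qed
  then have "inner_on C x x = 0" using x(1) perpD by blast
  then show False using x(2) by simp
qed

text \<open>Adjacency is symmetric, so the adjacency operators are self-adjoint.\<close>

lemma sum_N_swap: "(\<Sum>c\<in>C. \<Sum>d\<in>N u c. F c d) = (\<Sum>d\<in>C. \<Sum>c\<in>N u d. (F c d :: real))"
proof -
  have 1: "N u c = {d \<in> C. d \<in> N u c}" if "c \<in> C" for c using N_subset[OF that] by blast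
  have 2: "N u d = {c \<in> C. d \<in> N u c}" if "d \<in> C" for d using N_sym N_in_C that by blast
  have "(\<Sum>c\<in>C. \<Sum>d\<in>N u c. F c d) = (\<Sum>c\<in>C. \<Sum>d | d \<in> C \<and> d \<in> N u c. F c d)"
    using 1 by (intro sum.cong) auto
  also have "\<dots> = (\<Sum>d\<in>C. \<Sum>c | c \<in> C \<and> d \<in> N u c. F c d)"
    by (rule sum.swap_restrict[OF finite_C finite_C])
  also have "\<dots> = (\<Sum>d\<in>C. \<Sum>c\<in>N u d. F c d)" using 2 by (intro sum.cong) auto
  finally show ?thesis .
qed

text \<open>The mean over the \<open>a u + 1\<close> chambers of a panel, which is the orthogonal
  projection onto \<open>invariant {u}\<close>.\<close>

definition average :: "'t \<Rightarrow> ('c \<Rightarrow> real) \<Rightarrow> 'c \<Rightarrow> real" where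
  "average u f c = (adj_sum N u f c + f c) / (real (a u) + 1)"

lemma average_invariant: "average u f \<in> invariant {u}"
  unfolding invariant_def
proof (intro CollectI ballI)
  fix v c d assume "v \<in> {u}" and c: "c \<in> C" and "d \<in> N v c"
  then have d: "d \<in> N u c" by simp
  have dC: "d \<in> C" using N_in_C[OF c d] .
  have "insert d (N u d) = insert c (N u c)"
    using N_sym[OF c d] N_trans[OF c d] N_trans[OF dC N_sym[OF c d]] d by blast
  moreover have "sum f (insert c (N u c)) = adj_sum N u f c + f c" if "c \<in> C" for c
    using that finite_N[OF that] N_subset[OF that, of u] by (subst sum.insert) (auto simp: adj_sum_def)
  ultimately have "adj_sum N u f d + f d = adj_sum N u f c + f c" using c dC by metis
  then show "average u f d = average u f c" by (simp add: average_def)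
qed

lemma inner_average:
  assumes g: "g \<in> invariant J" "u \<in> J"
  shows "inner_on C (average u f) g = inner_on C f g"
proof -
  have "inner_on C (adj_sum N u f) g = (\<Sum>c\<in>C. \<Sum>d\<in>N u c. f d * g c)"
    unfolding inner_on_def adj_sum_def by (simp add: sum_distrib_right)
  also have "\<dots> = (\<Sum>c\<in>C. \<Sum>d\<in>N u c. f d * g d)"
    using invariantD[OF g(1,2)] by (intro sum.cong refl) simp
  also have "\<dots> = (\<Sum>d\<in>C. \<Sum>c\<in>N u d. f d * g d)" by (rule sum_N_swap)
  also have "\<dots> = real (a u) * inner_on C f g"
    using card_N by (simp add: inner_on_def sum_distrib_left)
  finally have "inner_on C (\<lambda>c. adj_sum N u f c + f c) g = (real (a u) + 1) * inner_on C f g"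
    by (simp add: inner_on_add_left algebra_simps)
  moreover have "average u f = (\<lambda>c. inverse (real (a u) + 1) * (adj_sum N u f c + f c))"
    by (simp add: average_def fun_eq_iff divide_inverse mult.commute)
  ultimately show ?thesis by (simp add: inner_on_scale_left)
qed

lemma gallery_sum_plane:
  assumes x: "\<And>c. c \<in> C \<Longrightarrow> adj_sum N s x c = \<alpha> * x c" "\<And>c. c \<in> C \<Longrightarrow> adj_sum N t x c = (\<beta> + 1) * \<theta> * y c - x c"
    and y: "\<And>c. c \<in> C \<Longrightarrow> adj_sum N s y c = (\<alpha> + 1) * \<theta> * x c - y c" "\<And>c. c \<in> C \<Longrightarrow> adj_sum N t y c = \<beta> * y c"
    and "c \<in> C"
  shows "gallery_sum N (map (\<lambda>c. if c then s else t) w) (\<lambda>c. fst p * x c + snd p * y c) c =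
    fst (foldr (plane_gen \<alpha> \<beta> \<theta>) w p) * x c + snd (foldr (plane_gen \<alpha> \<beta> \<theta>) w p) * y c"
  using \<open>c \<in> C\<close>
proof (induction w arbitrary: c)
  case (Cons b w)
  let ?p = "foldr (plane_gen \<alpha> \<beta> \<theta>) w p"
  let ?u = "if b then s else t"
  have "gallery_sum N (map (\<lambda>c. if c then s else t) (b # w)) (\<lambda>c. fst p * x c + snd p * y c) c =
      (\<Sum>d\<in>N ?u c. gallery_sum N (map (\<lambda>c. if c then s else t) w) (\<lambda>c. fst p * x c + snd p * y c) d)"
    by (simp only: list.map foldr.simps comp_apply adj_sum_def[of N ?u])
  also have "\<dots> = (\<Sum>d\<in>N ?u c. fst ?p * x d + snd ?p * y d)"
    using N_in_C[OF Cons.prems] by (intro sum.cong refl Cons.IH)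
  also have "\<dots> = fst ?p * adj_sum N ?u x c + snd ?p * adj_sum N ?u y c"
    by (simp add: adj_sum_def sum.distrib sum_distrib_left)
  also have "\<dots> = fst (plane_gen \<alpha> \<beta> \<theta> b ?p) * x c + snd (plane_gen \<alpha> \<beta> \<theta> b ?p) * y c"
    by (cases b) (simp_all add: x[OF Cons.prems] y[OF Cons.prems] plane_s_def plane_t_def, simp_all add: algebra_simps)
  finally show ?case by simp
qed simp

text \<open>A pair of unit vectors with maximal inner product spans a plane that is stable under both averages.\<close>
lemma average_of_maximal:
  assumes max: "cos_bound C (invariant {s} \<inter> perp J) V (inner_on C x y)"
    and x: "x \<in> invariant {s} \<inter> perp J" "inner_on C x x = 1"
    and y: "y \<in> V" "y \<in> perp J" "inner_on C y y = 1" and pos: "inner_on C x y > 0" and J: "s \<in> J" and c: "c \<in> C"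
  shows "average s y c = inner_on C x y * x c"
proof -
  let ?z = "average s y" and ?t = "inner_on C x y"
  have zg: "inner_on C ?z g = inner_on C y g" if "g \<in> invariant {s}" for g
    using inner_average[OF that] by simp
  have "?z \<in> perp J"
    using y(2) invariant_mono[of "{s}" J] J zg unfolding perp_def by auto
  then have z: "?z \<in> invariant {s} \<inter> perp J" using average_invariant by blast
  have zz: "inner_on C ?z ?z = inner_on C y ?z" using zg average_invariant by blast
  have zx: "inner_on C ?z x = ?t" using zg x(1) inner_on_commute[of C y x] by simp
  \<comment> \<open>The projection \<open>?z\<close> of \<open>y\<close> competes with
    \<open>x\<close> in the maximum: its inner product with \<open>y\<close> is the square of its
    norm, so that norm is at most \<open>?t\<close>. As its inner product with the unit vector
    \<open>x\<close> is \<open>?t\<close>, it must be \<open>?t\<close> times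
    \<open>x\<close>.\<close>
  have "inner_on C ?z y \<le> ?t * (norm_on C ?z * norm_on C y)"
    using max z y(1) unfolding cos_bound_def by blast
  then have "(norm_on C ?z)\<^sup>2 \<le> ?t * norm_on C ?z"
    using zz y(3) inner_on_commute[of C y ?z] norm_on_square[of C ?z] by (simp add: norm_on_def)
  then have "norm_on C ?z * norm_on C ?z \<le> ?t * norm_on C ?z" by (simp add: power2_eq_square)
  then have "norm_on C ?z \<le> ?t" using norm_on_nonneg[of C ?z] pos
    by (cases "norm_on C ?z = 0") auto
  then have "(norm_on C ?z)\<^sup>2 \<le> ?t * ?t" using norm_on_nonneg[of C ?z] by (simp add: power2_eq_square mult_mono)
  then have "inner_on C ?z ?z \<le> ?t * ?t" by (simp add: norm_on_square)
  then have "inner_on C (\<lambda>c. ?z c - ?t * x c) (\<lambda>c. ?z c - ?t * x c) \<le> 0"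
    using zx x(2) inner_on_commute[of C x ?z]
    by (simp add: inner_on_diff_left inner_on_diff_right inner_on_scale_left inner_on_scale_right)
  then show ?thesis using inner_on_eq_0[OF finite_C _ c] by fastforce
qed

lemma adj_sum_average: "adj_sum N u f c = (real (a u) + 1) * average u f c - f c"
  by (simp add: average_def field_simps)

lemma adj_sum_invariant: "f \<in> invariant J \<Longrightarrow> u \<in> J \<Longrightarrow> c \<in> C \<Longrightarrow> adj_sum N u f c = real (a u) * f c"
  using card_N by (simp add: adj_sum_def invariantD)

text \<open>At a maximising pair the two adjacency operators act as \<open>plane_s\<close> and
  \<open>plane_t\<close>, so \<open>dihedral_angle_bound\<close> applies with the length
  \<open>k\<close> of the braid relation, and \<open>k \<le> m\<close>.\<close>

lemma cos_bound_pair: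
  assumes st: "s \<noteq> t"
  shows "cos_bound C (invariant {s} \<inter> perp {s, t}) (invariant {t} \<inter> perp {s, t}) (sqrt ((real m - 2) / real q))"
    (is "cos_bound C ?U ?V ?l")
proof -
  obtain k where k: "2 \<le> k" "k \<le> m"
    and br: "\<And>f c. c \<in> C \<Longrightarrow> gallery_sum N (alt k s t) f c = gallery_sum N (alt k t s) f c"
    using braid[OF st] by blast
  have l: "?l \<ge> 0" using k by simp
  consider "cos_bound C ?U ?V 0" | x y where "x \<in> ?U" "y \<in> ?V" "inner_on C x x = 1" "inner_on C y y = 1"
      "inner_on C x y > 0" "cos_bound C ?U ?V (inner_on C x y)"
    using cos_bound_attained[OF finite_C closed_cone_invariant_perp closed_cone_invariant_perp] by blast
  then show ?thesis
  proof cases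
    case 1
    then show ?thesis using cos_bound_mono l by blast
  next
    case (2 x y)
    define \<theta> where "\<theta> = inner_on C x y"
    have \<theta>: "\<theta> > 0" using 2 by (simp add: \<theta>_def)
    have lt1: "\<theta> < 1"
      unfolding \<theta>_def using 2 st by (intro unit_inner_less_1[of t "{s, t}" s]) (auto simp: insert_Diff_if)
    have sy: "average s y c = \<theta> * x c" if "c \<in> C" for c
      unfolding \<theta>_def using 2 that by (intro average_of_maximal[where V = ?V]) auto
    have tx: "average t x c = \<theta> * y c" if "c \<in> C" for c
    proof -
      have "cos_bound C ?V ?U (inner_on C y x)" using 2(6) cos_bound_commute inner_on_commute by metis
      then show ?thesis unfolding \<theta>_def inner_on_commute[of C x y] using 2 that
        by (intro average_of_maximal[where V = ?U]) (auto simp: inner_on_commute[of C y x])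
    qed
    let ?c = "\<lambda>p c. fst p * x c + snd p * y c"
    let ?g = "plane_gen (real (a s)) (real (a t)) \<theta>"
    have plane: "gallery_sum N (map (\<lambda>c. if c then s else t) w) (?c p) c = ?c (foldr ?g w p) c" if "c \<in> C" for w p c
    proof (rule gallery_sum_plane)
      fix c assume c: "c \<in> C"
      show "adj_sum N s x c = real (a s) * x c" using adj_sum_invariant[OF _ _ c] 2(1) by blast
      show "adj_sum N t y c = real (a t) * y c" using adj_sum_invariant[OF _ _ c] 2(2) by blast
      show "adj_sum N t x c = (real (a t) + 1) * \<theta> * y c - x c" using adj_sum_average[of t x c] tx[OF c] by simp
      show "adj_sum N s y c = (real (a s) + 1) * \<theta> * x c - y c" using adj_sum_average[of s y c] sy[OF c] by simp
    qed (rule that)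
    \<comment> \<open>As \<open>\<theta> < 1\<close>, the two vectors are linearly independent, and
      the braid identity of functions passes to coordinates.\<close>
    have indep: "p = p'" if "\<And>c. c \<in> C \<Longrightarrow> ?c p c = ?c p' c" for p p' :: "real \<times> real"
    proof -
      define u where "u = fst p - fst p'"
      define v where "v = snd p - snd p'"
      have z: "u * x c + v * y c = 0" if "c \<in> C" for c
        using \<open>\<And>c. c \<in> C \<Longrightarrow> ?c p c = ?c p' c\<close>[OF that] by (simp add: u_def v_def algebra_simps)
      have "inner_on C (\<lambda>c. u * x c + v * y c) h = 0" for h using z by (simp add: inner_on_def)
      then have "u * inner_on C x h + v * inner_on C y h = 0" for h
        by (simp add: inner_on_add_left inner_on_scale_left)
      from this[of x] this[of y] have uv: "u + v * \<theta> = 0" "u * \<theta> + v = 0"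
        using 2 inner_on_commute[of C y x] by (simp_all add: \<theta>_def)
      then have v: "v = - (u * \<theta>)" by linarith
      have "u * (1 - \<theta> * \<theta>) = 0" using uv(1) unfolding v by (simp add: algebra_simps)
      moreover have "\<theta> * \<theta> < 1 * 1" using lt1 \<theta> by (intro mult_strict_mono) auto
      ultimately have "u = 0" by simp
      then show ?thesis using v by (simp add: u_def v_def prod_eq_iff)
    qed
    have pbr: "foldr ?g (alt k True False) p = foldr ?g (alt k False True) p" for p
    proof (rule indep)
      fix c assume c: "c \<in> C"
      show "?c (foldr ?g (alt k True False) p) c = ?c (foldr ?g (alt k False True) p) c"
        using br[OF c, of "?c p"] plane[OF c, of "alt k True False" p] plane[OF c, of "alt k False True" p]
        by (simp add: map_alt)
    qed
    have "\<theta>\<^sup>2 \<le> (real k - 2) / real q"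
    proof (rule dihedral_angle_bound[OF _ _ _ _ _ \<theta> k(1) pbr])
      show "real q \<le> real (a s) + 1" "real q \<le> real (a t) + 1" using q_le[of s] q_le[of t] by linarith+
    qed (use q_ge_1 in auto)
    also have "\<dots> \<le> (real m - 2) / real q" using k by (intro divide_right_mono) auto
    finally have "\<theta> \<le> ?l" using \<theta> by (intro real_le_rsqrt)
    then show ?thesis using 2(6) cos_bound_mono unfolding \<theta>_def by blast
  qed
qed

section \<open>Projections onto invariant functions and trickling down\<close>

lemma ex_projection: "\<exists>p\<in>invariant J. \<forall>g\<in>invariant J. inner_on C p g = inner_on C f g"
proof -
  \<comment> \<open>The classes of chambers that invariant functions cannot separate; averaging over
    them is the projection.\<close>
  define R where "R = (\<lambda>c d. \<forall>h\<in>invariant J. h c = h d)"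
  define K where "K = (\<lambda>c. {d \<in> C. R c d})"
  have R: "R c c" "R c d \<longleftrightarrow> R d c" "R c d \<Longrightarrow> R d e \<Longrightarrow> R c e" for c d e
    unfolding R_def by auto
  define p where "p = (\<lambda>c. (\<Sum>d\<in>K c. f d) / card (K c))"
  have KK: "K c = K d" if "R c d" for c d unfolding K_def using R that by blast
  have cardK: "card (K c) > 0" if "c \<in> C" for c
    unfolding K_def using that finite_C R(1) by (intro card_gt_0_iff[THEN iffD2]) auto
  have "p \<in> invariant J" unfolding invariant_def
  proof (intro CollectI ballI)
    fix u c d assume *: "u \<in> J" "c \<in> C" "d \<in> N u c"
    then have "R d c" unfolding R_def using invariantD by blast
    then show "p d = p c" unfolding p_def using KK by simp
  qed
  moreover have "inner_on C p g = inner_on C f g" if g: "g \<in> invariant J" for g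
  proof -
    have "inner_on C p g = (\<Sum>c\<in>C. \<Sum>d | d \<in> C \<and> R c d. f d * g d / card (K d))"
      unfolding inner_on_def
    proof (intro sum.cong refl)
      fix c assume c: "c \<in> C"
      have "p c * g c = (\<Sum>d\<in>K c. f d * g c / card (K c))"
        unfolding p_def by (simp add: sum_distrib_right sum_divide_distrib)
      also have "\<dots> = (\<Sum>d\<in>K c. f d * g d / card (K d))"
      proof (intro sum.cong refl)
        fix d assume "d \<in> K c"
        then have "R c d" by (simp add: K_def)
        then show "f d * g c / card (K c) = f d * g d / card (K d)" using KK[of c d] g unfolding R_def by metis
      qed
      finally show "p c * g c = (\<Sum>d | d \<in> C \<and> R c d. f d * g d / card (K d))" by (simp add: K_def)
    qed
    also have "\<dots> = (\<Sum>d\<in>C. \<Sum>c | c \<in> C \<and> R c d. f d * g d / card (K d))"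
      by (rule sum.swap_restrict[OF finite_C finite_C])
    also have "\<dots> = (\<Sum>d\<in>C. f d * g d)"
    proof (intro sum.cong refl)
      fix d assume d: "d \<in> C"
      have "{c. c \<in> C \<and> R c d} = K d" unfolding K_def using R(2) by blast
      then show "(\<Sum>c | c \<in> C \<and> R c d. f d * g d / card (K d)) = f d * g d" using cardK[OF d] by simp
    qed
    finally show ?thesis by (simp add: inner_on_def)
  qed
  ultimately show ?thesis by blast
qed

text \<open>Divided by \<open>F * G\<close> the left side is at most
  \<open>l + (1 - l) * ((x\<^sup>2 + y\<^sup>2) / 2)\<close>, by the inequality of the means and
  \<open>x\<^sup>2 + x'\<^sup>2 = 1\<close>; as \<open>l \<le> 1\<close>, this grows with
  \<open>x\<close> and \<open>y\<close>, which are at most \<open>L\<close>.\<close>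

lemma spherical_estimate:
  fixes F G P Q F' G' L l :: real
  assumes nn: "F \<ge> 0" "G \<ge> 0" "P \<ge> 0" "Q \<ge> 0" "F' \<ge> 0" "G' \<ge> 0" "0 \<le> l" "l \<le> 1" "L \<ge> 0"
    and PF: "P \<le> L * F" and QG: "Q \<le> L * G" and F: "F\<^sup>2 = P\<^sup>2 + F'\<^sup>2" and G: "G\<^sup>2 = Q\<^sup>2 + G'\<^sup>2"
  shows "P * Q + l * (F' * G') \<le> (L\<^sup>2 * (1 - l) + l) * (F * G)"
proof (cases "F = 0 \<or> G = 0")
  case True
  then have "P * Q = 0" "F' * G' = 0" using F G by (auto simp: sum_power2_eq_zero_iff)
  then show ?thesis using True by auto
next
  case False
  then have pos: "F > 0" "G > 0" using nn by auto
  define x where "x = P / F"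
  define y where "y = Q / G"
  define x' where "x' = F' / F"
  define y' where "y' = G' / G"
  have e: "P = x * F" "Q = y * G" "F' = x' * F" "G' = y' * G" using pos by (auto simp: x_def y_def x'_def y'_def)
  have 1: "x\<^sup>2 + x'\<^sup>2 = 1" "y\<^sup>2 + y'\<^sup>2 = 1"
    using F G pos by (auto simp: x_def y_def x'_def y'_def power_divide add_divide_distrib[symmetric])
  have xy: "0 \<le> x" "x \<le> L" "0 \<le> y" "y \<le> L"
    using PF QG pos nn by (auto simp: x_def y_def field_simps)
  have s: "x\<^sup>2 \<le> L\<^sup>2" "y\<^sup>2 \<le> L\<^sup>2" using xy by (auto intro: power_mono)
  have "0 \<le> (x - y)\<^sup>2" "0 \<le> (x' - y')\<^sup>2" by auto
  then have a1: "x * y \<le> (x\<^sup>2 + y\<^sup>2) / 2" and a2: "x' * y' \<le> (x'\<^sup>2 + y'\<^sup>2) / 2"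
    by (auto simp: power2_eq_square algebra_simps)
  have "x * y + l * (x' * y') \<le> (x\<^sup>2 + y\<^sup>2) / 2 + l * ((x'\<^sup>2 + y'\<^sup>2) / 2)"
    using a1 a2 nn by (intro add_mono mult_left_mono) auto
  also have "\<dots> = l + (1 - l) * ((x\<^sup>2 + y\<^sup>2) / 2)"
  proof -
    have "x'\<^sup>2 + y'\<^sup>2 = 2 - (x\<^sup>2 + y\<^sup>2)" using 1 by linarith
    then show ?thesis by (simp only:) (simp add: field_simps)
  qed
  also have "\<dots> \<le> l + (1 - l) * L\<^sup>2" using s nn by (intro add_left_mono mult_left_mono) auto
  finally have "(x * y + l * (x' * y')) * (F * G) \<le> (l + (1 - l) * L\<^sup>2) * (F * G)"
    using pos by (intro mult_right_mono) auto
  then show ?thesis unfolding e by (simp add: algebra_simps)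
qed

text \<open>Both functions are split by the projection onto \<open>invariant (J - {u})\<close>. The
  projected parts are short, as \<open>L\<close> also bounds the angles with the type
  \<open>u\<close>; the remainders are orthogonal to that space and fall under \<open>l\<close>, the
  bound for one type fewer.\<close>

lemma cos_bound_improve:
  assumes L: "\<And>s t. s \<in> J \<Longrightarrow> t \<in> J \<Longrightarrow> s \<noteq> t \<Longrightarrow>
      cos_bound C (invariant (J - {s}) \<inter> perp J) (invariant (J - {t}) \<inter> perp J) L"
    and l: "\<And>u s t. u \<in> J \<Longrightarrow> s \<in> J - {u} \<Longrightarrow> t \<in> J - {u} \<Longrightarrow> s \<noteq> t \<Longrightarrow>
      cos_bound C (invariant (J - {u} - {s}) \<inter> perp (J - {u})) (invariant (J - {u} - {t}) \<inter> perp (J - {u})) l"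
    and nn: "0 \<le> L" "0 \<le> l" "l \<le> 1"
    and stu: "s \<in> J" "t \<in> J" "u \<in> J" "s \<noteq> t" "u \<noteq> s" "u \<noteq> t"
  shows "cos_bound C (invariant (J - {s}) \<inter> perp J) (invariant (J - {t}) \<inter> perp J) (L\<^sup>2 * (1 - l) + l)"
  unfolding cos_bound_def
proof (intro ballI)
  fix f g assume f: "f \<in> invariant (J - {s}) \<inter> perp J" and g: "g \<in> invariant (J - {t}) \<inter> perp J"
  have proj: "\<exists>p f'. (\<forall>c. f c = p c + f' c) \<and> p \<in> invariant (J - {u}) \<and> f' \<in> invariant (J - {u} - {s}) \<inter> perp (J - {u})
      \<and> norm_on C p \<le> L * norm_on C f \<and> (norm_on C f)\<^sup>2 = (norm_on C p)\<^sup>2 + (norm_on C f')\<^sup>2"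
    if f: "f \<in> invariant (J - {s}) \<inter> perp J" and s: "s \<in> J" "u \<noteq> s" for f s
  proof -
    obtain p where p: "p \<in> invariant (J - {u})" "\<And>g. g \<in> invariant (J - {u}) \<Longrightarrow> inner_on C p g = inner_on C f g"
      using ex_projection[of "J - {u}" f] by blast
    define f' where "f' = (\<lambda>c. f c - p c)"
    have f'p: "f' \<in> perp (J - {u})" unfolding perp_def f'_def using p(2) by (simp add: inner_on_diff_left)
    have "f \<in> invariant (J - {u} - {s})" "p \<in> invariant (J - {u} - {s})"
      using f p(1) invariant_mono[of "J - {u} - {s}" "J - {s}"] invariant_mono[of "J - {u} - {s}" "J - {u}"] by blast+
    then have f'i: "f' \<in> invariant (J - {u} - {s})" unfolding f'_def by (rule invariant_diff)
    have "p \<in> perp J" unfolding perp_def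
    proof (intro CollectI ballI)
      fix h assume h: "h \<in> invariant J"
      then have "h \<in> invariant (J - {u})" using invariant_mono[of "J - {u}" J] by blast
      moreover have "inner_on C f h = 0" using f h perpD by blast
      ultimately show "inner_on C p h = 0" using p(2) by simp
    qed
    then have "inner_on C f p \<le> L * (norm_on C f * norm_on C p)"
      using L[OF s(1) stu(3)] s(2) f p(1) unfolding cos_bound_def by blast
    moreover have pp: "inner_on C f p = inner_on C p p" using p by simp
    ultimately have "norm_on C p * norm_on C p \<le> L * norm_on C f * norm_on C p"
      using norm_on_square[of C p] by (simp add: power2_eq_square)
    then have le: "norm_on C p \<le> L * norm_on C f"
      using norm_on_nonneg[of C p] norm_on_nonneg[of C f] nn by (cases "norm_on C p = 0") auto
    have "inner_on C f f = inner_on C p p + inner_on C f' f'"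
      unfolding f'_def using pp inner_on_commute[of C p f] by (simp add: inner_on_diff_left inner_on_diff_right)
    then have "(norm_on C f)\<^sup>2 = (norm_on C p)\<^sup>2 + (norm_on C f')\<^sup>2" by (simp add: norm_on_square)
    moreover have "\<forall>c. f c = p c + f' c" by (simp add: f'_def)
    ultimately show ?thesis using f'i f'p p(1) le by blast
  qed
  obtain p f' where p: "\<And>c. f c = p c + f' c" "p \<in> invariant (J - {u})" "f' \<in> invariant (J - {u} - {s}) \<inter> perp (J - {u})"
      "norm_on C p \<le> L * norm_on C f" "(norm_on C f)\<^sup>2 = (norm_on C p)\<^sup>2 + (norm_on C f')\<^sup>2"
    using proj[OF f stu(1,5)] by metis
  obtain r g' where r: "\<And>c. g c = r c + g' c" "r \<in> invariant (J - {u})" "g' \<in> invariant (J - {u} - {t}) \<inter> perp (J - {u})"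
      "norm_on C r \<le> L * norm_on C g" "(norm_on C g)\<^sup>2 = (norm_on C r)\<^sup>2 + (norm_on C g')\<^sup>2"
    using proj[OF g stu(2,6)] by metis
  have "inner_on C f g = inner_on C p r + inner_on C p g' + inner_on C f' r + inner_on C f' g'"
  proof -
    have "inner_on C f g = inner_on C (\<lambda>c. p c + f' c) (\<lambda>c. r c + g' c)" using p(1) r(1) by (intro inner_on_cong) auto
    then show ?thesis by (simp add: inner_on_def sum.distrib algebra_simps)
  qed
  moreover have "inner_on C f' r = 0" using perpD p(3) r(2) by blast
  moreover have "inner_on C p g' = 0" using perpD[of g' "J - {u}" p] r(3) p(2) inner_on_commute[of C p g'] by simp
  moreover have "inner_on C f' g' \<le> l * (norm_on C f' * norm_on C g')"
    using l[OF stu(3), of s t] stu p(3) r(3) unfolding cos_bound_def by auto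
  moreover have "inner_on C p r \<le> norm_on C p * norm_on C r"
  proof -
    have "inner_on C p r \<le> (\<Sum>c\<in>C. \<bar>p c\<bar> * \<bar>r c\<bar>)"
      unfolding inner_on_def by (intro sum_mono) (metis abs_ge_self abs_mult)
    also have "\<dots> \<le> L2_set p C * L2_set r C" by (rule L2_set_mult_ineq)
    finally show ?thesis by (simp add: norm_on_def L2_set_def inner_on_def power2_eq_square)
  qed
  ultimately have "inner_on C f g \<le> norm_on C p * norm_on C r + l * (norm_on C f' * norm_on C g')" by linarith
  also have "\<dots> \<le> (L\<^sup>2 * (1 - l) + l) * (norm_on C f * norm_on C g)"
    using p(4,5) r(4,5) nn by (intro spherical_estimate norm_on_nonneg)
  finally show "inner_on C f g \<le> (L\<^sup>2 * (1 - l) + l) * (norm_on C f * norm_on C g)" .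
qed

text \<open>Bounds pass to limits, so the best one is again a bound.\<close>

lemma cos_bound_Inf:
  assumes "A \<noteq> {}" "\<And>l. l \<in> A \<Longrightarrow> cos_bound C U V l"
  shows "cos_bound C U V (Inf A)"
  unfolding cos_bound_def
proof (intro ballI)
  fix f g assume fg: "f \<in> U" "g \<in> V"
  let ?n = "norm_on C f * norm_on C g"
  have le: "inner_on C f g \<le> l * ?n" if "l \<in> A" for l using assms(2)[OF that] fg unfolding cos_bound_def by blast
  show "inner_on C f g \<le> Inf A * ?n"
  proof (cases "?n = 0")
    case True
    then show ?thesis using le assms(1) by fastforce
  next
    case False
    then have "?n > 0" using norm_on_nonneg[of C f] norm_on_nonneg[of C g] by (simp add: less_le)
    then have "inner_on C f g / ?n \<le> Inf A" using le by (intro cInf_greatest assms(1)) (simp add: field_simps)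
    then show ?thesis using \<open>?n > 0\<close> by (simp add: field_simps)
  qed
qed

lemma cos_bound_less_1:
  assumes "s \<in> J" "t \<in> J" "s \<noteq> t"
  shows "\<exists>L. 0 \<le> L \<and> L < 1 \<and> cos_bound C (invariant (J - {s}) \<inter> perp J) (invariant (J - {t}) \<inter> perp J) L"
  using cos_bound_attained[OF finite_C closed_cone_invariant_perp[of "J - {s}" J] closed_cone_invariant_perp[of "J - {t}" J]]
proof
  assume "\<exists>x\<in>invariant (J - {s}) \<inter> perp J. \<exists>y\<in>invariant (J - {t}) \<inter> perp J. inner_on C x x = 1 \<and> inner_on C y y = 1 \<and>
    inner_on C x y > 0 \<and> cos_bound C (invariant (J - {s}) \<inter> perp J) (invariant (J - {t}) \<inter> perp J) (inner_on C x y)"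
  then show ?thesis using unit_inner_less_1[OF assms] by (meson less_imp_le)
qed (auto intro: exI[of _ 0])

text \<open>
  The step from \<open>n\<close> to \<open>n + 1\<close> types is the trickling-down theorem: the optimal bound \<open>L\<close>
  satisfies \<open>L \<le> L\<^sup>2 (1 - l) + l\<close> and \<open>L < 1\<close>, hence \<open>L \<le> l / (1 - l)\<close>.
\<close>
lemma cos_bound_trickling:
  fixes \<mu> :: real
  assumes \<mu>: "\<mu> = sqrt ((real m - 2) / real q)"
    and "card J = n + 2" "real (n + 1) * \<mu> < 1" "s \<in> J" "t \<in> J" "s \<noteq> t" "m \<ge> 2"
  shows "cos_bound C (invariant (J - {s}) \<inter> perp J) (invariant (J - {t}) \<inter> perp J) (\<mu> / (1 - real n * \<mu>))"
  using assms(2-)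
proof (induction n arbitrary: J s t)
  case 0
  then have J: "J = {s, t}"
    by (intro card_seteq[symmetric]) (auto simp: card_insert_if intro: card_ge_0_finite)
  have "J - {s} = {t}" "J - {t} = {s}" unfolding J using 0 by auto
  then show ?case using cos_bound_pair[of t s] 0 J \<mu> by (simp add: insert_commute)
next
  case (Suc n)
  have \<mu>0: "\<mu> \<ge> 0" using \<mu> Suc.prems by simp
  define l where "l = \<mu> / (1 - real n * \<mu>)"
  have b: "(2 + real n) * \<mu> < 1" using Suc.prems by (simp add: algebra_simps)
  have n\<mu>: "real n * \<mu> \<ge> 0" using \<mu>0 by simp
  have d: "1 - real n * \<mu> > 0" using b \<mu>0 by (simp add: algebra_simps)
  have l: "0 \<le> l" "l < 1" unfolding l_def using \<mu>0 d b by (auto simp: field_simps)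
  have finJ: "finite J" using Suc.prems by (intro card_ge_0_finite) simp
  have IH: "cos_bound C (invariant (J - {u} - {s}) \<inter> perp (J - {u})) (invariant (J - {u} - {t}) \<inter> perp (J - {u})) l"
    if "u \<in> J" "s \<in> J - {u}" "t \<in> J - {u}" "s \<noteq> t" for u s t
    unfolding l_def using that finJ Suc.prems b \<mu>0 by (intro Suc.IH) (auto simp: algebra_simps)
  define B where "B = (\<lambda>L. \<forall>s\<in>J. \<forall>t\<in>J. s \<noteq> t \<longrightarrow>
      cos_bound C (invariant (J - {s}) \<inter> perp J) (invariant (J - {t}) \<inter> perp J) L)"
  define A where "A = {L. 0 \<le> L \<and> B L}"
  have "\<exists>L. 0 \<le> L \<and> L < 1 \<and> B L"
  proof -
    have "\<forall>p. \<exists>L. fst p \<in> J \<longrightarrow> snd p \<in> J \<longrightarrow> fst p \<noteq> snd p \<longrightarrow> 0 \<le> L \<and> L < 1 \<and>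
        cos_bound C (invariant (J - {fst p}) \<inter> perp J) (invariant (J - {snd p}) \<inter> perp J) L"
      using cos_bound_less_1 by blast
    then obtain M where M: "\<And>p. fst p \<in> J \<Longrightarrow> snd p \<in> J \<Longrightarrow> fst p \<noteq> snd p \<Longrightarrow> 0 \<le> M p \<and> M p < 1 \<and>
        cos_bound C (invariant (J - {fst p}) \<inter> perp J) (invariant (J - {snd p}) \<inter> perp J) (M p)" by metis
    \<comment> \<open>The strict bounds of the finitely many pairs are united by a maximum; the
      element 0 makes the set nonempty in any case.\<close>
    define Z where "Z = insert 0 (M ` {p \<in> J \<times> J. fst p \<noteq> snd p})"
    have "finite Z" "Z \<noteq> {}" unfolding Z_def using finJ by auto
    then have "Max Z \<in> Z" and Max: "\<And>z. z \<in> Z \<Longrightarrow> z \<le> Max Z" by auto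
    note \<open>Max Z \<in> Z\<close>
    moreover have "0 \<le> z \<and> z < 1" if "z \<in> Z" for z using that M unfolding Z_def by auto
    moreover have "B (Max Z)" unfolding B_def
    proof (intro ballI impI)
      fix s t assume st: "s \<in> J" "t \<in> J" "s \<noteq> t"
      then have "M (s, t) \<le> Max Z" unfolding Z_def by (intro Max[unfolded Z_def]) auto
      moreover have "cos_bound C (invariant (J - {s}) \<inter> perp J) (invariant (J - {t}) \<inter> perp J) (M (s, t))"
        using M[of "(s, t)"] st by simp
      ultimately show "cos_bound C (invariant (J - {s}) \<inter> perp J) (invariant (J - {t}) \<inter> perp J) (Max Z)"
        by (rule cos_bound_mono[rotated])
    qed
    ultimately show ?thesis by blast
  qed
  then obtain L0 where L0: "L0 \<in> A" "L0 < 1" unfolding A_def by blast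
  define L where "L = Inf A"
  have bdd: "bdd_below A" unfolding A_def by (rule bdd_belowI[of _ 0]) auto
  have L: "0 \<le> L" "L < 1" unfolding L_def using L0 bdd cInf_lower[OF L0(1) bdd]
    by (auto intro!: cInf_greatest simp: A_def)
  have BL: "B L" unfolding B_def L_def
  proof (intro ballI impI cos_bound_Inf)
    show "A \<noteq> {}" using L0 by blast
  qed (auto simp: A_def B_def)
  have "B (L\<^sup>2 * (1 - l) + l)" unfolding B_def
  proof (intro ballI impI)
    fix s t assume st: "s \<in> J" "t \<in> J" "s \<noteq> t"
    \<comment> \<open>There are at least three types, which leaves a \<open>u\<close> along which to
      project.\<close>
    have "J - {s, t} \<noteq> {}"
    proof
      assume "J - {s, t} = {}"
      then have "card J \<le> card {s, t}" by (intro card_mono) auto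
      then show False using Suc.prems(1) card_insert_le_m1[of 2 "{t}" s] by (simp add: card_insert_if split: if_splits)
    qed
    then obtain u where u: "u \<in> J" "u \<noteq> s" "u \<noteq> t" by blast
    show "cos_bound C (invariant (J - {s}) \<inter> perp J) (invariant (J - {t}) \<inter> perp J) (L\<^sup>2 * (1 - l) + l)"
      using BL IH L l st u unfolding B_def by (intro cos_bound_improve[where u = u]) auto
  qed
  moreover have "L\<^sup>2 * (1 - l) + l \<ge> 0" using l by simp
  ultimately have "L \<le> L\<^sup>2 * (1 - l) + l" unfolding L_def using bdd
    by (intro cInf_lower) (auto simp: A_def)
  \<comment> \<open>The quadratic inequality factors, and \<open>L < 1\<close> selects the branch
    below the smaller root.\<close>
  then have "(1 - L) * (l - L * (1 - l)) \<ge> 0" by (simp add: algebra_simps power2_eq_square)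
  then have "L * (1 - l) \<le> l" using L by (simp add: zero_le_mult_iff)
  then have "L \<le> l / (1 - l)" using l by (simp add: field_simps)
  \<comment> \<open>For \<open>\<mu> > 0\<close> this is the passage from
    \<open>1 / l = 1 / \<mu> - n\<close> to the reciprocal that is smaller by one.\<close>
  also have "\<dots> = \<mu> / (1 - real (Suc n) * \<mu>)"
  proof -
    have "1 - l = (1 - real (Suc n) * \<mu>) / (1 - real n * \<mu>)" unfolding l_def using d by (simp add: field_simps)
    then show ?thesis unfolding l_def using d by simp
  qed
  finally show ?case using BL Suc.prems cos_bound_mono unfolding B_def by blast
qed

end

section \<open>Expansion of the vertex functions\<close>

context chamber_system
begin

definition all_pairs_bound :: "real \<Rightarrow> bool" where
  "all_pairs_bound l \<longleftrightarrow> (\<forall>s t. s \<noteq> t \<longrightarrow>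
     cos_bound C (invariant (UNIV - {s}) \<inter> perp UNIV) (invariant (UNIV - {t}) \<inter> perp UNIV) l)"

text \<open>Subtracting the means makes both functions orthogonal to the constants, which by
  connectedness are all that is invariant under every type. A 0-1 function of mean \<open>x\<close>
  has variance \<open>x - x\<^sup>2\<close>; the product of norms is replaced by half the sum of
  squares, so that the bound can be summed over types.\<close>

lemma inner_vertex_functions:
  assumes l: "all_pairs_bound l" "0 \<le> l" and st: "s \<noteq> t"
    and F: "F \<in> invariant (UNIV - {s})" "\<And>c. F c = 0 \<or> F c = 1" and G: "G \<in> invariant (UNIV - {t})" "\<And>c. G c = 0 \<or> G c = 1"
    and n: "n = real (card C)" and x: "x = sum F C / n" and y: "y = sum G C / n"
  shows "inner_on C F G \<le> n * (x * y) + l * n * ((x - x\<^sup>2) + (y - y\<^sup>2)) / 2"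
proof -
  have n0: "n > 0" unfolding n using finite_C C_nonempty by (simp add: card_gt_0_iff)
  have const: "\<exists>k. \<forall>c\<in>C. g c = k" if "g \<in> invariant UNIV" for g
  proof -
    obtain c0 where "c0 \<in> C" using C_nonempty by blast
    then have "g c = g c0" if "c \<in> C" for c
      using connected[of g c c0] invariantD[OF \<open>g \<in> invariant UNIV\<close> UNIV_I] that by blast
    then show ?thesis by blast
  qed
  have centred: "(\<lambda>c. H c - z) \<in> invariant (UNIV - {u}) \<inter> perp UNIV"
      "inner_on C (\<lambda>c. H c - z) (\<lambda>c. H c - z) = n * (z - z\<^sup>2)"
    if H: "H \<in> invariant (UNIV - {u})" "\<And>c. H c = 0 \<or> H c = 1" and z: "z = sum H C / n" for H u z
  proof -
    have sumH: "sum H C = n * z" using z n0 by simp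
    have "inner_on C (\<lambda>c. H c - z) g = 0" if g: "g \<in> invariant UNIV" for g
    proof -
      obtain k where k: "\<And>c. c \<in> C \<Longrightarrow> g c = k" using const[OF g] by blast
      have "inner_on C (\<lambda>c. H c - z) g = (\<Sum>c\<in>C. (H c - z) * k)"
        unfolding inner_on_def using k by (intro sum.cong) auto
      also have "\<dots> = (sum H C - n * z) * k"
        by (simp add: sum_distrib_right[symmetric] sum_subtractf n)
      finally show ?thesis using sumH by simp
    qed
    then have "(\<lambda>c. H c - z) \<in> perp UNIV" unfolding perp_def by blast
    moreover have "(\<lambda>c. H c - z) \<in> invariant (UNIV - {u})" using H(1) unfolding invariant_def by auto
    ultimately show "(\<lambda>c. H c - z) \<in> invariant (UNIV - {u}) \<inter> perp UNIV" by blast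
    have "H c * H c = H c" for c using H(2)[of c] by auto
    then have "(H c - z) * (H c - z) = H c - 2 * z * H c + z\<^sup>2" for c by (simp add: algebra_simps power2_eq_square)
    then have "inner_on C (\<lambda>c. H c - z) (\<lambda>c. H c - z) = sum H C - 2 * z * sum H C + n * z\<^sup>2"
      unfolding inner_on_def by (simp add: sum.distrib sum_subtractf sum_distrib_left n)
    then show "inner_on C (\<lambda>c. H c - z) (\<lambda>c. H c - z) = n * (z - z\<^sup>2)"
      unfolding sumH by (simp add: algebra_simps power2_eq_square)
  qed
  note cF = centred[OF F x] and cG = centred[OF G y]
  let ?f = "\<lambda>c. F c - x" and ?g = "\<lambda>c. G c - y"
  have "inner_on C F G = inner_on C ?f ?g + n * (x * y)"
  proof -
    have sums: "sum F C = n * x" "sum G C = n * y" using x y n0 by auto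
    have "inner_on C ?f ?g = (\<Sum>c\<in>C. F c * G c - y * F c - x * G c + x * y)"
      unfolding inner_on_def by (intro sum.cong) (auto simp: algebra_simps)
    also have "\<dots> = inner_on C F G - y * sum F C - x * sum G C + n * (x * y)"
      unfolding inner_on_def by (simp add: sum.distrib sum_subtractf sum_distrib_left n)
    finally show ?thesis unfolding sums by (simp add: algebra_simps)
  qed
  moreover have "inner_on C ?f ?g \<le> l * (norm_on C ?f * norm_on C ?g)"
    using l(1) st cF(1) cG(1) unfolding all_pairs_bound_def cos_bound_def by blast
  moreover have "norm_on C ?f * norm_on C ?g \<le> (n * (x - x\<^sup>2) + n * (y - y\<^sup>2)) / 2"
  proof -
    have "0 \<le> (norm_on C ?f - norm_on C ?g)\<^sup>2" by simp
    then show ?thesis unfolding cF(2)[symmetric] cG(2)[symmetric] norm_on_square[symmetric]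
      by (simp add: power2_eq_square algebra_simps)
  qed
  then have "l * (norm_on C ?f * norm_on C ?g) \<le> l * ((n * (x - x\<^sup>2) + n * (y - y\<^sup>2)) / 2)"
    using l(2) by (rule mult_left_mono)
  ultimately show ?thesis by (simp add: algebra_simps)
qed

lemma sum_offdiag:
  fixes g :: "'t \<Rightarrow> 't \<Rightarrow> real"
  shows "(\<Sum>s\<in>UNIV. \<Sum>t\<in>UNIV - {s}. g s t) = (\<Sum>s\<in>UNIV. \<Sum>t\<in>UNIV. g s t) - (\<Sum>s\<in>UNIV. g s s)"
proof -
  have "(\<Sum>t\<in>UNIV - {s}. g s t) = (\<Sum>t\<in>UNIV. g s t) - g s s" for s by (simp add: sum_diff1)
  then show ?thesis by (simp add: sum_subtractf)
qed

text \<open>The means \<open>M s\<close> may differ between types and only their average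
  \<open>\<alpha>\<close> is known. The sum \<open>Q\<close> of their squares enters with negative
  sign and is at least \<open>(r + 1) * \<alpha>\<^sup>2\<close>, so equal means are the worst
  case.\<close>

lemma inner_vertex_functions_sum:
  assumes l: "all_pairs_bound l" "0 \<le> l" and r: "CARD('t) = r + 1"
    and F: "\<And>s. F s \<in> invariant (UNIV - {s})" "\<And>s c. F s c = 0 \<or> F s c = 1"
    and n: "n = real (card C)" and \<alpha>: "\<alpha> = (\<Sum>s\<in>UNIV. sum (F s) C) / (n * (real r + 1))"
  shows "(\<Sum>s\<in>UNIV. \<Sum>t\<in>UNIV - {s}. inner_on C (F s) (F t)) \<le> n * real r * (real r + 1) * (\<alpha>\<^sup>2 + l * (\<alpha> - \<alpha>\<^sup>2))"
proof -
  have n0: "n > 0" unfolding n using finite_C C_nonempty by (simp add: card_gt_0_iff)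
  define M where "M = (\<lambda>s. sum (F s) C / n)"
  define Q where "Q = (\<Sum>s\<in>UNIV. (M s)\<^sup>2)"
  have sumM: "(\<Sum>s\<in>UNIV. M s) = (real r + 1) * \<alpha>"
  proof -
    have "n * (real r + 1) \<noteq> 0" using n0 by simp
    then have "(\<Sum>s\<in>UNIV. sum (F s) C) = \<alpha> * (n * (real r + 1))" unfolding \<alpha> by simp
    then show ?thesis unfolding M_def sum_divide_distrib[symmetric] using n0 by simp
  qed
  have Q: "(real r + 1) * \<alpha>\<^sup>2 \<le> Q"
  proof -
    have "(\<Sum>s\<in>UNIV. (M s - \<alpha>)\<^sup>2) \<ge> 0" by (intro sum_nonneg) simp
    moreover have "(\<Sum>s\<in>UNIV. (M s - \<alpha>)\<^sup>2) = (\<Sum>s\<in>UNIV. (M s)\<^sup>2 - 2 * \<alpha> * M s + \<alpha>\<^sup>2)"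
      by (intro sum.cong refl) (simp add: power2_diff algebra_simps)
    moreover have "\<dots> = Q - 2 * \<alpha> * (\<Sum>s\<in>UNIV. M s) + (real r + 1) * \<alpha>\<^sup>2"
      unfolding Q_def using r by (simp add: sum.distrib sum_subtractf sum_distrib_left add.commute)
    ultimately show ?thesis unfolding sumM by (simp add: power2_eq_square algebra_simps)
  qed
  have "(\<Sum>s\<in>UNIV. \<Sum>t\<in>UNIV - {s}. inner_on C (F s) (F t))
      \<le> (\<Sum>s\<in>UNIV. \<Sum>t\<in>UNIV - {s}. n * (M s * M t) + l * n * ((M s - (M s)\<^sup>2) + (M t - (M t)\<^sup>2)) / 2)"
  proof (intro sum_mono)
    fix s t :: 't assume "t \<in> UNIV - {s}"
    then have "s \<noteq> t" by blast
    show "inner_on C (F s) (F t) \<le> n * (M s * M t) + l * n * ((M s - (M s)\<^sup>2) + (M t - (M t)\<^sup>2)) / 2"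
      by (rule inner_vertex_functions[OF l \<open>s \<noteq> t\<close> F(1,2) F(1,2) n]) (simp_all add: M_def)
  qed
  also have "\<dots> = n * ((\<Sum>s\<in>UNIV. M s)\<^sup>2 - Q) + l * n * real r * ((\<Sum>s\<in>UNIV. M s) - Q)"
  proof -
    define V where "V = (\<lambda>s. M s - (M s)\<^sup>2)"
    have sV: "sum V UNIV = (\<Sum>s\<in>UNIV. M s) - Q" by (simp add: V_def Q_def sum_subtractf)
    have "(\<Sum>s\<in>UNIV. \<Sum>t\<in>UNIV - {s}. n * (M s * M t) + l * n * (V s + V t) / 2)
        = n * ((\<Sum>s\<in>UNIV. M s)\<^sup>2 - Q) + l * n / 2 * (2 * (real r + 1) * sum V UNIV - 2 * sum V UNIV)"
    proof -
      have 1: "(\<Sum>s\<in>UNIV. \<Sum>t\<in>UNIV. n * (M s * M t)) = n * (\<Sum>s\<in>UNIV. M s)\<^sup>2"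
        unfolding power2_eq_square sum_product by (simp only: sum_distrib_left)
      have 2: "(\<Sum>s\<in>UNIV. \<Sum>t\<in>UNIV. l * n * (V s + V t) / 2) = l * n / 2 * (2 * (real r + 1) * sum V UNIV)"
      proof -
        have "(\<Sum>s\<in>UNIV. \<Sum>t\<in>UNIV. V s + V t) = (\<Sum>s\<in>UNIV. (real r + 1) * V s) + (real r + 1) * sum V UNIV"
          using r by (simp add: sum.distrib add.commute)
        also have "\<dots> = 2 * (real r + 1) * sum V UNIV"
          unfolding sum_distrib_left[symmetric] by simp
        finally have "(\<Sum>s\<in>UNIV. \<Sum>t\<in>UNIV. V s + V t) = 2 * (real r + 1) * sum V UNIV" .
        then show ?thesis by (simp add: sum_distrib_left[symmetric] sum_divide_distrib[symmetric])
      qed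
      have 3: "(\<Sum>s\<in>UNIV. n * (M s * M s)) = n * Q" by (simp add: Q_def power2_eq_square sum_distrib_left)
      have 4: "(\<Sum>s\<in>UNIV. l * n * (V s + V s) / 2) = l * n / 2 * (2 * sum V UNIV)"
        by (simp add: sum_distrib_left sum_divide_distrib algebra_simps)
      show ?thesis unfolding sum_offdiag sum.distrib 1 2 3 4 by (simp add: algebra_simps)
    qed
    then show ?thesis unfolding sV unfolding V_def by (simp add: algebra_simps)
  qed
  also have "\<dots> \<le> n * (((real r + 1) * \<alpha>)\<^sup>2 - (real r + 1) * \<alpha>\<^sup>2)
      + l * n * real r * ((real r + 1) * \<alpha> - (real r + 1) * \<alpha>\<^sup>2)"
    unfolding sumM using Q n0 l(2) by (intro add_mono mult_left_mono) auto
  also have "\<dots> = n * real r * (real r + 1) * (\<alpha>\<^sup>2 + l * (\<alpha> - \<alpha>\<^sup>2))"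
    by (simp add: power2_eq_square algebra_simps)
  finally show ?thesis .
qed

text \<open>
  The sets of equal values of \<open>\<phi>\<close> are treated separately; if \<open>\<alpha> v\<close> is the weight of the value
  \<open>v\<close>, then the cut has weight at least \<open>(1 - l) (1 - \<Sum> \<alpha>\<^sup>2) \<ge> (1 - l) (1 - max \<alpha>)\<close>.
\<close>
lemma expansion:
  fixes \<phi> :: "'t \<Rightarrow> 'c \<Rightarrow> 'b"
  assumes l: "all_pairs_bound l" "0 \<le> l" "l \<le> 1" and r: "CARD('t) = r + 1"
    and \<phi>: "\<And>s u c d. u \<noteq> s \<Longrightarrow> c \<in> C \<Longrightarrow> d \<in> N u c \<Longrightarrow> \<phi> s d = \<phi> s c"
  shows "\<exists>v. (1 - l) * real r * (\<Sum>c\<in>C. \<Sum>s\<in>UNIV. of_bool (\<phi> s c \<noteq> v))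
    \<le> (\<Sum>c\<in>C. \<Sum>s\<in>UNIV. \<Sum>t\<in>UNIV. of_bool (\<phi> s c \<noteq> \<phi> t c))"
proof -
  define n where "n = real (card C)"
  have n0: "n > 0" unfolding n_def using finite_C C_nonempty by (simp add: card_gt_0_iff)
  \<comment> \<open>Only finitely many values occur, though their type may be infinite.\<close>
  define W where "W = (\<lambda>p. \<phi> (fst p) (snd p)) ` (UNIV \<times> C)"
  have finW: "finite W" unfolding W_def using finite_C by simp
  have neW: "W \<noteq> {}" unfolding W_def using C_nonempty by auto
  have inW: "\<phi> s c \<in> W" if "c \<in> C" for s c unfolding W_def using that by force
  define F where "F = (\<lambda>v s c. of_bool (\<phi> s c = v) :: real)"
  define \<alpha> where "\<alpha> = (\<lambda>v. (\<Sum>s\<in>UNIV. sum (F v s) C) / (n * (real r + 1)))"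
  have \<alpha>0: "\<alpha> v \<ge> 0" for v unfolding \<alpha>_def F_def using n0 by (intro divide_nonneg_nonneg sum_nonneg) auto
  have sumF: "(\<Sum>v\<in>W. F v s c) = 1" if "c \<in> C" for s c
    unfolding F_def of_bool_def using finW inW[OF that, of s] by simp
  have sum\<alpha>: "(\<Sum>v\<in>W. \<alpha> v) = 1"
  proof -
    have "(\<Sum>v\<in>W. \<Sum>s\<in>UNIV. sum (F v s) C) = (\<Sum>s\<in>UNIV. \<Sum>v\<in>W. sum (F v s) C)"
      by (rule sum.swap)
    also have "\<dots> = (\<Sum>s\<in>UNIV. \<Sum>c\<in>C. \<Sum>v\<in>W. F v s c)"
      by (intro sum.cong refl sum.swap)
    also have "\<dots> = (real r + 1) * n" using sumF r by (simp add: n_def)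
    finally have S: "(\<Sum>v\<in>W. \<Sum>s\<in>UNIV. sum (F v s) C) = n * (real r + 1)" by (simp only: mult.commute)
    have "n * (real r + 1) \<noteq> 0" using n0 by simp
    then show ?thesis unfolding \<alpha>_def sum_divide_distrib[symmetric] S by (rule divide_self)
  qed
  \<comment> \<open>The value of largest weight, which will be the constant subtracted from the
    cochain.\<close>
  obtain v where v: "v \<in> W" "\<And>u. u \<in> W \<Longrightarrow> \<alpha> u \<le> \<alpha> v"
  proof -
    have "Max (\<alpha> ` W) \<in> \<alpha> ` W" using finW neW by (intro Max_in) auto
    then obtain v where "v \<in> W" "\<alpha> v = Max (\<alpha> ` W)" by auto
    then show ?thesis using that finW by (metis Max_ge finite_imageI imageI)
  qed
  have sq: "(\<Sum>u\<in>W. (\<alpha> u)\<^sup>2) \<le> \<alpha> v"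
  proof -
    have "(\<Sum>u\<in>W. (\<alpha> u)\<^sup>2) \<le> (\<Sum>u\<in>W. \<alpha> v * \<alpha> u)"
      using v(2) \<alpha>0 by (intro sum_mono) (simp add: power2_eq_square mult_right_mono)
    then show ?thesis by (simp add: sum_distrib_left[symmetric] sum\<alpha>)
  qed
  have Finv: "F u s \<in> invariant (UNIV - {s})" for u s
    unfolding invariant_def F_def using \<phi> by auto
  have "(\<Sum>s\<in>UNIV. \<Sum>t\<in>UNIV - {s}. \<Sum>c\<in>C. of_bool (\<phi> s c = \<phi> t c))
      = (\<Sum>u\<in>W. \<Sum>s\<in>UNIV. \<Sum>t\<in>UNIV - {s}. inner_on C (F u s) (F u t))"
  proof -
    have "of_bool (\<phi> s c = \<phi> t c) = (\<Sum>u\<in>W. F u s c * F u t c)" if "c \<in> C" for s t c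
    proof -
      have "(\<Sum>u\<in>W. F u s c * F u t c) = (\<Sum>u\<in>W. if u = \<phi> s c then F u t c else 0)"
        unfolding F_def by (intro sum.cong) auto
      also have "\<dots> = F (\<phi> s c) t c" using finW inW[OF that] by simp
      finally show ?thesis by (auto simp: F_def)
    qed
    then have "(\<Sum>s\<in>UNIV. \<Sum>t\<in>UNIV - {s}. \<Sum>c\<in>C. of_bool (\<phi> s c = \<phi> t c))
        = (\<Sum>s\<in>UNIV. \<Sum>t\<in>UNIV - {s}. \<Sum>c\<in>C. \<Sum>u\<in>W. F u s c * F u t c)"
      by (intro sum.cong refl) simp
    also have "\<dots> = (\<Sum>s\<in>UNIV. \<Sum>t\<in>UNIV - {s}. \<Sum>u\<in>W. inner_on C (F u s) (F u t))"
      unfolding inner_on_def by (intro sum.cong refl sum.swap)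
    also have "\<dots> = (\<Sum>s\<in>UNIV. \<Sum>u\<in>W. \<Sum>t\<in>UNIV - {s}. inner_on C (F u s) (F u t))"
      by (intro sum.cong refl sum.swap)
    also have "\<dots> = (\<Sum>u\<in>W. \<Sum>s\<in>UNIV. \<Sum>t\<in>UNIV - {s}. inner_on C (F u s) (F u t))"
      by (rule sum.swap)
    finally show ?thesis .
  qed
  also have "\<dots> \<le> (\<Sum>u\<in>W. n * real r * (real r + 1) * ((\<alpha> u)\<^sup>2 + l * (\<alpha> u - (\<alpha> u)\<^sup>2)))"
    using Finv by (intro sum_mono inner_vertex_functions_sum[OF l(1,2) r]) (auto simp: F_def n_def \<alpha>_def)
  also have "\<dots> = n * real r * (real r + 1) * (l + (1 - l) * (\<Sum>u\<in>W. (\<alpha> u)\<^sup>2))"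
  proof -
    have "(\<Sum>u\<in>W. (\<alpha> u)\<^sup>2 + l * (\<alpha> u - (\<alpha> u)\<^sup>2)) = l + (1 - l) * (\<Sum>u\<in>W. (\<alpha> u)\<^sup>2)"
      using sum\<alpha> by (simp add: sum.distrib sum_subtractf sum_distrib_left[symmetric] algebra_simps)
    then show ?thesis by (simp add: sum_distrib_left[symmetric])
  qed
  also have "\<dots> \<le> n * real r * (real r + 1) * (l + (1 - l) * \<alpha> v)"
    using sq l n0 by (intro mult_left_mono add_left_mono) auto
  finally have eq_le: "(\<Sum>s\<in>UNIV. \<Sum>t\<in>UNIV - {s}. \<Sum>c\<in>C. of_bool (\<phi> s c = \<phi> t c))
      \<le> n * real r * (real r + 1) * (l + (1 - l) * \<alpha> v)" .
  have "(\<Sum>c\<in>C. \<Sum>s\<in>UNIV. \<Sum>t\<in>UNIV. of_bool (\<phi> s c \<noteq> \<phi> t c))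
      = (\<Sum>s\<in>UNIV. \<Sum>c\<in>C. \<Sum>t\<in>UNIV. (of_bool (\<phi> s c \<noteq> \<phi> t c) :: real))"
    by (rule sum.swap)
  also have "\<dots> = (\<Sum>s\<in>UNIV. \<Sum>t\<in>UNIV. \<Sum>c\<in>C. of_bool (\<phi> s c \<noteq> \<phi> t c))"
    by (intro sum.cong refl sum.swap)
  also have "\<dots> = (\<Sum>s\<in>UNIV. \<Sum>t\<in>UNIV - {s}. \<Sum>c\<in>C. of_bool (\<phi> s c \<noteq> \<phi> t c))"
    unfolding sum_offdiag by simp
  also have "\<dots> = (\<Sum>s\<in>UNIV. \<Sum>t\<in>UNIV - {s}. n - (\<Sum>c\<in>C. of_bool (\<phi> s c = \<phi> t c)))"
    unfolding n_def by (intro sum.cong refl) (simp add: of_bool_not_iff sum_subtractf)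
  also have "\<dots> = n * real r * (real r + 1) - (\<Sum>s\<in>UNIV. \<Sum>t\<in>UNIV - {s}. \<Sum>c\<in>C. of_bool (\<phi> s c = \<phi> t c))"
    using r by (simp add: sum_subtractf algebra_simps)
  also have "\<dots> \<ge> n * real r * (real r + 1) - n * real r * (real r + 1) * (l + (1 - l) * \<alpha> v)"
    using eq_le by simp
  finally have cut: "(\<Sum>c\<in>C. \<Sum>s\<in>UNIV. \<Sum>t\<in>UNIV. of_bool (\<phi> s c \<noteq> \<phi> t c))
      \<ge> n * real r * (real r + 1) * ((1 - l) * (1 - \<alpha> v))" by (simp add: algebra_simps)
  have "(\<Sum>c\<in>C. \<Sum>s\<in>UNIV. (of_bool (\<phi> s c \<noteq> v) :: real)) = (\<Sum>s\<in>UNIV. n - sum (F v s) C)"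
    unfolding n_def F_def by (subst sum.swap) (simp add: of_bool_not_iff sum_subtractf)
  also have "\<dots> = n * (real r + 1) * (1 - \<alpha> v)"
  proof -
    have "n * (real r + 1) \<noteq> 0" using n0 by simp
    then have "(\<Sum>s\<in>UNIV. sum (F v s) C) = \<alpha> v * (n * (real r + 1))" unfolding \<alpha>_def by simp
    then show ?thesis using r by (simp add: sum_subtractf algebra_simps)
  qed
  finally have sum_ne: "(\<Sum>c\<in>C. \<Sum>s\<in>UNIV. (of_bool (\<phi> s c \<noteq> v) :: real)) = n * (real r + 1) * (1 - \<alpha> v)" .
  show ?thesis by (rule exI[of _ v]) (use cut in \<open>simp only: sum_ne mult_ac\<close>)
qed

end

section \<open>The canonical weight\<close>

definition vertex_of :: "('v \<Rightarrow> 't) \<Rightarrow> 't \<Rightarrow> 'v set \<Rightarrow> 'v" where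
  "vertex_of \<tau> s c = inv_into c \<tau> s"

lemma vertex_of:
  assumes "c \<in> chambers \<tau> X"
  shows "vertex_of \<tau> s c \<in> c" "\<tau> (vertex_of \<tau> s c) = s" "v \<in> c \<Longrightarrow> vertex_of \<tau> (\<tau> v) c = v"
proof -
  have bij: "bij_betw \<tau> c UNIV" using assms by (simp add: chambers_def)
  show "vertex_of \<tau> s c \<in> c" "\<tau> (vertex_of \<tau> s c) = s" "v \<in> c \<Longrightarrow> vertex_of \<tau> (\<tau> v) c = v"
    unfolding vertex_of_def using bij
    by (auto simp: bij_betw_def inv_into_into f_inv_into_f inv_into_f_f)
qed

lemma vertex_of_adj:
  assumes "c \<in> chambers \<tau> X" "d \<in> adj \<tau> X u c" "u \<noteq> s"
  shows "vertex_of \<tau> s d = vertex_of \<tau> s c"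
proof -
  have d: "d \<in> chambers \<tau> X" "panel \<tau> u d = panel \<tau> u c" using assms(2) by (auto simp: adj_def)
  have "vertex_of \<tau> s c \<in> panel \<tau> u c" using vertex_of[OF assms(1)] assms(3) by (simp add: panel_def)
  then have "vertex_of \<tau> s c \<in> d" using d(2) by (auto simp: panel_def)
  then show ?thesis using vertex_of(3)[OF d(1)] vertex_of(2)[OF assms(1)] by metis
qed

text \<open>Double counting of incident faces and chambers: the weight is the law of a random face
  of size \<open>k\<close> in a random chamber.\<close>

lemma sum_canonical_weight:
  assumes fin: "finite X" and C: "faces X r = C" and A: "A \<subseteq> X" "\<And>x. x \<in> A \<Longrightarrow> card x = k"
  shows "sum (canonical_weight r X) A =
    (\<Sum>c\<in>C. real (card {x \<in> A. x \<subseteq> c})) / (real ((r + 1) choose k) * real (card C))"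
proof -
  have finC: "finite C" using C fin unfolding faces_def by auto
  have finA: "finite A" using A(1) fin finite_subset by blast
  have "(\<Sum>x\<in>A. real (card {c \<in> C. x \<subseteq> c})) = (\<Sum>x\<in>A. \<Sum>c | c \<in> C \<and> x \<subseteq> c. 1)" by simp
  also have "\<dots> = (\<Sum>c\<in>C. \<Sum>x | x \<in> A \<and> x \<subseteq> c. 1)" by (rule sum.swap_restrict[OF finA finC])
  finally have swap: "(\<Sum>x\<in>A. real (card {c \<in> C. x \<subseteq> c})) = (\<Sum>c\<in>C. real (card {x \<in> A. x \<subseteq> c}))" by simp
  have "sum (canonical_weight r X) A =
      (\<Sum>x\<in>A. real (card {c \<in> C. x \<subseteq> c}) / (real ((r + 1) choose k) * real (card C)))"
    unfolding canonical_weight_def C using A(2) by (intro sum.cong refl) (simp add: divide_inverse)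
  then show ?thesis unfolding swap[symmetric] by (simp add: sum_divide_distrib)
qed

lemma canonical_weight_nonneg: "canonical_weight r X x \<ge> 0"
  unfolding canonical_weight_def by simp

text \<open>The order on the vertices decides only the sign of the difference.\<close>

lemma coboundary0_neq_0_iff:
  assumes L: "linear_order_on (vertices X) L" and e: "{u, v} \<in> faces X 1"
  shows "coboundary0 L X f {u, v} \<noteq> 0 \<longleftrightarrow> f {u} \<noteq> f {v}"
proof -
  have uv: "u \<noteq> v" "u \<in> vertices X" "v \<in> vertices X"
    using e by (auto simp: faces_def card_insert_if split: if_splits)
  have L': "refl_on (vertices X) L" "antisym L" "total_on (vertices X) L"
    using L by (auto simp: order_on_defs)
  have refl: "(x, x) \<in> L" if "x \<in> vertices X" for x using refl_onD[OF L'(1) that] .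
  have key: "larger_vertex L {x, y} = y \<and> smaller_vertex L {x, y} = x"
    if "(x, y) \<in> L" "x \<noteq> y" "x \<in> vertices X" "y \<in> vertices X" for x y
  proof
    have "(y, x) \<notin> L" using antisymD[OF L'(2)] that by blast
    then show "larger_vertex L {x, y} = y" "smaller_vertex L {x, y} = x"
      unfolding larger_vertex_def smaller_vertex_def using that refl by (auto intro!: the_equality)
  qed
  have "(u, v) \<in> L \<or> (v, u) \<in> L" using L'(3) uv unfolding total_on_def by blast
  then show ?thesis
  proof
    assume "(u, v) \<in> L"
    then show ?thesis using key[of u v] uv e by (auto simp: coboundary0_def)
  next
    assume "(v, u) \<in> L"
    then show ?thesis using key[of v u] uv e by (auto simp: coboundary0_def insert_commute)
  qed
qed

lemma card_pairs_le:
  assumes "finite A" "finite P" "g ` P \<subseteq> A" "\<And>p p'. p \<in> P \<Longrightarrow> p' \<in> P \<Longrightarrow> g p = g p' \<Longrightarrow> p' = p \<or> p' = (snd p, fst p)"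
  shows "card P \<le> 2 * card A"
proof -
  have "card P = (\<Sum>x\<in>A. card {p \<in> P. g p = x})"
    using sum.group[OF assms(2,1,3), of "\<lambda>_. 1 :: nat"] by simp
  also have "\<dots> \<le> (\<Sum>x\<in>A. 2)"
  proof (rule sum_mono)
    fix x
    show "card {p \<in> P. g p = x} \<le> 2"
    proof (cases "{p \<in> P. g p = x} = {}")
      case True
      then show ?thesis by (metis card.empty zero_le)
    next
      case False
      then obtain p where p: "p \<in> P" "g p = x" by blast
      have "{p \<in> P. g p = x} \<subseteq> {p, (snd p, fst p)}"
      proof
        fix p' assume "p' \<in> {p \<in> P. g p = x}"
        then have "p' \<in> P" "g p = g p'" using p by auto
        then show "p' \<in> {p, (snd p, fst p)}" using assms(4)[OF p(1)] by blast
      qed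
      then have "card {p \<in> P. g p = x} \<le> card {p, (snd p, fst p)}" by (intro card_mono) auto
      also have "\<dots> \<le> 2" by (simp add: card_insert_if)
      finally show ?thesis .
    qed
  qed
  finally show ?thesis by simp
qed

text \<open>A pair of types with different values gives an edge of \<open>c\<close> that belongs to
  \<open>A\<close>; ordered pairs hit an edge at most twice, whence the factor 2.\<close>

lemma card_edges_ge:
  fixes \<tau> :: "'v \<Rightarrow> 't::finite"
  assumes X: "abstract_simplicial_complex X" and c: "c \<in> chambers \<tau> X"
    and A: "\<And>u v. {u, v} \<in> faces X 1 \<Longrightarrow> {u, v} \<in> A \<longleftrightarrow> f {u} \<noteq> f {v}" and "finite A"
  shows "(\<Sum>s\<in>UNIV. \<Sum>t\<in>UNIV. of_bool (f {vertex_of \<tau> s c} \<noteq> f {vertex_of \<tau> t c})) \<le> 2 * real (card {x \<in> A. x \<subseteq> c})"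
proof -
  note vc = vertex_of[OF c]
  define P where "P = {p :: 't \<times> 't. f {vertex_of \<tau> (fst p) c} \<noteq> f {vertex_of \<tau> (snd p) c}}"
  define g where "g = (\<lambda>p. {vertex_of \<tau> (fst p) c, vertex_of \<tau> (snd p) c})"
  have "(\<Sum>s\<in>UNIV. \<Sum>t\<in>UNIV. of_bool (f {vertex_of \<tau> s c} \<noteq> f {vertex_of \<tau> t c}))
      = (\<Sum>(s, t)\<in>UNIV \<times> UNIV. (of_bool (f {vertex_of \<tau> s c} \<noteq> f {vertex_of \<tau> t c}) :: real))"
    by (rule sum.cartesian_product)
  also have "\<dots> = (\<Sum>p\<in>UNIV. of_bool (p \<in> P))" by (intro sum.cong) (auto simp: P_def)
  also have "\<dots> = real (card P)" by (simp add: sum_of_bool_eq)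
  also have "card P \<le> 2 * card {x \<in> A. x \<subseteq> c}"
  proof (rule card_pairs_le[of _ _ g])
    show "g ` P \<subseteq> {x \<in> A. x \<subseteq> c}"
    proof clarify
      fix s t assume "(s, t) \<in> P"
      then have ne: "f {vertex_of \<tau> s c} \<noteq> f {vertex_of \<tau> t c}" by (simp add: P_def)
      have "{vertex_of \<tau> s c, vertex_of \<tau> t c} \<in> X"
        using X c vc(1) unfolding abstract_simplicial_complex_def chambers_def by (metis (no_types, lifting) empty_subsetI insert_subset mem_Collect_eq)
      moreover have "vertex_of \<tau> s c \<noteq> vertex_of \<tau> t c" using ne by metis
      ultimately have "{vertex_of \<tau> s c, vertex_of \<tau> t c} \<in> faces X 1" by (simp add: faces_def)
      then show "g (s, t) \<in> A \<and> g (s, t) \<subseteq> c" using A ne vc(1) by (simp add: g_def)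
    qed
    show "p' = p \<or> p' = (snd p, fst p)" if "g p = g p'" for p p'
    proof -
      have "\<tau> ` g p = {fst p, snd p}" for p unfolding g_def using vc(2) by simp
      then have "{fst p, snd p} = {fst p', snd p'}" using that by metis
      then show ?thesis by (auto simp: doubleton_eq_iff prod_eq_iff)
    qed
  qed (use assms(4) in auto)
  finally show ?thesis by simp
qed

lemma card_vertices_le:
  fixes \<tau> :: "'v \<Rightarrow> 't::finite"
  assumes c: "c \<in> chambers \<tau> X" and A: "\<And>x. x \<in> A \<Longrightarrow> card x = 1 \<and> f x \<noteq> a"
  shows "real (card {x \<in> A. x \<subseteq> c}) \<le> (\<Sum>s\<in>UNIV. of_bool (f {vertex_of \<tau> s c} \<noteq> a))"
proof -
  define S where "S = {s. f {vertex_of \<tau> s c} \<noteq> a}"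
  have "{x \<in> A. x \<subseteq> c} \<subseteq> (\<lambda>s. {vertex_of \<tau> s c}) ` S"
  proof
    fix x assume x: "x \<in> {x \<in> A. x \<subseteq> c}"
    then obtain v where v: "x = {v}" using A card_1_singletonE by blast
    then have "vertex_of \<tau> (\<tau> v) c = v" using vertex_of(3)[OF c] x by blast
    then show "x \<in> (\<lambda>s. {vertex_of \<tau> s c}) ` S" using v x A by (intro image_eqI[of _ _ "\<tau> v"]) (auto simp: S_def)
  qed
  then have "card {x \<in> A. x \<subseteq> c} \<le> card S" by (intro surj_card_le) auto
  also have "real (card S) = (\<Sum>s\<in>UNIV. of_bool (f {vertex_of \<tau> s c} \<noteq> a))"
    by (simp add: S_def sum_of_bool_eq)
  finally show ?thesis by simp
qed

lemma dist_constant_le: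
  fixes f :: "'v set \<Rightarrow> 'a::ab_group_add"
  assumes "finite X"
  shows "dist_constant X w f \<le> sum w {x \<in> faces X 0. f x \<noteq> a}"
proof -
  define g where "g = (\<lambda>x. if x \<in> faces X 0 then a else (0::'a))"
  have g: "g \<in> constant_cochains X" unfolding g_def constant_cochains_def cochains_def by auto
  have "{x \<in> faces X 0. f x - g x \<noteq> 0} = {x \<in> faces X 0. f x \<noteq> a}" by (auto simp: g_def)
  then have "sum w {x \<in> faces X 0. f x \<noteq> a} = cochain_norm X w 0 (\<lambda>x. f x - g x)"
    unfolding cochain_norm_def by simp
  \<comment> \<open>There may be infinitely many constants, but each norm is the weight of a subset
    of the finite set of vertices; this finiteness gives \<open>Min\<close> its meaning.\<close>
  moreover have "finite {cochain_norm X w 0 (\<lambda>x. f x - g x) | g. g \<in> constant_cochains X}"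
  proof (rule finite_subset)
    show "{cochain_norm X w 0 (\<lambda>x. f x - g x) | g. g \<in> constant_cochains X} \<subseteq> sum w ` Pow (faces X 0)"
      unfolding cochain_norm_def by blast
    show "finite (sum w ` Pow (faces X 0))" using assms by (simp add: faces_def)
  qed
  ultimately show ?thesis unfolding dist_constant_def using g by (auto intro!: Min_le)
qed

text \<open>Averaging over chambers turns both weights into counts of vertices and edges in a single
  chamber, the form in which \<open>expansion\<close> compares them.\<close>

lemma cochain_norm_coboundary_ge:
  fixes \<tau> :: "'v \<Rightarrow> 't::finite" and f :: "'v set \<Rightarrow> 'a::ab_group_add"
  assumes cs: "chamber_system (chambers \<tau> X) (adj \<tau> X) a q m" and l: "chamber_system.all_pairs_bound (chambers \<tau> X) (adj \<tau> X) l"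
    "0 \<le> l" "l \<le> 1"
    and X: "abstract_simplicial_complex X" "finite X" and r: "CARD('t) = r + 1" "r \<ge> 1"
    and faces: "faces X r = chambers \<tau> X" and L: "linear_order_on (vertices X) L"
  shows "(1 - l) * dist_constant X (canonical_weight r X) f \<le> cochain_norm X (canonical_weight r X) 1 (coboundary0 L X f)"
proof -
  interpret chamber_system "chambers \<tau> X" "adj \<tau> X" a q m by (rule cs)
  let ?C = "chambers \<tau> X" and ?w = "canonical_weight r X"
  let ?\<phi> = "\<lambda>s c. f {vertex_of \<tau> s c}"
  have n0: "real (card ?C) > 0" using finite_C C_nonempty by (simp add: card_gt_0_iff)
  have inv: "?\<phi> s d = ?\<phi> s c" if "u \<noteq> s" "c \<in> ?C" "d \<in> adj \<tau> X u c" for s u c d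
    using vertex_of_adj[OF that(2,3,1)] by simp
  have "\<exists>v. (1 - l) * real r * (\<Sum>c\<in>?C. \<Sum>s\<in>UNIV. of_bool (?\<phi> s c \<noteq> v))
    \<le> (\<Sum>c\<in>?C. \<Sum>s\<in>UNIV. \<Sum>t\<in>UNIV. of_bool (?\<phi> s c \<noteq> ?\<phi> t c))"
    by (rule expansion[OF l r(1)], erule (2) inv)
  then obtain v where v: "(1 - l) * real r * (\<Sum>c\<in>?C. \<Sum>s\<in>UNIV. of_bool (?\<phi> s c \<noteq> v))
    \<le> (\<Sum>c\<in>?C. \<Sum>s\<in>UNIV. \<Sum>t\<in>UNIV. of_bool (?\<phi> s c \<noteq> ?\<phi> t c))"
    by (elim exE)
  define A where "A = {x \<in> faces X 0. f x \<noteq> v}"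
  define B where "B = {x \<in> faces X 1. coboundary0 L X f x \<noteq> 0}"
  have "sum ?w A = (\<Sum>c\<in>?C. real (card {x \<in> A. x \<subseteq> c})) / (real ((r + 1) choose 1) * real (card ?C))"
    by (rule sum_canonical_weight[OF X(2) faces]) (auto simp: A_def faces_def)
  also have "\<dots> \<le> (\<Sum>c\<in>?C. \<Sum>s\<in>UNIV. of_bool (?\<phi> s c \<noteq> v)) / (real ((r + 1) choose 1) * real (card ?C))"
    by (intro divide_right_mono sum_mono card_vertices_le) (auto simp: A_def faces_def)
  finally have 1: "sum ?w A \<le> (\<Sum>c\<in>?C. \<Sum>s\<in>UNIV. of_bool (?\<phi> s c \<noteq> v)) / ((real r + 1) * real (card ?C))"
    unfolding choose_one by (simp only: of_nat_add of_nat_1)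
  have "(\<Sum>c\<in>?C. \<Sum>s\<in>UNIV. \<Sum>t\<in>UNIV. of_bool (?\<phi> s c \<noteq> ?\<phi> t c)) \<le> (\<Sum>c\<in>?C. 2 * real (card {x \<in> B. x \<subseteq> c}))"
    using coboundary0_neq_0_iff[OF L] X by (intro sum_mono card_edges_ge[OF X(1)]) (auto simp: B_def faces_def)
  then have "(\<Sum>c\<in>?C. \<Sum>s\<in>UNIV. \<Sum>t\<in>UNIV. of_bool (?\<phi> s c \<noteq> ?\<phi> t c)) / (real r * (real r + 1) * real (card ?C))
      \<le> (\<Sum>c\<in>?C. 2 * real (card {x \<in> B. x \<subseteq> c})) / (real r * (real r + 1) * real (card ?C))"
    by (intro divide_right_mono) auto
  also have "\<dots> = (\<Sum>c\<in>?C. real (card {x \<in> B. x \<subseteq> c})) / (real ((r + 1) choose 2) * real (card ?C))"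
  proof -
    \<comment> \<open>A chamber has \<open>r * (r + 1) / 2\<close> edges; the denominator 2 absorbs
      the factor from counting ordered pairs.\<close>
    have "even (r * (r + 1))" by simp
    then have choose: "real ((r + 1) choose 2) = real r * (real r + 1) / 2"
      unfolding choose_two by (simp add: real_of_nat_div algebra_simps)
    show ?thesis unfolding choose by (simp add: sum_distrib_left[symmetric])
  qed
  also have "\<dots> = sum ?w B"
    by (rule sum_canonical_weight[OF X(2) faces, symmetric]) (auto simp: B_def faces_def)
  finally have 2: "(\<Sum>c\<in>?C. \<Sum>s\<in>UNIV. \<Sum>t\<in>UNIV. of_bool (?\<phi> s c \<noteq> ?\<phi> t c)) / (real r * (real r + 1) * real (card ?C)) \<le> sum ?w B" .
  have "(1 - l) * dist_constant X ?w f \<le> (1 - l) * sum ?w A"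
    unfolding A_def using l dist_constant_le[OF X(2)] by (intro mult_left_mono) auto
  also have "\<dots> \<le> (1 - l) * ((\<Sum>c\<in>?C. \<Sum>s\<in>UNIV. of_bool (?\<phi> s c \<noteq> v)) / ((real r + 1) * real (card ?C)))"
    using 1 l by (intro mult_left_mono) auto
  \<comment> \<open>The factor \<open>real r\<close> of \<open>expansion\<close> is the ratio of the
    normalisations of ordered pairs and of vertices.\<close>
  also have "\<dots> = (1 - l) * real r * (\<Sum>c\<in>?C. \<Sum>s\<in>UNIV. of_bool (?\<phi> s c \<noteq> v)) / (real r * (real r + 1) * real (card ?C))"
    using r(2) by simp
  also have "\<dots> \<le> (\<Sum>c\<in>?C. \<Sum>s\<in>UNIV. \<Sum>t\<in>UNIV. of_bool (?\<phi> s c \<noteq> ?\<phi> t c)) / (real r * (real r + 1) * real (card ?C))"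
    by (rule divide_right_mono[OF v]) simp
  also note 2
  finally show ?thesis unfolding cochain_norm_def B_def .
qed

theorem corollary7p4:
  fixes r q m :: nat
    and X :: "'v set set"
    and T :: "'t::finite coxeter_diagram"
    and L :: "'v rel"
  assumes "r \<ge> 1" and "q \<ge> 1"
    and "abstract_simplicial_complex X" and "finite X" and "has_dimension X r"
    and "(\<exists>E \<tau>. building T X E \<and> building_labelling T E \<tau> \<and> spherical_diagram T \<and>
              thick q r X \<and> admits_strongly_transitive_action r X E \<tau>)
       \<or> (\<exists>(Y :: 'u set set) \<pi> d E \<tau>.
              universal_covering \<pi> Y X \<and>
              building T Y E \<and> building_labelling T E \<tau> \<and> affine_diagram T \<and>
              has_dimension Y d \<and> d \<ge> 2 \<and> thick q d Y \<and>
              admits_strongly_transitive_action d Y E \<tau> \<and>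
              (\<exists>\<tau>'. \<forall>v\<in>vertices Y. \<tau> v = \<tau>' (\<pi> v)))"
    and "max_label T = enat m"
    and "real q \<ge> real r ^ 2 * (real m - 2)"
    and "\<exists>c :: 'a::ab_group_add. c \<noteq> 0"
    and "linear_order_on (vertices X) L"
  shows "coboundary_expander0
           (1 - sqrt (real m - 2) / (sqrt (real q) - (real r - 1) * sqrt (real m - 2)))
           TYPE('a) L X (canonical_weight r X)"
proof -
  obtain \<tau> :: "'v \<Rightarrow> 't" and a where r: "CARD('t) = r + 1" and pure: "\<And>x. x \<in> X \<Longrightarrow> \<exists>c\<in>chambers \<tau> X. x \<subseteq> c"
    and cs: "chamber_system (chambers \<tau> X) (adj \<tau> X) a q m"
    using building_quotient_chamber_system[OF assms(1-7)] by blast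
  interpret chamber_system "chambers \<tau> X" "adj \<tau> X" a q m by (rule cs)
  have faces: "faces X r = chambers \<tau> X" by (rule faces_eq_chambers[OF pure r])
  \<comment> \<open>Two types exist because \<open>r \<ge> 1\<close>, and the braid relation of any
    two gives \<open>2 \<le> k \<le> m\<close>.\<close>
  have m: "m \<ge> 2"
  proof -
    have "\<exists>s t :: 't. s \<noteq> t"
    proof (rule ccontr)
      assume "\<not> ?thesis"
      then have "(UNIV :: 't set) = {undefined}" by auto
      then have "CARD('t) = 1" by (metis card_1_singleton_iff One_nat_def)
      then show False using r assms(1) by simp
    qed
    then show ?thesis using braid by (meson order_trans)
  qed
  define \<mu> where "\<mu> = sqrt ((real m - 2) / real q)"
  define l where "l = sqrt (real m - 2) / (sqrt (real q) - (real r - 1) * sqrt (real m - 2))"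
  have sq: "sqrt (real q) > 0" using assms(2) by simp
  have \<mu>0: "\<mu> \<ge> 0" using m by (simp add: \<mu>_def)
  have \<mu>: "sqrt (real m - 2) = \<mu> * sqrt (real q)" using sq by (simp add: \<mu>_def real_sqrt_divide)
  \<comment> \<open>The hypothesis on \<open>q\<close> after taking square roots.\<close>
  have r\<mu>: "real r * \<mu> \<le> 1"
  proof -
    have "real r * sqrt (real m - 2) = sqrt (real r ^ 2 * (real m - 2))" by (simp add: real_sqrt_mult)
    also have "\<dots> \<le> sqrt (real q)" using assms(8) by simp
    finally have "real r * \<mu> * sqrt (real q) \<le> 1 * sqrt (real q)" unfolding \<mu> by (simp add: mult.assoc)
    then show ?thesis using sq mult_le_cancel_right_pos by blast
  qed
  have l_eq: "l = \<mu> / (1 - (real r - 1) * \<mu>)"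
  proof -
    have "l = (\<mu> * sqrt (real q)) / ((1 - (real r - 1) * \<mu>) * sqrt (real q))" unfolding l_def \<mu> by (simp add: algebra_simps)
    then show ?thesis using sq by simp
  qed
  have den: "1 - (real r - 1) * \<mu> \<ge> \<mu>" using r\<mu> by (simp add: algebra_simps)
  have l01: "0 \<le> l" "l \<le> 1"
    unfolding l_eq using \<mu>0 den by (auto simp: divide_le_eq_1 intro!: divide_nonneg_nonneg)
  have bound: "(1 - l) * dist_constant X (canonical_weight r X) f
      \<le> cochain_norm X (canonical_weight r X) 1 (coboundary0 L X f)" for f :: "'v set \<Rightarrow> 'a"
  proof (cases "real r * \<mu> < 1")
    case True
    have "all_pairs_bound l" unfolding all_pairs_bound_def
    proof (intro allI impI)
      fix s t :: 't assume "s \<noteq> t"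
      \<comment> \<open>The full set of types has \<open>r + 1 = (r - 1) + 2\<close> elements, hence
        \<open>r - 1\<close> steps of trickling down.\<close>
      have "l = \<mu> / (1 - real (r - 1) * \<mu>)" using assms(1) by (simp add: l_eq of_nat_diff)
      then show "cos_bound (chambers \<tau> X) (invariant (UNIV - {s}) \<inter> perp UNIV) (invariant (UNIV - {t}) \<inter> perp UNIV) l"
        using cos_bound_trickling[OF \<mu>_def, of UNIV "r - 1" s t] True \<open>s \<noteq> t\<close> m r assms(1) by simp
    qed
    then show ?thesis
      using cochain_norm_coboundary_ge[OF cs _ l01 assms(3,4) r assms(1) faces assms(10)] by blast
  next
    case False
    \<comment> \<open>Trickling down works under the strict inequality; at equality
      \<open>l = 1\<close>, and the bound reads that a norm is nonnegative.\<close>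
    then have "real r * \<mu> = 1" using r\<mu> by linarith
    then have "1 - (real r - 1) * \<mu> = \<mu>" "\<mu> \<noteq> 0" by (auto simp: algebra_simps)
    then have "l = 1" by (simp add: l_eq)
    then show ?thesis unfolding cochain_norm_def by (simp add: sum_nonneg canonical_weight_nonneg)
  qed
  have "ereal (1 - l) \<le> cbe0 TYPE('a) L X (canonical_weight r X)"
    unfolding cbe0_def using bound l01 by (intro Sup_upper) auto
  then show ?thesis unfolding coboundary_expander0_def l_def .
qed

end
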